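(* Let $k\ge 2$, let $0<p<1$ be a fixed constant, and let $\{H_n\}_{n\to\infty}$ be a sequence of $k$-uniform hypergraphs with loops such that $|V(H_n)|=n$ and $|E(H_n)|\ge p\binom{n}{k}$. Let $\pi=k_1+\dots+k_t$ be a proper partition of $k$ and let $\ell\ge 1$ be an integer. Assume that the number of labeled copies of $C_{\pi,4\ell}$ in $H_n$ is at most $p^{|E(C_{\pi,4\ell})|}n^{|V(C_{\pi,4\ell})|}+o(n^{|V(C_{\pi,4\ell})|})$. Then $\lambda_{1,\pi}(H_n)=pn^{k/2}+o(n^{k/2})$ and $\lambda_{2,\pi}(H_n)=o(n^{k/2})$.
   Context: All asymptotic notation is as $n\to\infty$. A proper partition of $k$ is an unordered list of at least two positive integers summing to $k$; an ordering $\vec\pi=(k_1,\dots,k_t)$ of it is a proper ordered partition, and $t$ denotes the number of parts. A $k$-uniform hypergraph with loops $H$ consists of a finite vertex set $V(H)$ and a collection $E(H)$ of $k$-element multisets of elements of $V(H)$. A labeled copy of a hypergraph $F$ in $H$ is an injection $\alpha:V(F)\to V(H)$ such that for every edge $E$ of $F$, $\{\alpha(x):x\in E\}$ is an edge of $H$. Adjacency map: let $W=\mathbb{R}^{V(H)}$ with standard basis $\{e_v\}$. The adjacency map $\tau_H:W^k\to\mathbb{R}$ is the $k$-linear map with $\tau_H(e_{v_1},\dots,e_{v_k})=1$ if the multiset $\{v_1,\dots,v_k\}\in E(H)$ and $0$ otherwise, extended linearly. For a $k$-linear $\sigma:W^k\to\mathbb{R}$ and ordered partition $\vec\pi=(k_1,\dots,k_t)$,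 define the $t$-linear map $\sigma_{\vec\pi}:W^{\otimes k_1}\times\dots\times W^{\otimes k_t}\to\mathbb{R}$ on tensors of standard basis vectors by $\sigma_{\vec\pi}(b_{1,1}\otimes\dots\otimes b_{1,k_1},\dots,b_{t,1}\otimes\dots\otimes b_{t,k_t})=\sigma(b_{1,1},\dots,b_{1,k_1},\dots,b_{t,1},\dots,b_{t,k_t})$, extended linearly. The spectral norm of a multilinear map $\phi:W_1\times\dots\times W_t\to\mathbb{R}$ is $\|\phi\|=\sup\{|\phi(x_1,\dots,x_t)|: x_i\in W_i,\ \|x_i\|=1\}$ (Euclidean norms). Let $J:W^k\to\mathbb{R}$ be the all-ones $k$-linear map ($J(e_{v_1},\dots,e_{v_k})=1$ for all $v_i$). With $n=|V(H)|$ and any ordering $\vec\pi$ of $\pi$, define $\lambda_{1,\pi}(H)=\|\tau_{\vec\pi}\|$ and $\lambda_{2,\pi}(H)=\|\tau_{\vec\pi}-\frac{k!|E(H)|}{n^k}J_{\vec\pi}\|$ (these do not depend on the ordering). The cycle $C_{\pi,4\ell}$. First for $\vec\pi=(1,\dots,1)$ with $t$ parts, the step $S_{\vec\pi}$: let $A$ be a set of $2^{t-1}$ vertices labeled by the binary strings of length $t-1$, and $B_2,\dots,B_t$ disjoint sets of $2^{t-2}$ vertices each labeled by binary strings of length $t-2$; the vertex set is $A\cup B_2\cup\dots\cup B_t$, and $\{a,b_2,\dots,b_t\}$ ($a\in A$, $b_j\in B_j$) is an edge iff for each $j\in\{1,\dots,t-1\}$ the code of $b_{j+1}$ equals the code of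 $a$ with its $j$-th bit removed. For general $\vec\pi=(k_1,\dots,k_t)$, $S_{\vec\pi}$ has vertex set $(A\times[k_1])\cup(B_2\times[k_2])\cup\dots\cup(B_t\times[k_t])$ and for each edge $\{a,b_2,\dots,b_t\}$ of $S_{(1,\dots,1)}$ the edge $\{(a,1),\dots,(a,k_1),(b_2,1),\dots,(b_2,k_2),\dots,(b_t,1),\dots,(b_t,k_t)\}$. The attach tuples $A^{(0)}$, $A^{(1)}$ are the ordered tuples (in lexicographic order) of vertices coming from $A$ whose binary code ends in $0$, respectively $1$. The path $P_{\vec\pi,2m}$ ($m\ge1$) is formed from $m$ copies $T_1,\dots,T_m$ of $S_{\vec\pi}$ by identifying, coordinatewise, the attach tuple $A^{(1)}$ of $T_i$ with the attach tuple $A^{(0)}$ of $T_{i+1}$ for $1\le i\le m-1$; its attach tuples are $A^{(0)}$ of $T_1$ and $A^{(1)}$ of $T_m$. For $m\ge2$, the cycle $C_{\pi,2m}$ is obtained by choosing any ordering $\vec\pi$ of $\pi$ and identifying (coordinatewise) the two attach tuples of $P_{\vec\pi,2m}$. Here $C_{\pi,4\ell}$ is this with $2m=4\ell$. *)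

theory Defs
  imports "HOL-Analysis.Analysis" "HOL-Library.Multiset" "HOL-Library.Landau_Symbols"
begin

section \<open>Hypergraphs with loops and labeled copies\<close>

record 'a hypergraph =
  verts :: "'a set"
  edges :: "'a multiset set"

definition uniform_hypergraph_with_loops :: "nat \<Rightarrow> 'a hypergraph \<Rightarrow> bool" where
  "uniform_hypergraph_with_loops k H \<longleftrightarrow>
     finite (verts H) \<and> (\<forall>E\<in>edges H. size E = k \<and> set_mset E \<subseteq> verts H)"

definition labeled_copies :: "'b hypergraph \<Rightarrow> 'a hypergraph \<Rightarrow> ('b \<Rightarrow> 'a) set" where
  "labeled_copies F H =
     {\<alpha> \<in> verts F \<rightarrow>\<^sub>E verts H.
        inj_on \<alpha> (verts F) \<and> (\<forall>E\<in>edges F. image_mset \<alpha> E \<in> edges H)}"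

definition proper_partition :: "nat \<Rightarrow> nat multiset \<Rightarrow> bool" where
  "proper_partition k \<pi> \<longleftrightarrow> size \<pi> \<ge> 2 \<and> (\<forall>i\<in>#\<pi>. i > 0) \<and> sum_mset \<pi> = k"


section \<open>Multilinear maps and the two spectral quantities\<close>

text \<open>
  A vector of $W = R^V$ is a function \<^typ>\<open>'a \<Rightarrow> real\<close>, of which only the values on
  \<open>V\<close> matter. An element of the \<open>j\<close>-fold tensor power of \<open>W\<close> is given by its coordinates
  in the basis of tensors of standard basis vectors, that is, by a function on lists, of
  which only the values on \<open>tuples V j\<close> matter. The arguments of a multilinear map are
  collected in a list.
\<close>

definition tuples :: "'a set \<Rightarrow> nat \<Rightarrow> 'a list set" where
  "tuples V j = {vs. length vs = j \<and> set vs \<subseteq> V}"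

definition std_basis :: "'a \<Rightarrow> 'a \<Rightarrow> real" where
  "std_basis v = (\<lambda>u. if u = v then 1 else 0)"

text \<open>The \<open>k\<close>-linear map on $W^k$ with value \<open>c [v\<^sub>1, \<dots>, v\<^sub>k]\<close> at the basis vectors
  of \<open>v\<^sub>1, \<dots>, v\<^sub>k\<close>.\<close>

definition multilinear_extension ::
    "'a set \<Rightarrow> nat \<Rightarrow> ('a list \<Rightarrow> real) \<Rightarrow> ('a \<Rightarrow> real) list \<Rightarrow> real" where
  "multilinear_extension V k c xs =
     (\<Sum>vs\<in>tuples V k. c vs * (\<Prod>i<k. (xs ! i) (vs ! i)))"

definition adjacency_map :: "nat \<Rightarrow> 'a hypergraph \<Rightarrow> ('a \<Rightarrow> real) list \<Rightarrow> real" where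
  "adjacency_map k H =
     multilinear_extension (verts H) k (\<lambda>vs. if mset vs \<in> edges H then 1 else 0)"

definition all_ones_map :: "nat \<Rightarrow> 'a set \<Rightarrow> ('a \<Rightarrow> real) list \<Rightarrow> real" where
  "all_ones_map k V = multilinear_extension V k (\<lambda>_. 1)"

text \<open>The map $\sigma_{\vec\pi}$ for the ordered partition \<open>ks\<close>.\<close>

definition partition_map ::
    "'a set \<Rightarrow> nat list \<Rightarrow> (('a \<Rightarrow> real) list \<Rightarrow> real) \<Rightarrow> ('a list \<Rightarrow> real) list \<Rightarrow> real" where
  "partition_map V ks \<sigma> xs =
     (\<Sum>bs | length bs = length ks \<and> (\<forall>i<length ks. bs ! i \<in> tuples V (ks ! i)).
        \<sigma> (map std_basis (concat bs)) * (\<Prod>i<length ks. (xs ! i) (bs ! i)))"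

definition spectral_norm ::
    "'a set \<Rightarrow> nat list \<Rightarrow> (('a list \<Rightarrow> real) list \<Rightarrow> real) \<Rightarrow> real" where
  "spectral_norm V ks \<phi> =
     (SUP xs \<in> {xs. length xs = length ks \<and>
                    (\<forall>i<length ks. L2_set (xs ! i) (tuples V (ks ! i)) = 1)}. \<bar>\<phi> xs\<bar>)"

definition lambda1 :: "nat list \<Rightarrow> 'a hypergraph \<Rightarrow> real" where
  "lambda1 ks H =
     spectral_norm (verts H) ks (partition_map (verts H) ks (adjacency_map (sum_list ks) H))"

definition lambda2 :: "nat list \<Rightarrow> 'a hypergraph \<Rightarrow> real" where
  "lambda2 ks H =
     (let V = verts H; k = sum_list ks in
      spectral_norm V ks (\<lambda>xs.
        partition_map V ks (adjacency_map k H) xs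
        - fact k * real (card (edges H)) / real (card V) ^ k
          * partition_map V ks (all_ones_map k V) xs))"


section \<open>Steps, paths and cycles\<close>

text \<open>
  Parts are numbered from \<open>0\<close>: \<open>PartA\<close> belongs to part \<open>0\<close> and \<open>PartB j\<close>, with
  \<open>1 \<le> j < t\<close>, is the set usually written $B_{j+1}$. Its codes arise from
  those of \<open>A\<close> by removing the \<open>j\<close>-th bit, where bits are counted from \<open>1\<close>.
\<close>

datatype step_vertex = PartA "bool list" | PartB nat "bool list"

fun part_of :: "step_vertex \<Rightarrow> nat" where
  "part_of (PartA w) = 0"
| "part_of (PartB j w) = j"

definition remove_bit :: "nat \<Rightarrow> bool list \<Rightarrow> bool list" where
  "remove_bit j w = take (j - 1) w @ drop j w"

definition simple_step :: "nat \<Rightarrow> step_vertex hypergraph" where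
  "simple_step t =
     \<lparr>verts = {PartA w | w. length w = t - 1} \<union>
              {PartB j w | j w. j \<in> {1..<t} \<and> length w = t - 2},
      edges = {mset (PartA w # map (\<lambda>j. PartB j (remove_bit j w)) [1..<t]) | w.
                 length w = t - 1}\<rparr>"

definition step :: "nat list \<Rightarrow> (step_vertex \<times> nat) hypergraph" where
  "step ks =
     (let S = simple_step (length ks) in
      \<lparr>verts = {(v, i). v \<in> verts S \<and> i \<in> {1..ks ! part_of v}},
       edges = (\<lambda>E. mset_set {(v, i). v \<in># E \<and> i \<in> {1..ks ! part_of v}}) ` edges S\<rparr>)"

text \<open>All bit strings of length \<open>n\<close> in lexicographic order.\<close>

fun bit_strings :: "nat \<Rightarrow> bool list list" where
  "bit_strings 0 = [[]]"
| "bit_strings (Suc n) = map ((#) False) (bit_strings n) @ map ((#) True) (bit_strings n)"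

definition step_attach :: "bool \<Rightarrow> nat list \<Rightarrow> (step_vertex \<times> nat) list" where
  "step_attach b ks =
     concat (map (\<lambda>w. map (\<lambda>i. (PartA (w @ [b]), i)) [1..<Suc (ks ! 0)])
       (bit_strings (length ks - 2)))"

text \<open>Identification of vertices: the quotient by the equivalence relation generated by \<open>R\<close>.\<close>

definition glue_class :: "('a \<times> 'a) set \<Rightarrow> 'a \<Rightarrow> 'a set" where
  "glue_class R v = (R \<union> R\<inverse>)\<^sup>* `` {v}"

definition glue :: "('a \<times> 'a) set \<Rightarrow> 'a hypergraph \<Rightarrow> 'a set hypergraph" where
  "glue R H =
     \<lparr>verts = glue_class R ` verts H, edges = image_mset (glue_class R) ` edges H\<rparr>"

definition disjoint_copies :: "nat \<Rightarrow> 'a hypergraph \<Rightarrow> (nat \<times> 'a) hypergraph" where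
  "disjoint_copies m H =
     \<lparr>verts = {..<m} \<times> verts H, edges = (\<Union>i<m. image_mset (Pair i) ` edges H)\<rparr>"

definition path_identifications ::
    "nat list \<Rightarrow> nat \<Rightarrow> ((nat \<times> step_vertex \<times> nat) \<times> (nat \<times> step_vertex \<times> nat)) set" where
  "path_identifications ks m =
     (\<Union>i\<in>{i. Suc i < m}.
        set (zip (map (Pair i) (step_attach True ks)) (map (Pair (Suc i)) (step_attach False ks))))"

text \<open>\<open>hpath ks m\<close> and \<open>hcycle ks m\<close> are the path and the cycle of length \<open>2 * m\<close>,
  built from \<open>m\<close> steps.\<close>

definition hpath :: "nat list \<Rightarrow> nat \<Rightarrow> (nat \<times> step_vertex \<times> nat) set hypergraph" where
  "hpath ks m = glue (path_identifications ks m) (disjoint_copies m (step ks))"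

definition hpath_attach_first :: "nat list \<Rightarrow> nat \<Rightarrow> (nat \<times> step_vertex \<times> nat) set list" where
  "hpath_attach_first ks m =
     map (\<lambda>v. glue_class (path_identifications ks m) (0, v)) (step_attach False ks)"

definition hpath_attach_last :: "nat list \<Rightarrow> nat \<Rightarrow> (nat \<times> step_vertex \<times> nat) set list" where
  "hpath_attach_last ks m =
     map (\<lambda>v. glue_class (path_identifications ks m) (m - 1, v)) (step_attach True ks)"

definition hcycle :: "nat list \<Rightarrow> nat \<Rightarrow> (nat \<times> step_vertex \<times> nat) set set hypergraph" where
  "hcycle ks m = glue (set (zip (hpath_attach_first ks m) (hpath_attach_last ks m))) (hpath ks m)"

end

theory Submission
  imports Defs "HOL-Combinatorics.Multiset_Permutations"
begin

text \<open>
  Divide the adjacency kernel by $n^{k/2}$ and let \<open>e\<close> denote the constant unit vector of each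
  tensor power. Summing out the second part of two copies of a \<open>t\<close>-partite kernel \<open>g\<close> gives a
  \<open>(t - 1)\<close>-partite kernel \<open>g'\<close> on doubled blocks. After \<open>t - 1\<close> such eliminations one is left
  with a Gram matrix \<open>K\<close>, and the trace of its \<open>m\<close>-th power is the normalized number of
  homomorphisms of the cycle built from \<open>m\<close> steps.

  By Cauchy--Schwarz the edge density bounds \<open>\<langle>e, K e\<rangle>\<close> from below by \<open>c - o(1)\<close>, where \<open>c\<close> is
  \<open>p\<close> raised to the number of edges of a step, while the cycle count bounds the trace of
  $K^{2l}$ by $c^{2l} + o(1)$. For unit vectors \<open>e\<close> and \<open>h\<close> with \<open>h\<close> orthogonal to \<open>e\<close>,
  $\langle e, K e\rangle^{2l} + \langle h, K h\rangle^{2l}$ is at most this trace, so \<open>K\<close> is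
  close to the rank one form \<open>c e \<otimes> e\<close>. This closeness lifts back through the eliminations: if the
  form of \<open>g'\<close> is close to $p^2$ times the product of the functionals \<open>\<langle>_, e\<rangle>\<close>, and \<open>g\<close> has density
  at least \<open>p - o(1)\<close>, then the form of \<open>g\<close> is close to \<open>p\<close> times that product. All
  estimates are in terms of Euclidean norms, so the last one is the claim.
\<close>

section \<open>Inner products over an index set\<close>

definition inner_on :: "'b set \<Rightarrow> ('b \<Rightarrow> real) \<Rightarrow> ('b \<Rightarrow> real) \<Rightarrow> real" where
  "inner_on A u v = (\<Sum>x\<in>A. u x * v x)"

lemma inner_on_commute: "inner_on A u v = inner_on A v u"
  by (simp add: inner_on_def mult.commute)

lemma inner_on_self_nonneg: "0 \<le> inner_on A u u"
  by (simp add: inner_on_def sum_nonneg)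

lemma inner_on_diff_scaled_left:
  "inner_on A (\<lambda>x. u x - c * v x) w = inner_on A u w - c * inner_on A v w"
  by (simp add: inner_on_def algebra_simps sum_subtractf sum_distrib_left)

lemma inner_on_diff_scaled_right:
  "inner_on A w (\<lambda>x. u x - c * v x) = inner_on A w u - c * inner_on A w v"
  by (simp add: inner_on_commute[of A w] inner_on_diff_scaled_left)

lemma inner_on_Cauchy_Schwarz: "(inner_on A u v)\<^sup>2 \<le> inner_on A u u * inner_on A v v"
  using Cauchy_Schwarz_ineq_sum[of u v A] by (simp add: inner_on_def power2_eq_square)

lemma abs_inner_on_le_sqrt:
  assumes "inner_on A u u \<le> 1" and "inner_on A v v \<le> B"
  shows "\<bar>inner_on A u v\<bar> \<le> sqrt B"
proof (rule real_le_rsqrt)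
  have "(inner_on A u v)\<^sup>2 \<le> inner_on A u u * inner_on A v v"
    by (rule inner_on_Cauchy_Schwarz)
  also have "\<dots> \<le> 1 * B"
    using assms inner_on_self_nonneg by (intro mult_mono) auto
  finally show "\<bar>inner_on A u v\<bar>\<^sup>2 \<le> B" by simp
qed

lemma inner_on_orthogonal_part:
  assumes unit_e: "inner_on A e e = 1"
  defines "h \<equiv> \<lambda>w x. w x - inner_on A w e * e x"
  shows "inner_on A e (h w) = 0" and "inner_on A (h w) (h w) \<le> inner_on A w w"
proof -
  show orth: "inner_on A e (h w) = 0"
    by (simp add: h_def inner_on_diff_scaled_right unit_e inner_on_commute[of A w])
  have "inner_on A (h w) (h w) = inner_on A w (h w)"
    using orth by (subst (1) h_def) (simp add: inner_on_diff_scaled_left)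
  also have "\<dots> = inner_on A w w - (inner_on A w e)\<^sup>2"
    by (simp add: h_def inner_on_diff_scaled_right power2_eq_square)
  finally show "inner_on A (h w) (h w) \<le> inner_on A w w" by simp
qed

section \<open>Gram kernels\<close>

lemma log_convex_power_le:
  fixes s :: "nat \<Rightarrow> real"
  assumes nonneg: "\<And>j. 0 \<le> s j"
    and log_convex: "\<And>j. (s (Suc j))\<^sup>2 \<le> s j * s (Suc (Suc j))"
    and "s 0 \<le> 1" and "j \<ge> 1"
  shows "s 1 ^ j \<le> s j"
proof -
  have growth: "s 1 * s j \<le> s (Suc j)" for j
  proof (induction j)
    case 0
    then show ?case using \<open>s 0 \<le> 1\<close> nonneg[of 1] by (simp add: mult_left_le)
  next
    case (Suc j)
    show ?case
    proof (cases "s j = 0")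
      case True
      then have "s (Suc j) = 0" using log_convex[of j] by simp
      then show ?thesis using nonneg by simp
    next
      case False
      have "s j * (s 1 * s (Suc j)) = (s 1 * s j) * s (Suc j)" by simp
      also have "\<dots> \<le> (s (Suc j))\<^sup>2"
        using mult_right_mono[OF Suc.IH nonneg] by (simp add: power2_eq_square)
      also have "\<dots> \<le> s j * s (Suc (Suc j))" by (rule log_convex)
      finally show ?thesis using False nonneg[of j] by simp
    qed
  qed
  show ?thesis using \<open>j \<ge> 1\<close>
  proof (induction j rule: nat_induct_at_least)
    case (Suc j)
    have "s 1 ^ Suc j \<le> s 1 * s j"
      using mult_left_mono[OF Suc.IH nonneg[of 1]] by simp
    also have "\<dots> \<le> s (Suc j)" by (rule growth)
    finally show ?case .
  qed simp
qed

lemma sum_PiE_lessThan_Suc: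
  fixes f :: "(nat \<Rightarrow> 'b) \<Rightarrow> 'c::comm_monoid_add"
  shows "(\<Sum>a\<in>{..<Suc n} \<rightarrow>\<^sub>E Y. f a) = (\<Sum>a\<in>{..<n} \<rightarrow>\<^sub>E Y. \<Sum>y\<in>Y. f (a(n := y)))"
proof -
  have "inj_on (\<lambda>(y, a). a(n := y)) (Y \<times> ({..<n} \<rightarrow>\<^sub>E Y))"
    by (rule inj_combinator) simp
  then have "(\<Sum>a\<in>{..<Suc n} \<rightarrow>\<^sub>E Y. f a) = (\<Sum>(y, a)\<in>Y \<times> ({..<n} \<rightarrow>\<^sub>E Y). f (a(n := y)))"
    by (simp add: lessThan_Suc PiE_insert_eq sum.reindex case_prod_unfold)
  also have "\<dots> = (\<Sum>y\<in>Y. \<Sum>a\<in>{..<n} \<rightarrow>\<^sub>E Y. f (a(n := y)))"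
    by (simp add: sum.cartesian_product)
  finally show ?thesis by (subst sum.swap)
qed

locale gram_kernel =
  fixes Y :: "'y set" and Z :: "'z set" and Q :: "'y \<Rightarrow> 'z \<Rightarrow> real"
  assumes finite_Y: "finite Y"
begin

definition gram :: "'y \<Rightarrow> 'y \<Rightarrow> real" where
  "gram x y = inner_on Z (Q x) (Q y)"

definition gram_apply :: "('y \<Rightarrow> real) \<Rightarrow> 'y \<Rightarrow> real" where
  "gram_apply u x = inner_on Y (gram x) u"

definition transpose_apply :: "('y \<Rightarrow> real) \<Rightarrow> 'z \<Rightarrow> real" where
  "transpose_apply u z = inner_on Y u (\<lambda>x. Q x z)"

primrec gram_power :: "nat \<Rightarrow> 'y \<Rightarrow> 'y \<Rightarrow> real" where
  "gram_power 0 x y = (if x = y then 1 else 0)"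
| "gram_power (Suc j) x y = (\<Sum>z\<in>Y. gram_power j x z * gram z y)"

definition trace_power :: "nat \<Rightarrow> real" where
  "trace_power m = (\<Sum>x\<in>Y. gram_power m x x)"

definition moment :: "('y \<Rightarrow> real) \<Rightarrow> nat \<Rightarrow> real" where
  "moment u j = inner_on Y u ((gram_apply ^^ j) u)"

lemma gram_commute: "gram x y = gram y x"
  unfolding gram_def by (rule inner_on_commute)

lemma inner_gram_apply:
  "inner_on Y u (gram_apply v) = inner_on Z (transpose_apply u) (transpose_apply v)"
proof -
  have "inner_on Y u (gram_apply v) = (\<Sum>x\<in>Y. \<Sum>y\<in>Y. \<Sum>z\<in>Z. (u x * Q x z) * (v y * Q y z))"
    by (simp add: inner_on_def gram_apply_def gram_def sum_distrib_left sum_distrib_right mult_ac)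
  also have "\<dots> = (\<Sum>x\<in>Y. \<Sum>z\<in>Z. \<Sum>y\<in>Y. (u x * Q x z) * (v y * Q y z))"
    by (intro sum.cong refl sum.swap)
  also have "\<dots> = (\<Sum>z\<in>Z. \<Sum>x\<in>Y. \<Sum>y\<in>Y. (u x * Q x z) * (v y * Q y z))"
    by (rule sum.swap)
  finally show ?thesis
    by (simp add: inner_on_def transpose_apply_def sum_product)
qed

lemma inner_gram_apply_commute: "inner_on Y (gram_apply u) v = inner_on Y u (gram_apply v)"
  by (subst inner_on_commute) (simp add: inner_gram_apply inner_on_commute)

lemma inner_gram_apply_nonneg: "0 \<le> inner_on Y u (gram_apply u)"
  unfolding inner_gram_apply by (rule inner_on_self_nonneg)

lemma inner_gram_apply_Cauchy_Schwarz:
  "(inner_on Y u (gram_apply v))\<^sup>2 \<le> inner_on Y u (gram_apply u) * inner_on Y v (gram_apply v)"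
  unfolding inner_gram_apply by (rule inner_on_Cauchy_Schwarz)

lemma inner_gram_apply_diff_scaled_right:
  "inner_on Y u (gram_apply (\<lambda>x. v x - c * w x))
     = inner_on Y u (gram_apply v) - c * inner_on Y u (gram_apply w)"
  by (simp add: inner_on_diff_scaled_right flip: inner_gram_apply_commute)

lemma inner_funpow_gram_apply:
  "inner_on Y ((gram_apply ^^ i) u) ((gram_apply ^^ j) v)
     = inner_on Y u ((gram_apply ^^ (i + j)) v)"
proof (induction i arbitrary: j)
  case (Suc i)
  have "inner_on Y ((gram_apply ^^ Suc i) u) ((gram_apply ^^ j) v)
      = inner_on Y ((gram_apply ^^ i) u) ((gram_apply ^^ Suc j) v)"
    by (simp add: inner_gram_apply_commute)
  also have "\<dots> = inner_on Y u ((gram_apply ^^ (i + Suc j)) v)"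
    by (rule Suc.IH)
  finally show ?case by simp
qed simp

lemma moment_1: "moment u 1 = inner_on Y u (gram_apply u)"
  by (simp add: moment_def)

lemma moment_add: "moment u (i + j) = inner_on Y ((gram_apply ^^ i) u) ((gram_apply ^^ j) u)"
  by (simp add: moment_def inner_funpow_gram_apply)

lemma moment_Suc_add:
  "moment u (Suc (i + j)) = inner_on Y ((gram_apply ^^ i) u) (gram_apply ((gram_apply ^^ j) u))"
  using moment_add[of u i "Suc j"] by simp

lemma moment_nonneg: "0 \<le> moment u j"
proof (cases "even j")
  case True
  then obtain a where "j = a + a" by (auto elim: evenE simp: mult_2)
  then show ?thesis by (simp only: moment_add inner_on_self_nonneg)
next
  case False
  then obtain a where "j = Suc (a + a)" by (auto elim: oddE simp: mult_2)
  then show ?thesis by (simp only: moment_Suc_add inner_gram_apply_nonneg)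
qed

lemma moment_log_convex: "(moment u (Suc j))\<^sup>2 \<le> moment u j * moment u (Suc (Suc j))"
proof (cases "even j")
  case True
  then obtain a where j: "j = a + a" by (auto elim: evenE simp: mult_2)
  show ?thesis
    using inner_on_Cauchy_Schwarz[of Y "(gram_apply ^^ a) u" "(gram_apply ^^ Suc a) u"]
    by (simp only: j flip: moment_add) simp
next
  case False
  then obtain a where j: "j = Suc (a + a)" by (auto elim: oddE simp: mult_2)
  show ?thesis
    using inner_gram_apply_Cauchy_Schwarz[of "(gram_apply ^^ a) u" "(gram_apply ^^ Suc a) u"]
    by (simp only: j flip: moment_Suc_add) simp
qed

lemma moment_power_le:
  assumes "inner_on Y u u \<le> 1" and "j \<ge> 1"
  shows "moment u 1 ^ j \<le> moment u j"
  using moment_nonneg moment_log_convex _ assms(2)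
  by (rule log_convex_power_le) (simp add: moment_def assms(1))

lemma sum_if_eq_mult: "x \<in> Y \<Longrightarrow> (\<Sum>y\<in>Y. (if x = y then 1 else 0) * f y) = (f x :: real)"
  using finite_Y by (simp add: if_distrib[of "\<lambda>c. c * _"] cong: if_cong)

lemma sum_gram_power: "(\<Sum>x\<in>Y. \<Sum>y\<in>Y. u x * gram_power j x y * v y)
   = inner_on Y u ((gram_apply ^^ j) v)"
proof (induction j arbitrary: v)
  case 0
  then show ?case
    by (simp add: inner_on_def mult.assoc sum_if_eq_mult flip: sum_distrib_left)
next
  case (Suc j)
  have "(\<Sum>x\<in>Y. \<Sum>y\<in>Y. u x * gram_power (Suc j) x y * v y)
      = (\<Sum>x\<in>Y. \<Sum>y\<in>Y. \<Sum>z\<in>Y. u x * gram_power j x z * (gram z y * v y))"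
    by (simp add: sum_distrib_left sum_distrib_right mult_ac)
  also have "\<dots> = (\<Sum>x\<in>Y. \<Sum>z\<in>Y. \<Sum>y\<in>Y. u x * gram_power j x z * (gram z y * v y))"
    by (intro sum.cong refl sum.swap)
  also have "\<dots> = (\<Sum>x\<in>Y. \<Sum>z\<in>Y. u x * gram_power j x z * gram_apply v z)"
    by (simp add: gram_apply_def inner_on_def sum_distrib_left)
  also have "\<dots> = inner_on Y u ((gram_apply ^^ j) (gram_apply v))" by (rule Suc.IH)
  finally show ?case by (simp only: funpow_Suc_right comp_apply)
qed

lemma gram_power_add:
  assumes "y \<in> Y"
  shows "gram_power (i + j) x y = (\<Sum>z\<in>Y. gram_power i x z * gram_power j z y)"
  using assms
proof (induction j arbitrary: y)
  case 0
  then show ?case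
    using sum_if_eq_mult[of y "gram_power i x"] by (simp add: mult.commute eq_commute)
next
  case (Suc j)
  have "gram_power (i + Suc j) x y = (\<Sum>z\<in>Y. \<Sum>w\<in>Y. gram_power i x w * (gram_power j w z * gram z y))"
    using Suc.IH by (simp add: sum_distrib_right mult.assoc)
  also have "\<dots> = (\<Sum>w\<in>Y. \<Sum>z\<in>Y. gram_power i x w * (gram_power j w z * gram z y))"
    by (rule sum.swap)
  finally show ?case by (simp add: sum_distrib_left)
qed

lemma gram_power_commute: "x \<in> Y \<Longrightarrow> y \<in> Y \<Longrightarrow> gram_power j x y = gram_power j y x"
proof (induction j arbitrary: x y)
  case (Suc j)
  have "gram_power (Suc j) y x = (\<Sum>z\<in>Y. gram_power 1 y z * gram_power j z x)"
    using gram_power_add[of x 1 j y] Suc.prems by simp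
  also have "\<dots> = (\<Sum>z\<in>Y. gram_power j x z * gram z y)"
    using Suc by (intro sum.cong) (auto simp: sum_if_eq_mult gram_commute[of y])
  finally show ?case by simp
qed auto

lemma trace_power_double: "trace_power (2 * l) = (\<Sum>x\<in>Y. \<Sum>y\<in>Y. (gram_power l x y)\<^sup>2)"
  unfolding trace_power_def
proof (intro sum.cong refl)
  fix x assume "x \<in> Y"
  then show "gram_power (2 * l) x x = (\<Sum>y\<in>Y. (gram_power l x y)\<^sup>2)"
    using gram_power_add[of x l l x] gram_power_commute[of _ x l]
    by (simp add: mult_2 power2_eq_square)
qed

text \<open>Bessel's inequality for \<open>gram_power l\<close> against \<open>e \<otimes> e\<close> and \<open>h \<otimes> h\<close>. Vectors shorter than
  one are allowed, so that \<open>h = 0\<close> yields the bound for a single vector.\<close>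

lemma moments_le_trace_power:
  assumes short_e: "inner_on Y e e \<le> 1" and short_h: "inner_on Y h h \<le> 1"
    and orth: "inner_on Y e h = 0"
  shows "(moment e l)\<^sup>2 + (moment h l)\<^sup>2 \<le> trace_power (2 * l)"
proof -
  let ?a = "moment e l" and ?b = "moment h l"
  have product: "(\<Sum>x\<in>Y. u x * v x * (\<Sum>y\<in>Y. u y * v y)) = (inner_on Y u v)\<^sup>2" for u v
    by (simp add: inner_on_def power2_eq_square flip: sum_distrib_right)
  have "0 \<le> (\<Sum>x\<in>Y. \<Sum>y\<in>Y. (gram_power l x y - ?a * (e x * e y) - ?b * (h x * h y))\<^sup>2)"
    by (intro sum_nonneg) simp
  also have "\<dots> = (\<Sum>x\<in>Y. \<Sum>y\<in>Y. (gram_power l x y)\<^sup>2 - 2 * ?a * (e x * gram_power l x y * e y)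
      - 2 * ?b * (h x * gram_power l x y * h y) + ?a\<^sup>2 * ((e x * e x) * (e y * e y))
      + ?b\<^sup>2 * ((h x * h x) * (h y * h y)) + 2 * ?a * ?b * ((e x * h x) * (e y * h y)))"
    by (intro sum.cong refl) (simp add: power2_eq_square algebra_simps)
  also have "\<dots> = trace_power (2 * l) - 2 * ?a\<^sup>2 - 2 * ?b\<^sup>2
      + ?a\<^sup>2 * (inner_on Y e e)\<^sup>2 + ?b\<^sup>2 * (inner_on Y h h)\<^sup>2"
    by (simp only: sum.distrib sum_subtractf sum_distrib_left[symmetric] product)
       (simp add: orth sum_gram_power moment_def trace_power_double power2_eq_square)
  also have "\<dots> \<le> trace_power (2 * l) - 2 * ?a\<^sup>2 - 2 * ?b\<^sup>2 + ?a\<^sup>2 * 1 + ?b\<^sup>2 * 1"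
    using short_e short_h inner_on_self_nonneg
    by (intro add_mono mult_left_mono order_refl power_le_one) auto
  finally show ?thesis by simp
qed

lemma first_moments_le_trace_power:
  assumes short_e: "inner_on Y e e \<le> 1" and short_h: "inner_on Y h h \<le> 1"
    and orth: "inner_on Y e h = 0"
    and "l \<ge> 1"
  shows "moment e 1 ^ (2 * l) + moment h 1 ^ (2 * l) \<le> trace_power (2 * l)"
proof -
  have "moment u 1 ^ (2 * l) \<le> (moment u l)\<^sup>2" if "inner_on Y u u \<le> 1" for u
    using power_mono[OF moment_power_le[OF that \<open>l \<ge> 1\<close>], of 2] moment_nonneg[of u 1]
    by (simp add: power_mult[symmetric] mult.commute)
  from this[OF short_e] this[OF short_h] moments_le_trace_power[OF short_e short_h orth, of l]
  show ?thesis by linarith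
qed

lemma first_moment_le_trace_power:
  assumes "inner_on Y e e \<le> 1" and "l \<ge> 1"
  shows "moment e 1 ^ (2 * l) \<le> trace_power (2 * l)"
proof -
  have "moment (\<lambda>_. 0) 1 = 0" by (simp add: moment_def inner_on_def)
  then show ?thesis
    using first_moments_le_trace_power[of e "\<lambda>_. 0" l] assms
    by (simp add: inner_on_def power_0_left)
qed

lemma orthogonal_moment_le_root:
  assumes "inner_on Y e e \<le> 1" and "inner_on Y h h \<le> 1" and "inner_on Y e h = 0" and "l \<ge> 1"
  shows "moment h 1 \<le> root (2 * l) (trace_power (2 * l) - moment e 1 ^ (2 * l))"
proof -
  have "moment h 1 = root (2 * l) (moment h 1 ^ (2 * l))"
    using \<open>l \<ge> 1\<close> moment_nonneg by (simp add: real_root_power_cancel)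
  also have "\<dots> \<le> root (2 * l) (trace_power (2 * l) - moment e 1 ^ (2 * l))"
    using first_moments_le_trace_power[OF assms] \<open>l \<ge> 1\<close> by (intro real_root_le_mono) auto
  finally show ?thesis .
qed

lemma abs_inner_gram_apply_le_sqrt:
  assumes "moment u 1 \<le> a" and "moment v 1 \<le> b"
  shows "\<bar>inner_on Y u (gram_apply v)\<bar> \<le> sqrt (a * b)"
proof (rule real_le_rsqrt)
  have "(inner_on Y u (gram_apply v))\<^sup>2 \<le> moment u 1 * moment v 1"
    unfolding moment_1 by (rule inner_gram_apply_Cauchy_Schwarz)
  also have "\<dots> \<le> a * b"
    using assms order_trans[OF moment_nonneg assms(1)] moment_nonneg by (intro mult_mono) auto
  finally show "\<bar>inner_on Y u (gram_apply v)\<bar>\<^sup>2 \<le> a * b" by simp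
qed

lemma rank_one_approximation:
  assumes unit_e: "inner_on Y e e = 1"
    and short_u: "inner_on Y u u \<le> 1" and short_v: "inner_on Y v v \<le> 1"
    and orthogonal_moment: "\<And>h. inner_on Y e h = 0 \<Longrightarrow> inner_on Y h h \<le> 1 \<Longrightarrow> moment h 1 \<le> \<eta>"
  shows "\<bar>inner_on Y u (gram_apply v) - moment e 1 * (inner_on Y u e * inner_on Y v e)\<bar>
    \<le> 2 * sqrt (moment e 1 * \<eta>) + \<eta>"
proof -
  define a where "a = inner_on Y u e"
  define b where "b = inner_on Y v e"
  define hu where "hu x = u x - a * e x" for x
  define hv where "hv x = v x - b * e x" for x
  have coefficients_le: "\<bar>a\<bar> \<le> 1" "\<bar>b\<bar> \<le> 1"
    using abs_inner_on_le_sqrt[of Y _ e 1] unit_e short_u short_v by (simp_all add: a_def b_def)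
  have "inner_on Y e hu = 0" "inner_on Y hu hu \<le> 1" "inner_on Y e hv = 0" "inner_on Y hv hv \<le> 1"
    using inner_on_orthogonal_part[OF unit_e, of u] inner_on_orthogonal_part[OF unit_e, of v]
      short_u short_v
    by (auto simp: hu_def[abs_def] hv_def[abs_def] a_def b_def intro: order_trans)
  then have small: "moment hu 1 \<le> \<eta>" "moment hv 1 \<le> \<eta>"
    by (blast intro: orthogonal_moment)+
  have "0 \<le> \<eta>" using moment_nonneg small(1) by (rule order_trans)
  have "inner_on Y hu (gram_apply hv)
      = inner_on Y u (gram_apply v) - b * inner_on Y u (gram_apply e)
        - a * inner_on Y e (gram_apply v) + a * b * moment e 1"
    by (simp add: hu_def[abs_def] hv_def[abs_def] inner_gram_apply_diff_scaled_right
        inner_on_diff_scaled_left moment_def algebra_simps)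
  moreover have "inner_on Y u (gram_apply e) = inner_on Y e (gram_apply hu) + a * moment e 1"
    "inner_on Y e (gram_apply v) = inner_on Y e (gram_apply hv) + b * moment e 1"
    by (simp_all add: hu_def[abs_def] hv_def[abs_def] inner_gram_apply_diff_scaled_right moment_def
        inner_gram_apply_commute inner_on_commute[of Y u])
  ultimately have "inner_on Y u (gram_apply v) - moment e 1 * (a * b)
      = a * inner_on Y e (gram_apply hv) + b * inner_on Y e (gram_apply hu)
        + inner_on Y hu (gram_apply hv)"
    by (simp only:) (simp add: algebra_simps)
  moreover have "\<bar>a * inner_on Y e (gram_apply hv)\<bar> \<le> 1 * sqrt (moment e 1 * \<eta>)"
    "\<bar>b * inner_on Y e (gram_apply hu)\<bar> \<le> 1 * sqrt (moment e 1 * \<eta>)"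
    unfolding abs_mult using coefficients_le small
    by (intro mult_mono abs_inner_gram_apply_le_sqrt; simp)+
  moreover have "\<bar>inner_on Y hu (gram_apply hv)\<bar> \<le> \<eta>"
    using abs_inner_gram_apply_le_sqrt[OF small] \<open>0 \<le> \<eta>\<close> by simp
  ultimately show ?thesis by (simp add: a_def b_def)
qed

lemma sum_walks:
  "(\<Sum>a\<in>{..<Suc j} \<rightarrow>\<^sub>E Y. (\<Prod>i<j. gram (a i) (a (Suc i))) * f (a 0) (a j))
     = (\<Sum>x\<in>Y. \<Sum>y\<in>Y. gram_power j x y * f x y)"
proof (induction j arbitrary: f)
  case 0
  then show ?case by (simp add: sum_PiE_lessThan_Suc sum_if_eq_mult)
next
  case (Suc j)
  have "(\<Sum>a\<in>{..<Suc (Suc j)} \<rightarrow>\<^sub>E Y. (\<Prod>i<Suc j. gram (a i) (a (Suc i))) * f (a 0) (a (Suc j)))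
      = (\<Sum>a\<in>{..<Suc j} \<rightarrow>\<^sub>E Y. (\<Prod>i<j. gram (a i) (a (Suc i))) * (\<Sum>z\<in>Y. gram (a j) z * f (a 0) z))"
    by (subst sum_PiE_lessThan_Suc) (simp add: sum_distrib_left mult.assoc)
  also have "\<dots> = (\<Sum>x\<in>Y. \<Sum>y\<in>Y. \<Sum>z\<in>Y. gram_power j x y * (gram y z * f x z))"
    by (subst Suc.IH[of "\<lambda>x y. \<Sum>z\<in>Y. gram y z * f x z"]) (simp add: sum_distrib_left)
  also have "\<dots> = (\<Sum>x\<in>Y. \<Sum>z\<in>Y. \<Sum>y\<in>Y. gram_power j x y * (gram y z * f x z))"
    by (intro sum.cong refl sum.swap)
  finally show ?case by (simp add: sum_distrib_right mult.assoc)
qed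

lemma trace_power_closed_walks:
  assumes "m \<ge> 1"
  shows "trace_power m = (\<Sum>a\<in>{..<m} \<rightarrow>\<^sub>E Y. \<Prod>i<m. gram (a i) (a (Suc i mod m)))"
proof -
  obtain j where m: "m = Suc j" using assms by (cases m) auto
  have "(\<Prod>i<m. gram (a i) (a (Suc i mod m))) = (\<Prod>i<j. gram (a i) (a (Suc i))) * gram (a j) (a 0)"
    for a
    by (simp add: m)
  then show ?thesis
    using sum_walks[of j "\<lambda>x y. gram y x"] by (simp add: m trace_power_def)
qed

end

section \<open>Kernels on lists of blocks\<close>

lemma finite_tuples [simp]: "finite V \<Longrightarrow> finite (tuples V L)"
  using finite_lists_length_eq[of V L] by (simp add: tuples_def conj_commute)

lemma card_tuples: "finite V \<Longrightarrow> card (tuples V L) = card V ^ L"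
  using card_lists_length_eq[of V L] by (simp add: tuples_def conj_commute)

lemma sum_tuples_add:
  "(\<Sum>z\<in>tuples V (L + M). f z) = (\<Sum>a\<in>tuples V L. \<Sum>b\<in>tuples V M. f (a @ b))"
proof -
  have "(\<Sum>z\<in>tuples V (L + M). f z) = (\<Sum>(a, b)\<in>tuples V L \<times> tuples V M. f (a @ b))"
    by (rule sum.reindex_bij_witness[of _ "\<lambda>(a, b). a @ b" "\<lambda>z. (take L z, drop L z)"])
       (auto simp: tuples_def dest: in_set_takeD in_set_dropD)
  then show ?thesis by (simp add: sum.cartesian_product)
qed

definition blocks :: "'a set \<Rightarrow> nat list \<Rightarrow> 'a list list set" where
  "blocks V ls = {bs. list_all2 (\<lambda>b L. b \<in> tuples V L) bs ls}"

lemma blocks_Nil [simp]: "blocks V [] = {[]}"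
  by (simp add: blocks_def)

lemma blocks_Cons: "blocks V (L # ls) = (\<lambda>(b, bs). b # bs) ` (tuples V L \<times> blocks V ls)"
  by (auto simp: blocks_def list_all2_Cons2)

lemma length_blocks: "bs \<in> blocks V ls \<Longrightarrow> length bs = length ls"
  by (auto simp: blocks_def dest: list_all2_lengthD)

lemma concat_blocks: "bs \<in> blocks V ls \<Longrightarrow> concat bs \<in> tuples V (sum_list ls)"
proof (induction ls arbitrary: bs)
  case (Cons L ls)
  then obtain b bs' where "bs = b # bs'" "b \<in> tuples V L" "bs' \<in> blocks V ls"
    by (auto simp: blocks_Cons)
  then show ?case using Cons.IH[of bs'] by (auto simp: tuples_def)
qed (auto simp: tuples_def)

lemma sum_blocks_Cons:
  "(\<Sum>bs\<in>blocks V (L # ls). f bs) = (\<Sum>b\<in>tuples V L. \<Sum>bs\<in>blocks V ls. f (b # bs))"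
  unfolding blocks_Cons
  by (subst sum.reindex) (auto simp: inj_on_def sum.cartesian_product intro!: sum.cong)

lemma sum_blocks_concat: "(\<Sum>bs\<in>blocks V ls. f (concat bs)) = (\<Sum>z\<in>tuples V (sum_list ls). f z)"
proof (induction ls arbitrary: f)
  case Nil
  have "tuples V 0 = {[]}" by (auto simp: tuples_def)
  then show ?case by simp
next
  case (Cons L ls)
  then show ?case using Cons[of "\<lambda>z. f (_ @ z)"] by (simp add: sum_blocks_Cons sum_tuples_add)
qed

definition pure_tensor :: "('b \<Rightarrow> real) list \<Rightarrow> 'b list \<Rightarrow> real" where
  "pure_tensor us bs = prod_list (map2 (\<lambda>u b. u b) us bs)"

lemma pure_tensor_Nil [simp]: "pure_tensor [] bs = 1"
  by (simp add: pure_tensor_def)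

lemma pure_tensor_Cons [simp]: "pure_tensor (u # us) (b # bs) = u b * pure_tensor us bs"
  by (simp add: pure_tensor_def)

lemma pure_tensor_eq_prod:
  "length us = length bs \<Longrightarrow> pure_tensor us bs = (\<Prod>i<length bs. (us ! i) (bs ! i))"
proof (induction us bs rule: list_induct2)
  case (Cons u us b bs)
  then show ?case by (simp add: prod.lessThan_Suc_shift del: prod.lessThan_Suc)
qed simp

definition tensor_form :: "'a set \<Rightarrow> nat list \<Rightarrow> ('a list list \<Rightarrow> real) \<Rightarrow> ('a list \<Rightarrow> real) list \<Rightarrow> real"
  where "tensor_form V ls g us = inner_on (blocks V ls) g (pure_tensor us)"

definition unit_vectors :: "'a set \<Rightarrow> nat list \<Rightarrow> ('a list \<Rightarrow> real) list \<Rightarrow> bool" where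
  "unit_vectors V ls us \<longleftrightarrow> list_all2 (\<lambda>u L. inner_on (tuples V L) u u = 1) us ls"

lemma unit_vectors_Nil [simp]: "unit_vectors V [] us \<longleftrightarrow> us = []"
  by (simp add: unit_vectors_def)

lemma unit_vectors_Cons [simp]:
  "unit_vectors V (L # ls) (u # us) \<longleftrightarrow> inner_on (tuples V L) u u = 1 \<and> unit_vectors V ls us"
  by (simp add: unit_vectors_def)

lemma unit_vectors_ConsE:
  assumes "unit_vectors V (L # ls) us"
  obtains u us' where "us = u # us'" "inner_on (tuples V L) u u = 1" "unit_vectors V ls us'"
  using assms by (auto simp: unit_vectors_def list_all2_Cons2)

lemma unit_vectors_length: "unit_vectors V ls us \<Longrightarrow> length us = length ls"
  unfolding unit_vectors_def by (rule list_all2_lengthD)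

lemma unit_vectors_iff_L2_set:
  "unit_vectors V ls us \<longleftrightarrow>
     length us = length ls \<and> (\<forall>i<length ls. L2_set (us ! i) (tuples V (ls ! i)) = 1)"
  by (auto simp: unit_vectors_def list_all2_conv_all_nth L2_set_def inner_on_def power2_eq_square)

lemma inner_pure_tensor_self:
  assumes "unit_vectors V ls us"
  shows "inner_on (blocks V ls) (pure_tensor us) (pure_tensor us) = 1"
  using assms
proof (induction ls arbitrary: us)
  case (Cons L ls)
  obtain u us' where us: "us = u # us'" "inner_on (tuples V L) u u = 1" "unit_vectors V ls us'"
    using Cons.prems by (rule unit_vectors_ConsE)
  have "inner_on (blocks V (L # ls)) (pure_tensor us) (pure_tensor us)
      = inner_on (tuples V L) u u * inner_on (blocks V ls) (pure_tensor us') (pure_tensor us')"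
    by (simp add: us(1) inner_on_def sum_blocks_Cons sum_product mult_ac)
  then show ?case using us Cons.IH by simp
qed (simp add: inner_on_def)

lemma abs_tensor_form_le:
  assumes "unit_vectors V ls us"
  shows "\<bar>tensor_form V ls g us\<bar> \<le> sqrt (inner_on (blocks V ls) g g)"
  unfolding tensor_form_def inner_on_commute[of _ g "pure_tensor us"]
  by (rule abs_inner_on_le_sqrt) (simp_all add: inner_pure_tensor_self[OF assms])

text \<open>One function serves as the constant unit vector of every tensor power of $R^V$.\<close>

definition uniform_vector :: "'a set \<Rightarrow> 'a list \<Rightarrow> real" where
  "uniform_vector V z = (1 / sqrt (real (card V))) ^ length z"

definition uniform_kernel :: "'a set \<Rightarrow> 'a list list \<Rightarrow> real" where
  "uniform_kernel V bs = uniform_vector V (concat bs)"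

definition kernel_density :: "'a set \<Rightarrow> nat list \<Rightarrow> ('a list list \<Rightarrow> real) \<Rightarrow> real" where
  "kernel_density V ls g = inner_on (blocks V ls) g (uniform_kernel V)"

lemma uniform_kernel_Cons: "uniform_kernel V (b # bs) = uniform_vector V b * uniform_kernel V bs"
  by (simp add: uniform_kernel_def uniform_vector_def power_add)

lemma pure_tensor_uniform:
  "pure_tensor (replicate (length bs) (uniform_vector V)) bs = uniform_kernel V bs"
  by (induction bs)
     (simp_all add: uniform_kernel_Cons, simp add: uniform_kernel_def uniform_vector_def)

lemma tensor_form_uniform:
  "tensor_form V ls g (replicate (length ls) (uniform_vector V)) = kernel_density V ls g"
  by (simp add: tensor_form_def kernel_density_def inner_on_def pure_tensor_uniform
      flip: length_blocks cong: sum.cong)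

definition kernel_norm :: "'a set \<Rightarrow> nat list \<Rightarrow> ('a list list \<Rightarrow> real) \<Rightarrow> real" where
  "kernel_norm V ls g = spectral_norm V ls (tensor_form V ls g)"

lemma kernel_norm_eq_SUP:
  "kernel_norm V ls g = (SUP us\<in>{us. unit_vectors V ls us}. \<bar>tensor_form V ls g us\<bar>)"
  by (simp add: kernel_norm_def spectral_norm_def unit_vectors_iff_L2_set)

lemma abs_tensor_form_le_kernel_norm:
  "unit_vectors V ls us \<Longrightarrow> \<bar>tensor_form V ls g us\<bar> \<le> kernel_norm V ls g"
  unfolding kernel_norm_eq_SUP
  by (intro cSUP_upper bdd_aboveI2[of _ _ "sqrt (inner_on (blocks V ls) g g)"])
     (auto intro: abs_tensor_form_le)

definition deviation :: "real \<Rightarrow> 'a set \<Rightarrow> nat list \<Rightarrow> ('a list list \<Rightarrow> real) \<Rightarrow> real" where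
  "deviation p V ls g = kernel_norm V ls (\<lambda>bs. g bs - p * uniform_kernel V bs)"

lemma tensor_form_diff_scaled:
  "tensor_form V ls (\<lambda>bs. g bs - c * h bs) us = tensor_form V ls g us - c * tensor_form V ls h us"
  by (simp add: tensor_form_def inner_on_diff_scaled_left)

lemma abs_tensor_form_diff_le_deviation:
  "unit_vectors V ls us \<Longrightarrow>
     \<bar>tensor_form V ls g us - p * tensor_form V ls (uniform_kernel V) us\<bar> \<le> deviation p V ls g"
  unfolding deviation_def
  using abs_tensor_form_le_kernel_norm[of V ls us "\<lambda>bs. g bs - p * uniform_kernel V bs"]
  by (simp add: tensor_form_diff_scaled)

context
  fixes V :: "'a set"
  assumes finite_V: "finite V" and nonempty_V: "V \<noteq> {}"
begin

lemma inner_uniform_vector_self: "inner_on (tuples V L) (uniform_vector V) (uniform_vector V) = 1"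
proof -
  have "inner_on (tuples V L) (uniform_vector V) (uniform_vector V)
      = (\<Sum>z\<in>tuples V L. (1 / real (card V)) ^ L)"
    unfolding inner_on_def
    by (intro sum.cong refl)
       (simp add: uniform_vector_def tuples_def power_mult_distrib[symmetric])
  also have "\<dots> = 1"
    using finite_V nonempty_V by (simp add: card_tuples power_divide)
  finally show ?thesis .
qed

lemma inner_uniform_kernel_self: "inner_on (blocks V ls) (uniform_kernel V) (uniform_kernel V) = 1"
  using inner_uniform_vector_self
    sum_blocks_concat[of "\<lambda>z. uniform_vector V z * uniform_vector V z"]
  by (simp add: inner_on_def uniform_kernel_def)

lemma unit_vectors_uniform: "unit_vectors V ls (replicate (length ls) (uniform_vector V))"
  by (induction ls) (simp_all add: inner_uniform_vector_self)

lemma kernel_density_uniform_kernel: "kernel_density V ls (uniform_kernel V) = 1"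
  by (simp add: kernel_density_def inner_uniform_kernel_self)

lemma abs_tensor_form_uniform_kernel_le:
  "unit_vectors V ls us \<Longrightarrow> \<bar>tensor_form V ls (uniform_kernel V) us\<bar> \<le> 1"
  using abs_tensor_form_le[of V ls us "uniform_kernel V"] by (simp add: inner_uniform_kernel_self)

lemma kernel_norm_leI:
  "(\<And>us. unit_vectors V ls us \<Longrightarrow> \<bar>tensor_form V ls g us\<bar> \<le> B) \<Longrightarrow> kernel_norm V ls g \<le> B"
  unfolding kernel_norm_eq_SUP using unit_vectors_uniform by (intro cSUP_least) auto

lemma kernel_norm_nonneg: "0 \<le> kernel_norm V ls g"
  using abs_tensor_form_le_kernel_norm[OF unit_vectors_uniform, of ls g] by linarith

lemma deviation_nonneg: "0 \<le> deviation p V ls g"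
  unfolding deviation_def by (rule kernel_norm_nonneg)

lemma abs_kernel_density_diff_le_deviation: "\<bar>kernel_density V ls g - p\<bar> \<le> deviation p V ls g"
  using abs_tensor_form_diff_le_deviation[OF unit_vectors_uniform, of ls g p]
  by (simp add: tensor_form_uniform kernel_density_uniform_kernel)

lemma kernel_norm_scale: "kernel_norm V ls (\<lambda>bs. c * g bs) = \<bar>c\<bar> * kernel_norm V ls g"
proof (rule antisym)
  have scale: "tensor_form V ls (\<lambda>bs. c * g bs) us = c * tensor_form V ls g us" for us
    by (simp add: tensor_form_def inner_on_def sum_distrib_left mult.assoc)
  show "kernel_norm V ls (\<lambda>bs. c * g bs) \<le> \<bar>c\<bar> * kernel_norm V ls g"
    by (intro kernel_norm_leI)
       (simp add: scale abs_mult abs_tensor_form_le_kernel_norm mult_left_mono)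
  show "\<bar>c\<bar> * kernel_norm V ls g \<le> kernel_norm V ls (\<lambda>bs. c * g bs)"
  proof (cases "c = 0")
    case False
    have "\<bar>tensor_form V ls g us\<bar> \<le> kernel_norm V ls (\<lambda>bs. c * g bs) / \<bar>c\<bar>"
      if "unit_vectors V ls us" for us
      using abs_tensor_form_le_kernel_norm[OF that, of "\<lambda>bs. c * g bs"] False
      by (simp add: scale abs_mult field_simps)
    then show ?thesis
      using False kernel_norm_leI[of ls g "kernel_norm V ls (\<lambda>bs. c * g bs) / \<bar>c\<bar>"]
      by (simp add: field_simps)
  qed (simp add: kernel_norm_nonneg)
qed

lemma abs_kernel_norm_diff_le_deviation:
  assumes "0 \<le> p"
  shows "\<bar>kernel_norm V ls g - p\<bar> \<le> deviation p V ls g"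
proof -
  define U where "U us = p * tensor_form V ls (uniform_kernel V) us" for us
  have abs_U_le: "\<bar>U us\<bar> \<le> p" if "unit_vectors V ls us" for us
    using abs_tensor_form_uniform_kernel_le[OF that] assms
    by (simp add: U_def abs_mult mult_left_le)
  have close: "\<bar>tensor_form V ls g us - U us\<bar> \<le> deviation p V ls g" if "unit_vectors V ls us" for us
    unfolding U_def by (rule abs_tensor_form_diff_le_deviation[OF that])
  have "kernel_norm V ls g \<le> p + deviation p V ls g"
  proof (rule kernel_norm_leI)
    fix us assume "unit_vectors V ls us"
    from abs_U_le[OF this] close[OF this] show "\<bar>tensor_form V ls g us\<bar> \<le> p + deviation p V ls g"
      by linarith
  qed
  moreover have "p - deviation p V ls g \<le> kernel_norm V ls g"
    using abs_kernel_density_diff_le_deviation[of ls g p]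
      abs_tensor_form_le_kernel_norm[OF unit_vectors_uniform, of ls g]
    by (simp add: tensor_form_uniform)
  ultimately show ?thesis by linarith
qed

lemma deviation_triangle: "deviation q V ls g \<le> deviation p V ls g + \<bar>p - q\<bar>"
  unfolding deviation_def[of q]
proof (rule kernel_norm_leI)
  fix us assume unit_us: "unit_vectors V ls us"
  define U where "U = tensor_form V ls (uniform_kernel V) us"
  have "\<bar>(p - q) * U\<bar> \<le> \<bar>p - q\<bar>"
    using abs_tensor_form_uniform_kernel_le[OF unit_us] by (simp add: U_def abs_mult mult_left_le)
  moreover have "tensor_form V ls g us - q * U = (tensor_form V ls g us - p * U) + (p - q) * U"
    by (simp add: algebra_simps)
  ultimately show "\<bar>tensor_form V ls (\<lambda>bs. g bs - q * uniform_kernel V bs) us\<bar>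
      \<le> deviation p V ls g + \<bar>p - q\<bar>"
    using abs_tensor_form_diff_le_deviation[OF unit_us, of g p]
    unfolding tensor_form_diff_scaled U_def by linarith
qed

end

section \<open>Doubled blocks\<close>

definition half :: "bool \<Rightarrow> 'a list \<Rightarrow> 'a list" where
  "half b z = (if b then drop else take) (length z div 2) z"

lemma half_append [simp]: "length x = length y \<Longrightarrow> half b (x @ y) = (if b then y else x)"
  by (simp add: half_def)

lemma half_False_append_half_True: "half False z @ half True z = z"
  by (simp add: half_def)

lemma length_half: "length (half False z) + length (half True z) = length z"
  by (simp add: half_def)

lemma half_tuples: "z \<in> tuples V (2 * L) \<Longrightarrow> half b z \<in> tuples V L"
  by (auto simp: half_def tuples_def dest: in_set_takeD in_set_dropD)

lemma sum_tuples_double: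
  "(\<Sum>z\<in>tuples V (2 * L). f (half False z) (half True z)) = (\<Sum>a\<in>tuples V L. \<Sum>b\<in>tuples V L. f a b)"
  unfolding mult_2 sum_tuples_add by (intro sum.cong refl) (simp add: tuples_def)

lemma sum_blocks_double:
  "(\<Sum>cs\<in>blocks V (map ((*) 2) ls). f (map (half False) cs) (map (half True) cs))
     = (\<Sum>bs\<in>blocks V ls. \<Sum>bs'\<in>blocks V ls. f bs bs')"
proof (induction ls arbitrary: f)
  case (Cons L ls)
  let ?f = "\<lambda>a b. \<Sum>bs\<in>blocks V ls. \<Sum>bs'\<in>blocks V ls. f (a # bs) (b # bs')"
  have "(\<Sum>cs\<in>blocks V (map ((*) 2) (L # ls)). f (map (half False) cs) (map (half True) cs))
      = (\<Sum>z\<in>tuples V (2 * L). ?f (half False z) (half True z))"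
    using Cons.IH[of "\<lambda>bs bs'. f (half False _ # bs) (half True _ # bs')"]
    by (simp add: sum_blocks_Cons)
  also have "\<dots> = (\<Sum>a\<in>tuples V L. \<Sum>b\<in>tuples V L. ?f a b)"
    by (rule sum_tuples_double)
  also have "\<dots> = (\<Sum>a\<in>tuples V L. \<Sum>bs\<in>blocks V ls. \<Sum>b\<in>tuples V L. \<Sum>bs'\<in>blocks V ls.
      f (a # bs) (b # bs'))"
    by (intro sum.cong refl sum.swap)
  finally show ?case by (simp add: sum_blocks_Cons)
qed simp

definition tensor :: "('a list \<Rightarrow> real) \<Rightarrow> ('a list \<Rightarrow> real) \<Rightarrow> 'a list \<Rightarrow> real" where
  "tensor u v z = u (half False z) * v (half True z)"

lemma pure_tensor_tensor:
  assumes "length us = length cs" and "length vs = length cs"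
  shows "pure_tensor (map2 tensor us vs) cs
     = pure_tensor us (map (half False) cs) * pure_tensor vs (map (half True) cs)"
  using assms
proof (induction cs arbitrary: us vs)
  case (Cons c cs)
  then show ?case by (cases us; cases vs) (auto simp: tensor_def)
qed auto

lemma inner_tensor:
  "inner_on (tuples V (2 * L)) (tensor u v) (tensor u' v')
     = inner_on (tuples V L) u u' * inner_on (tuples V L) v v'"
  using sum_tuples_double[of "\<lambda>a b. (u a * u' a) * (v b * v' b)" V L]
  by (simp add: inner_on_def tensor_def sum_product mult_ac)

lemma unit_vectors_tensor:
  assumes "unit_vectors V ls us" and "unit_vectors V ls vs"
  shows "unit_vectors V (map ((*) 2) ls) (map2 tensor us vs)"
  using assms
proof (induction ls arbitrary: us vs)
  case (Cons L ls)
  then show ?case by (auto simp: inner_tensor elim!: unit_vectors_ConsE)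
qed simp

lemma tensor_form_tensor:
  assumes "length us = length ls" and "length vs = length ls"
  shows "tensor_form V (map ((*) 2) ls) (\<lambda>cs. G (map (half False) cs) (map (half True) cs))
       (map2 tensor us vs)
     = (\<Sum>bs\<in>blocks V ls. \<Sum>bs'\<in>blocks V ls. G bs bs' * (pure_tensor us bs * pure_tensor vs bs'))"
  unfolding tensor_form_def inner_on_def sum_blocks_double[symmetric]
  by (intro sum.cong refl) (auto simp: assms pure_tensor_tensor dest!: length_blocks)

lemma uniform_kernel_half:
  "uniform_kernel V cs
     = uniform_kernel V (map (half False) cs) * uniform_kernel V (map (half True) cs)"
proof (induction cs)
  case (Cons c cs)
  then show ?case
    using length_half[of c]
    by (simp add: uniform_kernel_Cons uniform_vector_def flip: power_add)
qed (simp add: uniform_kernel_def uniform_vector_def)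

lemma tensor_uniform_vector: "tensor (uniform_vector V) (uniform_vector V) = uniform_vector V"
  by (simp add: tensor_def uniform_vector_def length_half fun_eq_iff flip: power_add)

lemma tensor_form_uniform_kernel_tensor:
  assumes "length us = length ls" and "length vs = length ls"
  shows "tensor_form V (map ((*) 2) ls) (uniform_kernel V) (map2 tensor us vs)
     = tensor_form V ls (uniform_kernel V) us * tensor_form V ls (uniform_kernel V) vs"
proof -
  have "tensor_form V (map ((*) 2) ls) (uniform_kernel V) (map2 tensor us vs)
      = tensor_form V (map ((*) 2) ls)
          (\<lambda>cs. uniform_kernel V (map (half False) cs) * uniform_kernel V (map (half True) cs))
          (map2 tensor us vs)"
    by (simp flip: uniform_kernel_half)
  also have "\<dots> = (\<Sum>bs\<in>blocks V ls. \<Sum>bs'\<in>blocks V ls.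
      uniform_kernel V bs * uniform_kernel V bs' * (pure_tensor us bs * pure_tensor vs bs'))"
    by (rule tensor_form_tensor[OF assms])
  finally show ?thesis
    by (simp add: tensor_form_def inner_on_def sum_product mult_ac)
qed

section \<open>Elimination of a part\<close>

fun insert_second :: "'b \<Rightarrow> 'b list \<Rightarrow> 'b list" where
  "insert_second y (b # bs) = b # y # bs"
| "insert_second y [] = [y]"

text \<open>The Cauchy--Schwarz step that produces the vertices \<open>PartB 1\<close> of the step: two copies of a
  kernel share their second block, which is summed out.\<close>

definition double :: "'a set \<Rightarrow> nat \<Rightarrow> ('a list list \<Rightarrow> real) \<Rightarrow> 'a list list \<Rightarrow> real" where
  "double V L g cs = inner_on (tuples V L)
     (\<lambda>y. g (insert_second y (map (half False) cs))) (\<lambda>y. g (insert_second y (map (half True) cs)))"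

definition slice ::
    "'a set \<Rightarrow> nat list \<Rightarrow> ('a list list \<Rightarrow> real) \<Rightarrow> ('a list \<Rightarrow> real) list \<Rightarrow> 'a list \<Rightarrow> real" where
  "slice V ls g us y = tensor_form V ls (\<lambda>bs. g (insert_second y bs)) us"

lemma tensor_form_eq_inner_slice:
  "tensor_form V (l0 # l1 # ls) g (u0 # u1 # us)
     = inner_on (tuples V l1) u1 (slice V (l0 # ls) g (u0 # us))"
proof -
  have "tensor_form V (l0 # l1 # ls) g (u0 # u1 # us)
      = (\<Sum>a\<in>tuples V l0. \<Sum>y\<in>tuples V l1. \<Sum>bs\<in>blocks V ls.
          u1 y * (g (a # y # bs) * (u0 a * pure_tensor us bs)))"
    by (simp add: tensor_form_def inner_on_def sum_blocks_Cons mult_ac)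
  also have "\<dots> = (\<Sum>y\<in>tuples V l1. \<Sum>a\<in>tuples V l0. \<Sum>bs\<in>blocks V ls.
          u1 y * (g (a # y # bs) * (u0 a * pure_tensor us bs)))"
    by (rule sum.swap)
  finally show ?thesis
    by (simp add: slice_def tensor_form_def inner_on_def sum_blocks_Cons sum_distrib_left)
qed

lemma tensor_form_double:
  assumes "length us = length ls" and "length vs = length ls"
  shows "tensor_form V (map ((*) 2) ls) (double V L g) (map2 tensor us vs)
     = inner_on (tuples V L) (slice V ls g us) (slice V ls g vs)"
proof -
  let ?B = "blocks V ls"
  let ?F = "\<lambda>us bs y. g (insert_second y bs) * pure_tensor us bs"
  have "tensor_form V (map ((*) 2) ls) (double V L g) (map2 tensor us vs)
     = (\<Sum>bs\<in>?B. \<Sum>bs'\<in>?B. inner_on (tuples V L) (\<lambda>y. g (insert_second y bs))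
         (\<lambda>y. g (insert_second y bs')) * (pure_tensor us bs * pure_tensor vs bs'))"
    using tensor_form_tensor[OF assms, of V "\<lambda>bs bs'. inner_on (tuples V L)
        (\<lambda>y. g (insert_second y bs)) (\<lambda>y. g (insert_second y bs'))"]
    by (simp add: double_def[abs_def])
  also have "\<dots> = (\<Sum>bs\<in>?B. \<Sum>bs'\<in>?B. \<Sum>y\<in>tuples V L. ?F us bs y * ?F vs bs' y)"
    by (simp only: inner_on_def sum_distrib_left sum_distrib_right mult_ac)
  also have "\<dots> = (\<Sum>bs\<in>?B. \<Sum>y\<in>tuples V L. \<Sum>bs'\<in>?B. ?F us bs y * ?F vs bs' y)"
    by (intro sum.cong refl sum.swap)
  also have "\<dots> = (\<Sum>y\<in>tuples V L. \<Sum>bs\<in>?B. \<Sum>bs'\<in>?B. ?F us bs y * ?F vs bs' y)"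
    by (rule sum.swap)
  finally show ?thesis
    by (simp add: slice_def tensor_form_def inner_on_def sum_product)
qed

lemma tensor_form_uniform_kernel_Cons_Cons:
  "tensor_form V (l0 # l1 # ls) (uniform_kernel V) (u0 # u1 # us)
     = inner_on (tuples V l1) u1 (uniform_vector V)
         * tensor_form V (l0 # ls) (uniform_kernel V) (u0 # us)"
proof -
  have "slice V (l0 # ls) (uniform_kernel V) (u0 # us) y
      = uniform_vector V y * tensor_form V (l0 # ls) (uniform_kernel V) (u0 # us)" for y
    by (simp add: slice_def tensor_form_def inner_on_def sum_blocks_Cons uniform_kernel_Cons
        sum_distrib_left mult_ac)
  then show ?thesis
    by (simp add: tensor_form_eq_inner_slice inner_on_def sum_distrib_right mult.assoc)
qed

lemma kernel_density_eq_inner_slice: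
  "kernel_density V (l0 # l1 # ls) g = inner_on (tuples V l1) (uniform_vector V)
     (slice V (l0 # ls) g (replicate (Suc (length ls)) (uniform_vector V)))"
  by (simp add: tensor_form_eq_inner_slice flip: tensor_form_uniform)

lemma kernel_density_double_eq:
  "kernel_density V (map ((*) 2) ls) (double V L g) = inner_on (tuples V L)
     (slice V ls g (replicate (length ls) (uniform_vector V)))
     (slice V ls g (replicate (length ls) (uniform_vector V)))"
  using tensor_form_double[of "replicate (length ls) (uniform_vector V)" ls
      "replicate (length ls) (uniform_vector V)" V L g]
    tensor_form_uniform[of V "map ((*) 2) ls" "double V L g"]
  by (simp add: zip_replicate tensor_uniform_vector)

lemma inner_close_to_product:
  assumes short_v: "inner_on Y v v \<le> 1" and unit_e: "inner_on Y e e = 1"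
    and abs_a_le: "\<bar>a\<bar> \<le> 1" and "0 < p"
    and FF_close: "\<bar>inner_on Y F F - p\<^sup>2 * (a * a)\<bar> \<le> \<delta>"
    and FG_close: "\<bar>inner_on Y F G - p\<^sup>2 * a\<bar> \<le> \<delta>"
    and GG_close: "\<bar>inner_on Y G G - p\<^sup>2\<bar> \<le> \<delta>"
    and low: "p - \<delta>' \<le> inner_on Y e G"
  shows "\<bar>inner_on Y v F - p * (a * inner_on Y v e)\<bar> \<le> 2 * sqrt \<delta> + sqrt (\<delta> + 2 * p * \<delta>')"
proof -
  have "inner_on Y (\<lambda>y. F y - a * G y) (\<lambda>y. F y - a * G y)
      = (inner_on Y F F - p\<^sup>2 * (a * a)) - 2 * (a * (inner_on Y F G - p\<^sup>2 * a))
        + a * a * (inner_on Y G G - p\<^sup>2)"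
    by (simp add: inner_on_diff_scaled_left inner_on_diff_scaled_right inner_on_commute[of Y G F]
        algebra_simps)
  moreover have "\<bar>a * (inner_on Y F G - p\<^sup>2 * a)\<bar> \<le> 1 * \<delta>"
    unfolding abs_mult using abs_a_le FG_close by (intro mult_mono) auto
  moreover have "\<bar>a * a * (inner_on Y G G - p\<^sup>2)\<bar> \<le> 1 * 1 * \<delta>"
    unfolding abs_mult using abs_a_le GG_close by (intro mult_mono) auto
  ultimately have "inner_on Y (\<lambda>y. F y - a * G y) (\<lambda>y. F y - a * G y) \<le> 4 * \<delta>"
    using FF_close by linarith
  then have FaG: "\<bar>inner_on Y v (\<lambda>y. F y - a * G y)\<bar> \<le> 2 * sqrt \<delta>"
    using abs_inner_on_le_sqrt[OF short_v] by (fastforce simp: real_sqrt_mult)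
  have "inner_on Y (\<lambda>y. G y - p * e y) (\<lambda>y. G y - p * e y)
      = inner_on Y G G - 2 * (p * inner_on Y e G) + p\<^sup>2"
    by (simp add: inner_on_diff_scaled_left inner_on_diff_scaled_right inner_on_commute[of Y G e]
        unit_e algebra_simps power2_eq_square)
  moreover have "p * (p - \<delta>') \<le> p * inner_on Y e G"
    using low \<open>0 < p\<close> by (intro mult_left_mono) auto
  ultimately have "inner_on Y (\<lambda>y. G y - p * e y) (\<lambda>y. G y - p * e y) \<le> \<delta> + 2 * p * \<delta>'"
    using GG_close by (simp add: algebra_simps power2_eq_square)
  then have Gpe: "\<bar>inner_on Y v (\<lambda>y. G y - p * e y)\<bar> \<le> sqrt (\<delta> + 2 * p * \<delta>')"
    by (rule abs_inner_on_le_sqrt[OF short_v])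
  have "\<bar>a * inner_on Y v (\<lambda>y. G y - p * e y)\<bar> \<le> 1 * sqrt (\<delta> + 2 * p * \<delta>')"
    unfolding abs_mult using abs_a_le Gpe by (intro mult_mono) auto
  moreover have "inner_on Y v F - p * (a * inner_on Y v e)
      = inner_on Y v (\<lambda>y. F y - a * G y) + a * inner_on Y v (\<lambda>y. G y - p * e y)"
    by (simp add: inner_on_diff_scaled_right algebra_simps)
  ultimately show ?thesis using FaG by linarith
qed

context
  fixes V :: "'a set"
  assumes finite_V: "finite V" and nonempty_V: "V \<noteq> {}"
begin

lemma kernel_density_power2_le_double:
  "(kernel_density V (l0 # l1 # ls) g)\<^sup>2 \<le> kernel_density V (map ((*) 2) (l0 # ls)) (double V l1 g)"
  using inner_on_Cauchy_Schwarz[of "tuples V l1" "uniform_vector V"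
      "slice V (l0 # ls) g (replicate (Suc (length ls)) (uniform_vector V))"]
  unfolding kernel_density_eq_inner_slice kernel_density_double_eq
  by (simp add: inner_uniform_vector_self[OF finite_V nonempty_V])

text \<open>By \<open>x\<^sup>2 \<ge> 2 p x - p\<^sup>2\<close>, no bound on \<open>\<delta>\<close> is needed.\<close>

lemma kernel_density_double_ge:
  assumes "0 < p" and "p - \<delta> \<le> kernel_density V (l0 # l1 # ls) g"
  shows "p\<^sup>2 - 2 * p * \<delta> \<le> kernel_density V (map ((*) 2) (l0 # ls)) (double V l1 g)"
proof -
  let ?x = "kernel_density V (l0 # l1 # ls) g"
  have "p * (p - \<delta>) \<le> p * ?x" using assms by simp
  then have "p\<^sup>2 - 2 * p * \<delta> \<le> 2 * p * ?x - p\<^sup>2" by (simp add: algebra_simps power2_eq_square)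
  also have "\<dots> \<le> ?x\<^sup>2" using zero_le_power2[of "?x - p"] by (simp add: power2_diff algebra_simps)
  also note kernel_density_power2_le_double
  finally show ?thesis .
qed

lemma deviation_le_of_double_close:
  assumes "0 < p" and low: "p - \<delta>' \<le> kernel_density V (l0 # l1 # ls) g"
    and close: "\<And>us vs. unit_vectors V (l0 # ls) us \<Longrightarrow> unit_vectors V (l0 # ls) vs \<Longrightarrow>
      \<bar>tensor_form V (map ((*) 2) (l0 # ls)) (double V l1 g) (map2 tensor us vs)
        - p\<^sup>2 * tensor_form V (map ((*) 2) (l0 # ls)) (uniform_kernel V) (map2 tensor us vs)\<bar> \<le> \<delta>"
  shows "deviation p V (l0 # l1 # ls) g \<le> 2 * sqrt \<delta> + sqrt (\<delta> + 2 * p * \<delta>')"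
  unfolding deviation_def
proof (rule kernel_norm_leI[OF finite_V nonempty_V])
  let ?Y = "tuples V l1" and ?S = "slice V (l0 # ls) g"
  let ?U = "tensor_form V (l0 # ls) (uniform_kernel V)"
  define E where "E = replicate (Suc (length ls)) (uniform_vector V)"
  have unit_E: "unit_vectors V (l0 # ls) E"
    using unit_vectors_uniform[OF finite_V nonempty_V, of "l0 # ls"] by (simp add: E_def)
  have "?U E = 1"
    using tensor_form_uniform[of V "l0 # ls"] kernel_density_uniform_kernel[OF finite_V nonempty_V]
    by (simp add: E_def)
  fix us assume "unit_vectors V (l0 # l1 # ls) us"
  then obtain u0 u1 us' where us: "us = u0 # u1 # us'" and unit_u1: "inner_on ?Y u1 u1 = 1"
    and unit_rest: "unit_vectors V (l0 # ls) (u0 # us')"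
    by (auto elim!: unit_vectors_ConsE)
  have slices_close: "\<bar>inner_on ?Y (?S vs) (?S ws) - p\<^sup>2 * (?U vs * ?U ws)\<bar> \<le> \<delta>"
    if "unit_vectors V (l0 # ls) vs" "unit_vectors V (l0 # ls) ws" for vs ws
    using close[OF that] that[THEN unit_vectors_length]
    by (simp only: tensor_form_double tensor_form_uniform_kernel_tensor)
  have "\<bar>inner_on ?Y u1 (?S (u0 # us'))
        - p * (?U (u0 # us') * inner_on ?Y u1 (uniform_vector V))\<bar>
      \<le> 2 * sqrt \<delta> + sqrt (\<delta> + 2 * p * \<delta>')"
  proof (rule inner_close_to_product)
    show "\<bar>?U (u0 # us')\<bar> \<le> 1"
      by (rule abs_tensor_form_uniform_kernel_le[OF finite_V nonempty_V unit_rest])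
    show "p - \<delta>' \<le> inner_on ?Y (uniform_vector V) (?S E)"
      using low by (simp add: kernel_density_eq_inner_slice E_def)
  qed (use slices_close[OF unit_rest unit_rest] slices_close[OF unit_rest unit_E]
      slices_close[OF unit_E unit_E] \<open>?U E = 1\<close> unit_u1 \<open>0 < p\<close>
      inner_uniform_vector_self[OF finite_V nonempty_V] in simp_all)
  then show "\<bar>tensor_form V (l0 # l1 # ls) (\<lambda>bs. g bs - p * uniform_kernel V bs) us\<bar>
      \<le> 2 * sqrt \<delta> + sqrt (\<delta> + 2 * p * \<delta>')"
    unfolding us tensor_form_diff_scaled tensor_form_uniform_kernel_Cons_Cons
    by (simp add: tensor_form_eq_inner_slice mult.commute)
qed

lemma deviation_le_deviation_double:
  assumes "0 < p" and "p - \<delta> \<le> kernel_density V (l0 # l1 # ls) g"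
  defines "D \<equiv> deviation (p\<^sup>2) V (map ((*) 2) (l0 # ls)) (double V l1 g)"
  shows "deviation p V (l0 # l1 # ls) g \<le> 2 * sqrt D + sqrt (D + 2 * p * \<delta>)"
  using assms(1,2)
proof (rule deviation_le_of_double_close)
  fix us vs assume "unit_vectors V (l0 # ls) us" "unit_vectors V (l0 # ls) vs"
  then have "unit_vectors V (map ((*) 2) (l0 # ls)) (map2 tensor us vs)"
    by (rule unit_vectors_tensor)
  then show "\<bar>tensor_form V (map ((*) 2) (l0 # ls)) (double V l1 g) (map2 tensor us vs)
      - p\<^sup>2 * tensor_form V (map ((*) 2) (l0 # ls)) (uniform_kernel V) (map2 tensor us vs)\<bar> \<le> D"
    unfolding D_def by (rule abs_tensor_form_diff_le_deviation)
qed

end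

section \<open>Block assignments of the cycle\<close>

definition bits :: "nat \<Rightarrow> bool list set" where
  "bits s = {w. length w = s}"

lemma finite_bits [simp]: "finite (bits s)"
  using finite_lists_length_eq[of "UNIV :: bool set" s] by (simp add: bits_def)

lemma card_bits: "card (bits s) = 2 ^ s"
  using card_lists_length_eq[of "UNIV :: bool set" s] by (simp add: bits_def)

lemma prod_bits_Suc:
  fixes f :: "bool list \<Rightarrow> 'b::comm_monoid_mult"
  shows "(\<Prod>w\<in>bits (Suc s). f w) = (\<Prod>w\<in>bits s. f (False # w) * f (True # w))"
proof -
  have "(\<Prod>w\<in>bits (Suc s). f w) = (\<Prod>(w, b)\<in>bits s \<times> UNIV. f (b # w))"
    by (rule prod.reindex_bij_witness[of _ "\<lambda>(w, b). b # w" "\<lambda>w. (tl w, hd w)"])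
       (auto simp: bits_def length_Suc_conv)
  also have "\<dots> = (\<Prod>w\<in>bits s. \<Prod>b\<in>UNIV. f (b # w))"
    by (simp add: prod.cartesian_product)
  finally show ?thesis by (simp add: UNIV_bool mult.commute)
qed

text \<open>A block is a pair of the number of a step and a vertex of the simple step with \<open>t\<close> parts.
  After all identifications, the blocks in \<open>A\<close> whose code ends in \<open>False\<close> represent every block
  in \<open>A\<close>.\<close>

fun cycle_block :: "nat \<Rightarrow> step_vertex \<Rightarrow> bool" where
  "cycle_block t (PartA w) \<longleftrightarrow> length w = t - 1 \<and> \<not> last w"
| "cycle_block t (PartB j w) \<longleftrightarrow> j \<in> {1..<t} \<and> length w = t - 2"

definition cycle_blocks :: "nat \<Rightarrow> nat \<Rightarrow> (nat \<times> step_vertex) set" where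
  "cycle_blocks m t = {..<m} \<times> {v. cycle_block t v}"

fun block_rep :: "nat \<Rightarrow> nat \<times> step_vertex \<Rightarrow> nat \<times> step_vertex" where
  "block_rep m (i, PartA w) =
     (if last w then (Suc i mod m, PartA (butlast w @ [False])) else (i, PartA w))"
| "block_rep m (i, PartB j w) = (i, PartB j w)"

definition assignments :: "nat \<Rightarrow> 'a set \<Rightarrow> nat list \<Rightarrow> (nat \<times> step_vertex \<Rightarrow> 'a list) set" where
  "assignments m V ls = (\<Pi>\<^sub>E x\<in>cycle_blocks m (length ls). tuples V (ls ! part_of (snd x)))"

definition step_edge :: "nat \<Rightarrow> bool list \<Rightarrow> step_vertex list" where
  "step_edge t w = PartA w # map (\<lambda>j. PartB j (remove_bit j w)) [1..<t]"

definition edge_blocks :: "nat \<Rightarrow> nat \<Rightarrow> (nat \<times> step_vertex \<Rightarrow> 'b) \<Rightarrow> nat \<Rightarrow> bool list \<Rightarrow> 'b list" where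
  "edge_blocks m t \<phi> i w = map (\<lambda>v. \<phi> (block_rep m (i, v))) (step_edge t w)"

text \<open>For the indicator kernel of the edges, this is the number of homomorphisms of the cycle built
  from \<open>m\<close> steps, grouped into blocks.\<close>

definition cycle_sum :: "nat \<Rightarrow> 'a set \<Rightarrow> nat list \<Rightarrow> ('a list list \<Rightarrow> real) \<Rightarrow> real" where
  "cycle_sum m V ls g = (\<Sum>\<phi>\<in>assignments m V ls.
     \<Prod>i<m. \<Prod>w\<in>bits (length ls - 1). g (edge_blocks m (length ls) \<phi> i w))"

lemma assignments_tuples:
  "\<phi> \<in> assignments m V ls \<Longrightarrow> x \<in> cycle_blocks m (length ls) \<Longrightarrow> \<phi> x \<in> tuples V (ls ! part_of (snd x))"
  unfolding assignments_def by (rule PiE_mem)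

lemma cycle_sum_scale:
  "cycle_sum m V ls (\<lambda>bs. c * g bs) = c ^ (m * 2 ^ (length ls - 1)) * cycle_sum m V ls g"
  by (simp add: cycle_sum_def prod.distrib card_bits sum_distrib_left mult.commute flip: power_mult)

lemma sum_PiE_Times_pair:
  assumes "x \<noteq> y"
  shows "(\<Sum>\<phi>\<in>(\<Pi>\<^sub>E z\<in>I \<times> {x, y}. S (snd z)). f (\<lambda>i\<in>I. \<phi> (i, x)) (\<lambda>i\<in>I. \<phi> (i, y)))
     = (\<Sum>a\<in>I \<rightarrow>\<^sub>E S x. \<Sum>b\<in>I \<rightarrow>\<^sub>E S y. f a b)"
proof -
  have "(\<Sum>\<phi>\<in>(\<Pi>\<^sub>E z\<in>I \<times> {x, y}. S (snd z)). f (\<lambda>i\<in>I. \<phi> (i, x)) (\<lambda>i\<in>I. \<phi> (i, y)))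
      = (\<Sum>(a, b)\<in>(I \<rightarrow>\<^sub>E S x) \<times> (I \<rightarrow>\<^sub>E S y). f a b)"
  proof (rule sum.reindex_bij_witness[of _
        "\<lambda>(a, b). \<lambda>z\<in>I \<times> {x, y}. if snd z = x then a (fst z) else b (fst z)"
        "\<lambda>\<phi>. (\<lambda>i\<in>I. \<phi> (i, x), \<lambda>i\<in>I. \<phi> (i, y))"])
    fix \<phi> assume \<phi>: "\<phi> \<in> (\<Pi>\<^sub>E z\<in>I \<times> {x, y}. S (snd z))"
    then show "(\<lambda>i\<in>I. \<phi> (i, x), \<lambda>i\<in>I. \<phi> (i, y)) \<in> (I \<rightarrow>\<^sub>E S x) \<times> (I \<rightarrow>\<^sub>E S y)"
      by (auto simp: PiE_iff)
  qed (use assms in \<open>auto simp: fun_eq_iff PiE_iff extensional_def\<close>)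
  then show ?thesis by (simp add: sum.cartesian_product)
qed

lemma cycle_blocks_2: "cycle_blocks m 2 = {..<m} \<times> {PartA [False], PartB 1 []}"
proof -
  have "cycle_block 2 v \<longleftrightarrow> v = PartA [False] \<or> v = PartB 1 []" for v
    by (cases v) (auto simp: length_Suc_conv numeral_2_eq_2)
  then show ?thesis by (auto simp: cycle_blocks_def)
qed

lemma cycle_sum_pair:
  assumes "finite V"
  shows "cycle_sum m V [l0, l1] g = (\<Sum>a\<in>{..<m} \<rightarrow>\<^sub>E tuples V l0. \<Prod>i<m.
     inner_on (tuples V l1) (\<lambda>y. g [a i, y]) (\<lambda>y. g [a (Suc i mod m), y]))"
proof -
  let ?f = "\<lambda>a b. \<Prod>i<m. g [a i, b i] * g [a (Suc i mod m), b i]"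
  let ?a = "\<lambda>\<phi>. \<lambda>i\<in>{..<m}. \<phi> (i, PartA [False])" and ?b = "\<lambda>\<phi>. \<lambda>i\<in>{..<m}. \<phi> (i, PartB 1 [])"
  have "bits 0 = {[]}" by (auto simp: bits_def)
  have "(\<Prod>i<m. \<Prod>w\<in>bits 1. g (edge_blocks m 2 \<phi> i w)) = ?f (?a \<phi>) (?b \<phi>)" for \<phi>
  proof (intro prod.cong refl)
    fix i assume "i \<in> {..<m}"
    moreover from this have "Suc i mod m < m" by simp
    moreover have "[Suc 0..<2] = [1]" by (simp add: upt_rec)
    ultimately show "(\<Prod>w\<in>bits 1. g (edge_blocks m 2 \<phi> i w))
        = g [?a \<phi> i, ?b \<phi> i] * g [?a \<phi> (Suc i mod m), ?b \<phi> i]"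
      using \<open>bits 0 = {[]}\<close>
      by (simp add: prod_bits_Suc edge_blocks_def step_edge_def remove_bit_def)
  qed
  then have "cycle_sum m V [l0, l1] g = (\<Sum>\<phi>\<in>assignments m V [l0, l1]. ?f (?a \<phi>) (?b \<phi>))"
    by (simp add: cycle_sum_def numeral_2_eq_2)
  also have "\<dots> = (\<Sum>a\<in>{..<m} \<rightarrow>\<^sub>E tuples V l0. \<Sum>b\<in>{..<m} \<rightarrow>\<^sub>E tuples V l1. ?f a b)"
    using sum_PiE_Times_pair[of "PartA [False]" "PartB 1 []" ?f "{..<m}"
        "\<lambda>v. tuples V ([l0, l1] ! part_of v)"]
    by (simp add: assignments_def cycle_blocks_2[unfolded numeral_2_eq_2])
  finally show ?thesis using assms by (simp add: inner_on_def prod_sum_PiE)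
qed

text \<open>When a part is eliminated, each block of the cycle with one part less combines two blocks,
  whose codes extend its code by a first bit.\<close>

fun lift_block :: "bool \<Rightarrow> nat \<times> step_vertex \<Rightarrow> nat \<times> step_vertex" where
  "lift_block b (i, PartA w) = (i, PartA (b # w))"
| "lift_block b (i, PartB j w) = (i, PartB (Suc j) (b # w))"

fun split_block ::
  "(nat \<times> step_vertex \<Rightarrow> 'a list) \<Rightarrow> (nat \<times> bool list \<Rightarrow> 'a list) \<Rightarrow> nat \<times> step_vertex \<Rightarrow> 'a list" where
  "split_block \<psi> \<eta> (i, PartA w) = half (hd w) (\<psi> (i, PartA (tl w)))"
| "split_block \<psi> \<eta> (i, PartB j w) =
     (if j = 1 then \<eta> (i, w) else half (hd w) (\<psi> (i, PartB (j - 1) (tl w))))"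

lemma lift_block_in_cycle_blocks:
  "2 \<le> t \<Longrightarrow> x \<in> cycle_blocks m t \<Longrightarrow> lift_block b x \<in> cycle_blocks m (Suc t)"
  by (cases "(b, x)" rule: lift_block.cases) (auto simp: cycle_blocks_def)

lemma PartB_1_in_cycle_blocks:
  "2 \<le> t \<Longrightarrow> i < m \<Longrightarrow> w \<in> bits (t - 1) \<Longrightarrow> (i, PartB (Suc 0) w) \<in> cycle_blocks m (Suc t)"
  by (auto simp: cycle_blocks_def bits_def)

lemma cycle_blocks_SucE:
  assumes "x \<in> cycle_blocks m (Suc t)" and "2 \<le> t"
  obtains (lifted) b y where "x = lift_block b y" "y \<in> cycle_blocks m t"
  | (eliminated) i w where "x = (i, PartB (Suc 0) w)" "i < m" "w \<in> bits (t - 1)"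
proof -
  obtain i v where x: "x = (i, v)" "i < m" and v: "cycle_block (Suc t) v"
    using assms(1) by (auto simp: cycle_blocks_def)
  show thesis
  proof (cases v)
    case (PartA w)
    then obtain b w' where "w = b # w'" "length w' = t - 1"
      using v assms(2) by (cases w) auto
    then have "x = lift_block b (i, PartA w')" "(i, PartA w') \<in> cycle_blocks m t"
      using x v PartA assms(2) by (auto simp: cycle_blocks_def split: if_splits)
    then show thesis by (rule lifted)
  next
    case (PartB j w)
    show thesis
    proof (cases "j = 1")
      case True
      then show thesis using eliminated x v PartB by (auto simp: bits_def)
    next
      case False
      then obtain j' b w' where "j = Suc j'" "1 \<le> j'" "w = b # w'" "length w' = t - 2"
        using v PartB assms(2) by (cases j; cases w) auto
      then have "x = lift_block b (i, PartB j' w')" "(i, PartB j' w') \<in> cycle_blocks m t"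
        using x v PartB by (auto simp: cycle_blocks_def)
      then show thesis by (rule lifted)
    qed
  qed
qed

lemma split_block_lift_block:
  "x \<in> cycle_blocks m t \<Longrightarrow> split_block \<psi> \<eta> (lift_block b x) = half b (\<psi> x)"
  by (cases "(b, x)" rule: lift_block.cases) (auto simp: cycle_blocks_def)

lemma nth_part_of_lift_block:
  "x \<in> cycle_blocks m t \<Longrightarrow>
     (l0 # l1 # ls) ! part_of (snd (lift_block b x)) = (l0 # ls) ! part_of (snd x)"
  by (cases "(b, x)" rule: lift_block.cases) (auto simp: cycle_blocks_def nth_Cons')

lemma part_of_less: "x \<in> cycle_blocks m t \<Longrightarrow> 0 < t \<Longrightarrow> part_of (snd x) < t"
  by (cases "snd x") (auto simp: cycle_blocks_def)

definition split_blocks ::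
  "nat \<Rightarrow> nat \<Rightarrow> (nat \<times> step_vertex \<Rightarrow> 'a list) \<Rightarrow> (nat \<times> bool list \<Rightarrow> 'a list) \<Rightarrow>
     nat \<times> step_vertex \<Rightarrow> 'a list" where
  "split_blocks m t \<psi> \<eta> = restrict (split_block \<psi> \<eta>) (cycle_blocks m (Suc t))"

definition merge_blocks ::
  "nat \<Rightarrow> nat \<Rightarrow> (nat \<times> step_vertex \<Rightarrow> 'a list) \<Rightarrow> nat \<times> step_vertex \<Rightarrow> 'a list" where
  "merge_blocks m t \<phi> = (\<lambda>x\<in>cycle_blocks m t. \<phi> (lift_block False x) @ \<phi> (lift_block True x))"

definition eliminated_blocks ::
  "nat \<Rightarrow> nat \<Rightarrow> (nat \<times> step_vertex \<Rightarrow> 'a list) \<Rightarrow> nat \<times> bool list \<Rightarrow> 'a list" where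
  "eliminated_blocks m t \<phi> = (\<lambda>x\<in>{..<m} \<times> bits (t - 1). \<phi> (fst x, PartB (Suc 0) (snd x)))"

lemma split_blocks_lift_block:
  "2 \<le> t \<Longrightarrow> x \<in> cycle_blocks m t \<Longrightarrow> split_blocks m t \<psi> \<eta> (lift_block b x) = half b (\<psi> x)"
  by (simp add: split_blocks_def lift_block_in_cycle_blocks split_block_lift_block)

lemma split_blocks_PartB_1:
  "2 \<le> t \<Longrightarrow> i < m \<Longrightarrow> w \<in> bits (t - 1) \<Longrightarrow> split_blocks m t \<psi> \<eta> (i, PartB (Suc 0) w) = \<eta> (i, w)"
  using PartB_1_in_cycle_blocks[of t i m w] by (simp add: split_blocks_def)

lemma split_blocks_in_assignments:
  assumes \<psi>: "\<psi> \<in> assignments m V (map ((*) 2) (l0 # ls))"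
    and \<eta>: "\<eta> \<in> {..<m} \<times> bits (length ls) \<rightarrow>\<^sub>E tuples V l1"
    and two_parts: "2 \<le> Suc (length ls)"
  shows "split_blocks m (Suc (length ls)) \<psi> \<eta> \<in> assignments m V (l0 # l1 # ls)"
  unfolding assignments_def
proof (rule PiE_I)
  fix x assume "x \<in> cycle_blocks m (length (l0 # l1 # ls))"
  then have "x \<in> cycle_blocks m (Suc (Suc (length ls)))" by simp
  then show "split_blocks m (Suc (length ls)) \<psi> \<eta> x \<in> tuples V ((l0 # l1 # ls) ! part_of (snd x))"
    using two_parts
  proof (cases rule: cycle_blocks_SucE)
    case (lifted b y)
    then have "\<psi> y \<in> tuples V (2 * (l0 # ls) ! part_of (snd y))"
      using assignments_tuples[OF \<psi>, of y] part_of_less[of y m "Suc (length ls)"]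
      by (simp del: list.map add: nth_map)
    then have "half b (\<psi> y) \<in> tuples V ((l0 # ls) ! part_of (snd y))" by (rule half_tuples)
    then show ?thesis
      using lifted by (simp add: split_blocks_lift_block[OF two_parts] nth_part_of_lift_block)
  next
    case (eliminated i w)
    then show ?thesis
      using PiE_mem[OF \<eta>, of "(i, w)"] by (simp add: split_blocks_PartB_1[OF two_parts])
  qed
qed (simp add: split_blocks_def)

lemma lift_block_tuples:
  assumes "\<phi> \<in> assignments m V (l0 # l1 # ls)" and "2 \<le> Suc (length ls)"
    and x: "x \<in> cycle_blocks m (Suc (length ls))"
  shows "\<phi> (lift_block b x) \<in> tuples V ((l0 # ls) ! part_of (snd x))"
  using assignments_tuples[OF assms(1), of "lift_block b x"]
    lift_block_in_cycle_blocks[OF assms(2) x]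
  by (simp add: nth_part_of_lift_block[OF x])

lemma merge_blocks_in_assignments:
  assumes \<phi>: "\<phi> \<in> assignments m V (l0 # l1 # ls)" and two_parts: "2 \<le> Suc (length ls)"
  shows "merge_blocks m (Suc (length ls)) \<phi> \<in> assignments m V (map ((*) 2) (l0 # ls))"
  unfolding assignments_def
proof (rule PiE_I)
  fix x assume "x \<in> cycle_blocks m (length (map ((*) 2) (l0 # ls)))"
  then have x: "x \<in> cycle_blocks m (Suc (length ls))" by simp
  have "\<phi> (lift_block False x) @ \<phi> (lift_block True x) \<in> tuples V (2 * (l0 # ls) ! part_of (snd x))"
    using lift_block_tuples[OF \<phi> two_parts x] by (auto simp: tuples_def)
  then show "merge_blocks m (Suc (length ls)) \<phi> x
      \<in> tuples V (map ((*) 2) (l0 # ls) ! part_of (snd x))"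
    using x part_of_less[OF x] by (simp del: list.map add: merge_blocks_def nth_map)
qed (simp add: merge_blocks_def)

lemma eliminated_blocks_in:
  assumes "\<phi> \<in> assignments m V (l0 # l1 # ls)" and "2 \<le> Suc (length ls)"
  shows "eliminated_blocks m (Suc (length ls)) \<phi> \<in> {..<m} \<times> bits (length ls) \<rightarrow>\<^sub>E tuples V l1"
proof -
  have "\<phi> (i, PartB 1 w) \<in> tuples V l1" if "i < m" "w \<in> bits (length ls)" for i w
    using assignments_tuples[OF assms(1), of "(i, PartB 1 w)"]
      PartB_1_in_cycle_blocks[OF assms(2), of i m w] that by simp
  then show ?thesis by (auto simp: eliminated_blocks_def)
qed

lemma split_merge_blocks:
  assumes \<phi>: "\<phi> \<in> assignments m V (l0 # l1 # ls)" and two_parts: "2 \<le> Suc (length ls)"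
  shows "split_blocks m (Suc (length ls)) (merge_blocks m (Suc (length ls)) \<phi>)
           (eliminated_blocks m (Suc (length ls)) \<phi>) = \<phi>" (is "?\<phi> = \<phi>")
proof (rule PiE_ext)
  let ?A = "\<Pi>\<^sub>E x\<in>cycle_blocks m (Suc (Suc (length ls))).
    tuples V ((l0 # l1 # ls) ! part_of (snd x))"
  show "?\<phi> \<in> ?A"
    using split_blocks_in_assignments[OF merge_blocks_in_assignments[OF \<phi> two_parts]
        eliminated_blocks_in[OF \<phi> two_parts] two_parts]
    by (simp add: assignments_def)
  show "\<phi> \<in> ?A"
    using \<phi> by (simp add: assignments_def)
  fix x assume "x \<in> cycle_blocks m (Suc (Suc (length ls)))"
  then show "?\<phi> x = \<phi> x" using two_parts
  proof (cases rule: cycle_blocks_SucE)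
    case (lifted b y)
    have "length (\<phi> (lift_block False y)) = length (\<phi> (lift_block True y))"
      using lift_block_tuples[OF \<phi> two_parts lifted(2)] by (simp add: tuples_def)
    then show ?thesis
      using lifted
      by (cases b) (simp_all add: split_blocks_lift_block[OF two_parts] merge_blocks_def)
  next
    case (eliminated i w)
    then show ?thesis using two_parts by (simp add: split_blocks_PartB_1 eliminated_blocks_def)
  qed
qed

lemma merge_split_blocks:
  assumes "\<psi> \<in> assignments m V ls" and "2 \<le> length ls"
  shows "merge_blocks m (length ls) (split_blocks m (length ls) \<psi> \<eta>) = \<psi>"
proof
  fix x
  show "merge_blocks m (length ls) (split_blocks m (length ls) \<psi> \<eta>) x = \<psi> x"
    using PiE_arb[OF assms(1)[unfolded assignments_def], of x]
    by (cases "x \<in> cycle_blocks m (length ls)")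
       (simp_all add: merge_blocks_def split_blocks_lift_block assms(2) half_False_append_half_True)
qed

lemma eliminated_split_blocks:
  assumes "\<eta> \<in> {..<m} \<times> bits (t - 1) \<rightarrow>\<^sub>E S" and "2 \<le> t"
  shows "eliminated_blocks m t (split_blocks m t \<psi> \<eta>) = \<eta>"
proof
  fix x
  show "eliminated_blocks m t (split_blocks m t \<psi> \<eta>) x = \<eta> x"
    using PiE_arb[OF assms(1), of x] assms(2)
    by (cases "x \<in> {..<m} \<times> bits (t - 1)") (auto simp: eliminated_blocks_def split_blocks_PartB_1)
qed

lemma sum_assignments_split:
  assumes "2 \<le> Suc (length ls)"
  shows "(\<Sum>\<phi>\<in>assignments m V (l0 # l1 # ls). f \<phi>)
    = (\<Sum>\<psi>\<in>assignments m V (map ((*) 2) (l0 # ls)). \<Sum>\<eta>\<in>{..<m} \<times> bits (length ls) \<rightarrow>\<^sub>E tuples V l1.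
        f (split_blocks m (Suc (length ls)) \<psi> \<eta>))"
proof -
  let ?A = "assignments m V (map ((*) 2) (l0 # ls))"
  let ?B = "{..<m} \<times> bits (length ls) \<rightarrow>\<^sub>E tuples V l1"
  let ?split = "\<lambda>(\<psi>, \<eta>). split_blocks m (Suc (length ls)) \<psi> \<eta>"
  let ?merge = "\<lambda>\<phi>. (merge_blocks m (Suc (length ls)) \<phi>, eliminated_blocks m (Suc (length ls)) \<phi>)"
  have "(\<Sum>\<phi>\<in>assignments m V (l0 # l1 # ls). f \<phi>) = (\<Sum>p\<in>?A \<times> ?B. f (?split p))"
  proof (rule sum.reindex_bij_witness[of _ ?split ?merge])
    fix p assume "p \<in> ?A \<times> ?B"
    then show "?merge (?split p) = p"
      using merge_split_blocks[of "fst p" m V "map ((*) 2) (l0 # ls)"]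
        eliminated_split_blocks[of "snd p" m "Suc (length ls)"] assms
      by (auto simp del: list.map)
    from \<open>p \<in> ?A \<times> ?B\<close> show "?split p \<in> assignments m V (l0 # l1 # ls)"
      using assms by (auto intro: split_blocks_in_assignments simp del: list.map)
  next
    fix \<phi> assume "\<phi> \<in> assignments m V (l0 # l1 # ls)"
    then show "?split (?merge \<phi>) = \<phi>" "?merge \<phi> \<in> ?A \<times> ?B"
      using assms
      by (simp_all add: split_merge_blocks merge_blocks_in_assignments eliminated_blocks_in
          del: list.map)
    then show "f (?split (?merge \<phi>)) = f \<phi>" by simp
  qed
  then show ?thesis by (simp add: sum.cartesian_product case_prod_unfold)
qed

lemma remove_bit_Suc_Cons: "1 \<le> j \<Longrightarrow> remove_bit (Suc j) (b # w) = b # remove_bit j w"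
  by (cases j) (simp_all add: remove_bit_def)

lemma length_remove_bit: "1 \<le> j \<Longrightarrow> j \<le> length w \<Longrightarrow> length (remove_bit j w) = length w - 1"
  by (simp add: remove_bit_def)

lemma edge_blocks_split_blocks:
  assumes "i < m" and two_parts: "2 \<le> t" and w: "w \<in> bits (t - 1)"
  shows "edge_blocks m (Suc t) (split_blocks m t \<psi> \<eta>) i (b # w)
     = insert_second (\<eta> (i, w)) (map (half b) (edge_blocks m t \<psi> i w))"
proof -
  let ?\<phi> = "split_blocks m t \<psi> \<eta>"
  have mod_less: "Suc i mod m < m" and length_w: "length w = t - 1" "w \<noteq> []"
    using \<open>i < m\<close> two_parts w by (auto simp: bits_def)
  have "block_rep m (i, PartA (b # w)) = lift_block b (block_rep m (i, PartA w))"
    "block_rep m (i, PartA w) \<in> cycle_blocks m t"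
    using mod_less length_w two_parts \<open>i < m\<close> by (auto simp: cycle_blocks_def)
  then have partA: "?\<phi> (block_rep m (i, PartA (b # w))) = half b (\<psi> (block_rep m (i, PartA w)))"
    by (simp only: split_blocks_lift_block[OF two_parts])
  have partB: "?\<phi> (i, PartB (Suc j) (remove_bit (Suc j) (b # w)))
      = half b (\<psi> (i, PartB j (remove_bit j w)))" if "j \<in> set [1..<t]" for j
  proof -
    have "remove_bit (Suc j) (b # w) = b # remove_bit j w" "length (remove_bit j w) = t - 2"
      using that length_w by (auto simp: remove_bit_Suc_Cons length_remove_bit)
    then have "(i, PartB (Suc j) (remove_bit (Suc j) (b # w)))
        = lift_block b (i, PartB j (remove_bit j w))"
      "(i, PartB j (remove_bit j w)) \<in> cycle_blocks m t"
      using that \<open>i < m\<close> by (auto simp: cycle_blocks_def)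
    then show ?thesis by (simp only: split_blocks_lift_block[OF two_parts])
  qed
  have "?\<phi> (i, PartB 1 (remove_bit 1 (b # w))) = \<eta> (i, w)"
    using assms by (simp add: remove_bit_def split_blocks_PartB_1)
  moreover have "[1..<Suc t] = 1 # map Suc [1..<t]"
    using two_parts by (simp add: map_Suc_upt upt_conv_Cons del: upt_Suc)
  ultimately show ?thesis
    unfolding edge_blocks_def step_edge_def using partA partB by (simp del: upt_Suc)
qed

lemma cycle_sum_double:
  assumes finite_V: "finite V" and two_parts: "2 \<le> Suc (length ls)"
  shows "cycle_sum m V (l0 # l1 # ls) g = cycle_sum m V (map ((*) 2) (l0 # ls)) (double V l1 g)"
proof -
  let ?t = "Suc (length ls)" and ?I = "{..<m} \<times> bits (length ls)"
  define G where "G \<psi> x y b =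
    g (insert_second y (map (half b) (edge_blocks m ?t \<psi> (fst x) (snd x))))" for \<psi> x y b
  have edges: "(\<Prod>i<m. \<Prod>w\<in>bits ?t. g (edge_blocks m (Suc ?t) (split_blocks m ?t \<psi> \<eta>) i w))
      = (\<Prod>x\<in>?I. G \<psi> x (\<eta> x) False * G \<psi> x (\<eta> x) True)" for \<psi> \<eta>
  proof -
    let ?g = "\<lambda>x b. g (edge_blocks m (Suc ?t) (split_blocks m ?t \<psi> \<eta>) (fst x) (b # snd x))"
    have "(\<Prod>i<m. \<Prod>w\<in>bits ?t. g (edge_blocks m (Suc ?t) (split_blocks m ?t \<psi> \<eta>) i w))
        = (\<Prod>x\<in>?I. ?g x False * ?g x True)"
      by (simp add: prod_bits_Suc prod.cartesian_product case_prod_unfold)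
    also have "\<dots> = (\<Prod>x\<in>?I. G \<psi> x (\<eta> x) False * G \<psi> x (\<eta> x) True)"
      using two_parts by (intro prod.cong refl) (auto simp: edge_blocks_split_blocks G_def)
    finally show ?thesis .
  qed
  have "cycle_sum m V (l0 # l1 # ls) g
      = (\<Sum>\<psi>\<in>assignments m V (map ((*) 2) (l0 # ls)). \<Sum>\<eta>\<in>?I \<rightarrow>\<^sub>E tuples V l1.
          \<Prod>x\<in>?I. G \<psi> x (\<eta> x) False * G \<psi> x (\<eta> x) True)"
    by (simp add: cycle_sum_def sum_assignments_split[OF two_parts] edges del: list.map)
  also have "\<dots> = (\<Sum>\<psi>\<in>assignments m V (map ((*) 2) (l0 # ls)).
      \<Prod>x\<in>?I. \<Sum>y\<in>tuples V l1. G \<psi> x y False * G \<psi> x y True)"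
    using finite_V by (intro sum.cong refl prod_sum_PiE[symmetric]) auto
  also have "\<dots> = cycle_sum m V (map ((*) 2) (l0 # ls)) (double V l1 g)"
    by (simp add: cycle_sum_def double_def inner_on_def G_def prod.cartesian_product
        case_prod_unfold del: list.map)
  finally show ?thesis .
qed

section \<open>Kernels with two parts\<close>

locale pair_kernel =
  fixes V :: "'a set" and l0 l1 :: nat and g :: "'a list list \<Rightarrow> real"
  assumes finite_V: "finite V" and nonempty_V: "V \<noteq> {}"

sublocale pair_kernel \<subseteq> gram_kernel "tuples V l0" "tuples V l1" "\<lambda>x y. g [x, y]"
  by unfold_locales (simp add: finite_V)

context pair_kernel
begin

lemma tensor_form_double_pair:
  "tensor_form V [2 * l0] (double V l1 g) [tensor u v] = inner_on (tuples V l0) u (gram_apply v)"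
proof -
  have "transpose_apply w = slice V [l0] g [w]" for w
    by (simp add: fun_eq_iff transpose_apply_def slice_def tensor_form_def inner_on_def
        sum_blocks_Cons mult.commute)
  then show ?thesis
    using tensor_form_double[of "[u]" "[l0]" "[v]" V l1 g] by (simp add: inner_gram_apply)
qed

lemma tensor_form_uniform_kernel_pair:
  "tensor_form V [2 * l0] (uniform_kernel V) [tensor u v]
     = inner_on (tuples V l0) u (uniform_vector V) * inner_on (tuples V l0) v (uniform_vector V)"
proof -
  have "tensor_form V [l0] (uniform_kernel V) [w] = inner_on (tuples V l0) w (uniform_vector V)"
    for w
    by (simp add: tensor_form_def inner_on_def sum_blocks_Cons uniform_kernel_def mult.commute)
  then show ?thesis
    using tensor_form_uniform_kernel_tensor[of "[u]" "[l0]" "[v]" V] by simp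
qed

lemma kernel_density_double_pair:
  "kernel_density V [2 * l0] (double V l1 g) = moment (uniform_vector V) 1"
  using tensor_form_uniform[of V "[2 * l0]" "double V l1 g"]
    tensor_form_double_pair[of "uniform_vector V" "uniform_vector V"]
  by (simp add: moment_def tensor_uniform_vector)

lemma cycle_sum_eq_trace_power: "m \<ge> 1 \<Longrightarrow> cycle_sum m V [l0, l1] g = trace_power m"
  by (simp add: trace_power_closed_walks cycle_sum_pair[OF finite_V] gram_def)

lemma kernel_density_double_power_le_cycle_sum:
  assumes "l \<ge> 1"
  shows "kernel_density V [2 * l0] (double V l1 g) ^ (2 * l) \<le> cycle_sum (2 * l) V [l0, l1] g"
  using first_moment_le_trace_power[of "uniform_vector V" l] assms
  by (simp add: kernel_density_double_pair cycle_sum_eq_trace_power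
      inner_uniform_vector_self[OF finite_V nonempty_V])

lemma tensor_form_double_close_to_rank_one:
  assumes "l \<ge> 1"
    and unit_u: "inner_on (tuples V l0) u u = 1" and unit_v: "inner_on (tuples V l0) v v = 1"
  defines "s \<equiv> kernel_density V [2 * l0] (double V l1 g)"
  defines "\<eta> \<equiv> root (2 * l) (cycle_sum (2 * l) V [l0, l1] g - s ^ (2 * l))"
  shows "\<bar>tensor_form V [2 * l0] (double V l1 g) [tensor u v]
      - s * tensor_form V [2 * l0] (uniform_kernel V) [tensor u v]\<bar> \<le> 2 * sqrt (s * \<eta>) + \<eta>"
proof -
  have unit: "inner_on (tuples V l0) (uniform_vector V) (uniform_vector V) = 1"
    by (rule inner_uniform_vector_self[OF finite_V nonempty_V])
  have "moment h 1 \<le> \<eta>"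
    if "inner_on (tuples V l0) (uniform_vector V) h = 0" "inner_on (tuples V l0) h h \<le> 1" for h
    using orthogonal_moment_le_root[of "uniform_vector V" h l] unit that \<open>l \<ge> 1\<close>
    by (simp add: \<eta>_def s_def kernel_density_double_pair cycle_sum_eq_trace_power)
  then show ?thesis
    using rank_one_approximation[OF unit, of u v \<eta>] unit_u unit_v
    by (simp add: s_def tensor_form_double_pair tensor_form_uniform_kernel_pair
        kernel_density_double_pair)
qed

lemma deviation_pair_le:
  assumes "l \<ge> 1" and "0 < p" and "p - \<delta> \<le> kernel_density V [l0, l1] g"
  defines "s \<equiv> kernel_density V [2 * l0] (double V l1 g)"
  defines "\<eta> \<equiv> root (2 * l) (cycle_sum (2 * l) V [l0, l1] g - s ^ (2 * l))"
  defines "D \<equiv> 2 * sqrt (s * \<eta>) + \<eta> + \<bar>s - p\<^sup>2\<bar>"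
  shows "deviation p V [l0, l1] g \<le> 2 * sqrt D + sqrt (D + 2 * p * \<delta>)"
  using assms(2,3)
proof (rule deviation_le_of_double_close[OF finite_V nonempty_V])
  fix us vs assume unit_us: "unit_vectors V [l0] us" and unit_vs: "unit_vectors V [l0] vs"
  define U where "U = tensor_form V [2 * l0] (uniform_kernel V) (map2 tensor us vs)"
  define Q where "Q = tensor_form V [2 * l0] (double V l1 g) (map2 tensor us vs)"
  obtain u v where "us = [u]" "vs = [v]"
    and "inner_on (tuples V l0) u u = 1" "inner_on (tuples V l0) v v = 1"
    using unit_us unit_vs by (auto elim!: unit_vectors_ConsE)
  then have "\<bar>Q - s * U\<bar> \<le> 2 * sqrt (s * \<eta>) + \<eta>"
    using tensor_form_double_close_to_rank_one[OF \<open>l \<ge> 1\<close>, of u v]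
    by (simp add: Q_def U_def s_def \<eta>_def)
  moreover have "\<bar>(s - p\<^sup>2) * U\<bar> \<le> \<bar>s - p\<^sup>2\<bar>"
    using abs_tensor_form_uniform_kernel_le[OF finite_V nonempty_V
        unit_vectors_tensor[OF unit_us unit_vs]]
    by (simp add: U_def abs_mult mult_left_le)
  moreover have "Q - p\<^sup>2 * U = (Q - s * U) + (s - p\<^sup>2) * U"
    by (simp add: algebra_simps)
  ultimately have "\<bar>Q - p\<^sup>2 * U\<bar> \<le> D" unfolding D_def by linarith
  then show "\<bar>tensor_form V (map ((*) 2) [l0]) (double V l1 g) (map2 tensor us vs)
      - p\<^sup>2 * tensor_form V (map ((*) 2) [l0]) (uniform_kernel V) (map2 tensor us vs)\<bar> \<le> D"
    by (simp add: Q_def U_def)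
qed

end

section \<open>Kernels with few cycles\<close>

lemma tendsto_of_power_bounds:
  fixes s C \<delta> \<epsilon> :: "'i \<Rightarrow> real"
  assumes "0 < N" and "0 \<le> a" and s_nonneg: "\<forall>\<^sub>F n in F. 0 \<le> s n"
    and lower: "\<forall>\<^sub>F n in F. a - \<delta> n \<le> s n" and \<delta>_tendsto: "(\<delta> \<longlongrightarrow> 0) F"
    and power_le: "\<forall>\<^sub>F n in F. s n ^ N \<le> C n"
    and upper: "\<forall>\<^sub>F n in F. C n \<le> a ^ N + \<epsilon> n" and \<epsilon>_tendsto: "(\<epsilon> \<longlongrightarrow> 0) F"
  shows "(s \<longlongrightarrow> a) F" and "(C \<longlongrightarrow> a ^ N) F"
proof -
  have s_upper: "\<forall>\<^sub>F n in F. s n \<le> root N (a ^ N + \<epsilon> n)"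
    using s_nonneg power_le upper
  proof eventually_elim
    case (elim n)
    then have "s n = root N (s n ^ N)" using \<open>0 < N\<close> by (simp add: real_root_power_cancel)
    also have "\<dots> \<le> root N (a ^ N + \<epsilon> n)" using \<open>0 < N\<close> elim by (intro real_root_le_mono) auto
    finally show ?case .
  qed
  have "((\<lambda>n. a - \<delta> n) \<longlongrightarrow> a - 0) F" "((\<lambda>n. root N (a ^ N + \<epsilon> n)) \<longlongrightarrow> root N (a ^ N + 0)) F"
    by (intro tendsto_intros \<delta>_tendsto \<epsilon>_tendsto)+
  then show s_tendsto: "(s \<longlongrightarrow> a) F"
    using real_tendsto_sandwich[OF lower s_upper, of a] \<open>0 < N\<close> \<open>0 \<le> a\<close>
    by (simp add: real_root_power_cancel)
  have "((\<lambda>n. s n ^ N) \<longlongrightarrow> a ^ N) F" "((\<lambda>n. a ^ N + \<epsilon> n) \<longlongrightarrow> a ^ N + 0) F"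
    by (intro tendsto_intros s_tendsto \<epsilon>_tendsto)+
  then show "(C \<longlongrightarrow> a ^ N) F"
    using real_tendsto_sandwich[OF power_le upper] by simp
qed

context
  fixes V :: "'i \<Rightarrow> 'a set" and F :: "'i filter"
  assumes nonempty: "\<forall>\<^sub>F n in F. finite (V n) \<and> V n \<noteq> {}"
begin

lemma deviation_tendsto_0_of_le:
  assumes "\<forall>\<^sub>F n in F. deviation p (V n) ls (g n) \<le> 2 * sqrt (D n) + sqrt (D n + 2 * p * \<delta> n)"
    and "(D \<longlongrightarrow> 0) F" and "(\<delta> \<longlongrightarrow> 0) F"
  shows "((\<lambda>n. deviation p (V n) ls (g n)) \<longlongrightarrow> 0) F"
proof (rule real_tendsto_sandwich[OF _ assms(1)])
  show "\<forall>\<^sub>F n in F. 0 \<le> deviation p (V n) ls (g n)"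
    using nonempty by eventually_elim (simp add: deviation_nonneg)
  have "((\<lambda>n. 2 * sqrt (D n) + sqrt (D n + 2 * p * \<delta> n))
      \<longlongrightarrow> 2 * sqrt 0 + sqrt (0 + 2 * p * 0)) F"
    by (intro tendsto_intros assms)
  then show "((\<lambda>n. 2 * sqrt (D n) + sqrt (D n + 2 * p * \<delta> n)) \<longlongrightarrow> 0) F" by simp
qed simp

lemma deviation_pair_tendsto_0:
  assumes "0 < p" and "l \<ge> 1"
    and density: "\<forall>\<^sub>F n in F. p - \<delta> n \<le> kernel_density (V n) [l0, l1] (g n)"
    and \<delta>_tendsto: "(\<delta> \<longlongrightarrow> 0) F"
    and cycles: "\<forall>\<^sub>F n in F. cycle_sum (2 * l) (V n) [l0, l1] (g n) \<le> p ^ (4 * l) + \<epsilon> n"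
    and \<epsilon>_tendsto: "(\<epsilon> \<longlongrightarrow> 0) F"
  shows "((\<lambda>n. deviation p (V n) [l0, l1] (g n)) \<longlongrightarrow> 0) F"
proof -
  define s where "s n = kernel_density (V n) [2 * l0] (double (V n) l1 (g n))" for n
  define C where "C n = cycle_sum (2 * l) (V n) [l0, l1] (g n)" for n
  define D where "D n = 2 * sqrt (s n * root (2 * l) (C n - s n ^ (2 * l)))
    + root (2 * l) (C n - s n ^ (2 * l)) + \<bar>s n - p\<^sup>2\<bar>" for n
  have p_power: "p ^ (4 * l) = (p\<^sup>2) ^ (2 * l)" by (simp flip: power_mult)
  have bounds: "\<forall>\<^sub>F n in F. 0 \<le> s n \<and> p\<^sup>2 - 2 * p * \<delta> n \<le> s n \<and> s n ^ (2 * l) \<le> C n \<and>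
      deviation p (V n) [l0, l1] (g n) \<le> 2 * sqrt (D n) + sqrt (D n + 2 * p * \<delta> n)"
    using nonempty density
  proof eventually_elim
    case (elim n)
    interpret pair_kernel "V n" l0 l1 "g n" using elim by unfold_locales auto
    have "0 \<le> s n"
      unfolding s_def kernel_density_double_pair by (rule moment_nonneg)
    moreover have "p\<^sup>2 - 2 * p * \<delta> n \<le> s n"
      using kernel_density_double_ge[of "V n" p "\<delta> n" l0 l1 "[]"] elim \<open>0 < p\<close>
      by (simp add: s_def)
    ultimately show ?case
      using kernel_density_double_power_le_cycle_sum deviation_pair_le \<open>l \<ge> 1\<close> \<open>0 < p\<close> elim
      by (simp add: s_def C_def D_def)
  qed
  then have nonneg: "\<forall>\<^sub>F n in F. 0 \<le> s n"
    and lower: "\<forall>\<^sub>F n in F. p\<^sup>2 - 2 * p * \<delta> n \<le> s n"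
    and power_le: "\<forall>\<^sub>F n in F. s n ^ (2 * l) \<le> C n"
    by (auto elim: eventually_mono)
  have upper: "\<forall>\<^sub>F n in F. C n \<le> (p\<^sup>2) ^ (2 * l) + \<epsilon> n"
    using cycles by (simp add: C_def p_power)
  have "((\<lambda>n. 2 * p * \<delta> n) \<longlongrightarrow> 0) F"
    using \<delta>_tendsto by (rule tendsto_mult_right_zero)
  then have s_tendsto: "(s \<longlongrightarrow> p\<^sup>2) F" and C_tendsto: "(C \<longlongrightarrow> (p\<^sup>2) ^ (2 * l)) F"
    using tendsto_of_power_bounds[OF _ _ nonneg lower _ power_le upper \<epsilon>_tendsto] \<open>l \<ge> 1\<close>
    by simp_all
  have "(D \<longlongrightarrow> 2 * sqrt (p\<^sup>2 * root (2 * l) ((p\<^sup>2) ^ (2 * l) - (p\<^sup>2) ^ (2 * l)))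
      + root (2 * l) ((p\<^sup>2) ^ (2 * l) - (p\<^sup>2) ^ (2 * l)) + \<bar>p\<^sup>2 - p\<^sup>2\<bar>) F"
    unfolding D_def by (intro tendsto_intros s_tendsto C_tendsto)
  then have D_tendsto: "(D \<longlongrightarrow> 0) F" by simp
  have "\<forall>\<^sub>F n in F. deviation p (V n) [l0, l1] (g n) \<le> 2 * sqrt (D n) + sqrt (D n + 2 * p * \<delta> n)"
    using bounds by eventually_elim simp
  from this D_tendsto \<delta>_tendsto show ?thesis by (rule deviation_tendsto_0_of_le)
qed

lemma deviation_tendsto_0_of_double:
  assumes "0 < p" and density: "\<forall>\<^sub>F n in F. p - \<delta> n \<le> kernel_density (V n) (l0 # l1 # ls) (g n)"
    and \<delta>_tendsto: "(\<delta> \<longlongrightarrow> 0) F"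
    and double:
      "((\<lambda>n. deviation (p\<^sup>2) (V n) (map ((*) 2) (l0 # ls)) (double (V n) l1 (g n))) \<longlongrightarrow> 0) F"
  shows "((\<lambda>n. deviation p (V n) (l0 # l1 # ls) (g n)) \<longlongrightarrow> 0) F"
proof (rule deviation_tendsto_0_of_le[OF _ double \<delta>_tendsto])
  show "\<forall>\<^sub>F n in F. deviation p (V n) (l0 # l1 # ls) (g n)
      \<le> 2 * sqrt (deviation (p\<^sup>2) (V n) (map ((*) 2) (l0 # ls)) (double (V n) l1 (g n)))
        + sqrt (deviation (p\<^sup>2) (V n) (map ((*) 2) (l0 # ls)) (double (V n) l1 (g n))
          + 2 * p * \<delta> n)"
    using nonempty density
    by eventually_elim (use \<open>0 < p\<close> in \<open>simp add: deviation_le_deviation_double del: list.map\<close>)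
qed

lemma deviation_tendsto_0:
  assumes "0 < p" and "l \<ge> 1" and "2 \<le> length ls"
    and "\<forall>\<^sub>F n in F. p - \<delta> n \<le> kernel_density (V n) ls (g n)" and "(\<delta> \<longlongrightarrow> 0) F"
    and "\<forall>\<^sub>F n in F. cycle_sum (2 * l) (V n) ls (g n) \<le> p ^ (2 * l * 2 ^ (length ls - 1)) + \<epsilon> n"
    and "(\<epsilon> \<longlongrightarrow> 0) F"
  shows "((\<lambda>n. deviation p (V n) ls (g n)) \<longlongrightarrow> 0) F"
  using assms
proof (induction "length ls" arbitrary: ls p g \<delta> rule: less_induct)
  case less
  obtain l0 l1 ms where ls: "ls = l0 # l1 # ms"
    using less.prems(3) by (cases ls; cases "tl ls") auto
  show ?case
  proof (cases "ms = []")
    case True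
    then have pair: "ls = [l0, l1]" by (simp add: ls)
    then have exponent: "2 * l * 2 ^ (length ls - 1) = 4 * l" by simp
    show ?thesis
      using less.prems(1,2,4,5) less.prems(6)[unfolded exponent] less.prems(7)
      unfolding pair by (rule deviation_pair_tendsto_0)
  next
    case False
    let ?ls = "map ((*) 2) (l0 # ms)" and ?D = "\<lambda>n. double (V n) l1 (g n)"
    have two_parts: "2 \<le> Suc (length ms)" using False by (cases ms) auto
    have "((\<lambda>n. deviation (p\<^sup>2) (V n) ?ls (?D n)) \<longlongrightarrow> 0) F"
    proof (rule less.hyps[where \<delta> = "\<lambda>n. 2 * p * \<delta> n"])
      show "\<forall>\<^sub>F n in F. p\<^sup>2 - 2 * p * \<delta> n \<le> kernel_density (V n) ?ls (?D n)"
        using nonempty less.prems(4)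
        by eventually_elim (use \<open>0 < p\<close> in \<open>simp add: ls kernel_density_double_ge del: list.map\<close>)
      show "((\<lambda>n. 2 * p * \<delta> n) \<longlongrightarrow> 0) F"
        using less.prems(5) by (intro tendsto_mult_right_zero)
      have exponent: "(p\<^sup>2) ^ (2 * l * 2 ^ (length ?ls - 1)) = p ^ (2 * l * 2 ^ (length ls - 1))"
        by (simp add: ls mult_ac flip: power_mult)
      show "\<forall>\<^sub>F n in F. cycle_sum (2 * l) (V n) ?ls (?D n)
          \<le> (p\<^sup>2) ^ (2 * l * 2 ^ (length ?ls - 1)) + \<epsilon> n"
        unfolding exponent using nonempty less.prems(6)
        by eventually_elim (simp add: ls cycle_sum_double[OF _ two_parts] del: list.map)
    qed (use less.prems two_parts in \<open>simp_all add: ls\<close>)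
    with less.prems(1,4,5) show ?thesis
      unfolding ls by (rule deviation_tendsto_0_of_double)
  qed
qed

end

section \<open>The identifications in the cycle\<close>

lemma glue_class_self: "x \<in> glue_class R x"
  by (simp add: glue_class_def)

lemma glue_class_invariant:
  assumes "\<And>x y. (x, y) \<in> R \<Longrightarrow> f x = f y" and "y \<in> glue_class R x"
  shows "f y = f x"
proof -
  have "(x, y) \<in> (R \<union> R\<inverse>)\<^sup>*" using assms(2) by (simp add: glue_class_def)
  then show ?thesis
    by (induction rule: rtrancl_induct) (auto dest: assms(1))
qed

lemma glue_class_eqI:
  assumes "(x, y) \<in> R"
  shows "glue_class R x = glue_class R y"
proof -
  have "(x, y) \<in> (R \<union> R\<inverse>)\<^sup>*" "(y, x) \<in> (R \<union> R\<inverse>)\<^sup>*" using assms by auto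
  then show ?thesis unfolding glue_class_def by (auto intro: rtrancl_trans)
qed

lemma glue_class_lift:
  assumes "\<And>x y. (x, y) \<in> R \<Longrightarrow> f x = f y"
  shows "f (SOME z. z \<in> glue_class R x) = f x"
proof -
  have "(SOME z. z \<in> glue_class R x) \<in> glue_class R x"
    using glue_class_self by (rule someI)
  with assms show ?thesis by (rule glue_class_invariant)
qed

lemma set_bit_strings: "set (bit_strings s) = bits s"
proof (induction s)
  case 0
  then show ?case by (auto simp: bits_def)
next
  case (Suc s)
  have "bits (Suc s) = (#) False ` bits s \<union> (#) True ` bits s"
    by (force simp: bits_def length_Suc_conv)
  then show ?case using Suc by simp
qed

definition attach_index :: "nat list \<Rightarrow> (bool list \<times> nat) list" where
  "attach_index ks =
     concat (map (\<lambda>w. map (Pair w) [1..<Suc (ks ! 0)]) (bit_strings (length ks - 2)))"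

lemma step_attach_eq_map: "step_attach b ks = map (\<lambda>(w, r). (PartA (w @ [b]), r)) (attach_index ks)"
  by (simp add: step_attach_def attach_index_def map_concat comp_def)

lemma set_attach_index: "set (attach_index ks) = bits (length ks - 2) \<times> {1..ks ! 0}"
  by (simp add: attach_index_def set_bit_strings atLeastLessThanSuc_atLeastAtMost del: upt_Suc) auto

lemma image_case_prod_Times: "(\<lambda>(x, y). f x y) ` (A \<times> B) = {f x y | x y. x \<in> A \<and> y \<in> B}"
  by force

lemma set_zip_step_attach:
  "set (zip (map f (step_attach b ks)) (map g (step_attach c ks))) =
     {(f (PartA (w @ [b]), r), g (PartA (w @ [c]), r)) | w r.
        w \<in> bits (length ks - 2) \<and> r \<in> {1..ks ! 0}}"
proof -
  have "set (zip (map f (step_attach b ks)) (map g (step_attach c ks))) =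
      (\<lambda>(w, r). (f (PartA (w @ [b]), r), g (PartA (w @ [c]), r))) `
        (bits (length ks - 2) \<times> {1..ks ! 0})"
    by (simp add: step_attach_eq_map zip_map_map zip_same_conv_map set_attach_index image_image
        case_prod_unfold comp_def)
  also have "\<dots> = {(f (PartA (w @ [b]), r), g (PartA (w @ [c]), r)) | w r.
      w \<in> bits (length ks - 2) \<and> r \<in> {1..ks ! 0}}"
    by (rule image_case_prod_Times)
  finally show ?thesis .
qed

lemma path_identifications_iff:
  "(x, y) \<in> path_identifications ks m \<longleftrightarrow> (\<exists>i w r. Suc i < m \<and> w \<in> bits (length ks - 2) \<and>
     r \<in> {1..ks ! 0} \<and> x = (i, PartA (w @ [True]), r) \<and> y = (Suc i, PartA (w @ [False]), r))"
  unfolding path_identifications_def set_zip_step_attach by blast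

locale step_cycle =
  fixes ks :: "nat list" and m :: nat
  assumes two_parts: "2 \<le> length ks" and parts_pos: "j \<in> set ks \<Longrightarrow> 0 < j" and steps_pos: "1 \<le> m"
begin

definition path_class :: "nat \<times> step_vertex \<times> nat \<Rightarrow> (nat \<times> step_vertex \<times> nat) set" where
  "path_class = glue_class (path_identifications ks m)"

definition closing_identifications ::
  "((nat \<times> step_vertex \<times> nat) set \<times> (nat \<times> step_vertex \<times> nat) set) set" where
  "closing_identifications = set (zip (hpath_attach_first ks m) (hpath_attach_last ks m))"

definition quot :: "nat \<times> step_vertex \<times> nat \<Rightarrow> (nat \<times> step_vertex \<times> nat) set set" where
  "quot x = glue_class closing_identifications (path_class x)"

definition copy_verts :: "(nat \<times> step_vertex \<times> nat) set" where
  "copy_verts = {..<m} \<times> verts (step ks)"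

fun vertex_rep :: "nat \<times> step_vertex \<times> nat \<Rightarrow> nat \<times> step_vertex \<times> nat" where
  "vertex_rep (i, v, r) = (fst (block_rep m (i, v)), snd (block_rep m (i, v)), r)"

definition cycle_verts :: "(nat \<times> step_vertex \<times> nat) set" where
  "cycle_verts = {(i, v, r). (i, v) \<in> cycle_blocks m (length ks) \<and> r \<in> {1..ks ! part_of v}}"

lemma closing_identifications_iff:
  "(c, d) \<in> closing_identifications \<longleftrightarrow> (\<exists>w r. w \<in> bits (length ks - 2) \<and> r \<in> {1..ks ! 0} \<and>
     c = path_class (0, PartA (w @ [False]), r) \<and> d = path_class (m - 1, PartA (w @ [True]), r))"
  unfolding closing_identifications_def hpath_attach_first_def hpath_attach_last_def
    path_class_def set_zip_step_attach by blast

lemma verts_hcycle_eq_quot: "verts (hcycle ks m) = quot ` copy_verts"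
  by (simp add: hcycle_def hpath_def glue_def disjoint_copies_def image_image quot_def[abs_def]
      closing_identifications_def path_class_def copy_verts_def)

lemma edges_hcycle_eq_quot: "edges (hcycle ks m) =
    (\<lambda>(i, E). image_mset quot (image_mset (Pair i) E)) ` ({..<m} \<times> edges (step ks))"
proof -
  have "edges (hcycle ks m) = image_mset quot ` (\<Union>i<m. image_mset (Pair i) ` edges (step ks))"
    by (simp add: hcycle_def hpath_def glue_def disjoint_copies_def image_image
        closing_identifications_def multiset.map_comp quot_def[abs_def] path_class_def comp_def)
  then show ?thesis by auto
qed

lemma verts_step_iff:
  "(v, r) \<in> verts (step ks) \<longleftrightarrow> v \<in> verts (simple_step (length ks)) \<and> r \<in> {1..ks ! part_of v}"
  by (auto simp: step_def Let_def)

lemma block_rep_in_cycle_blocks: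
  assumes "i < m" and "v \<in> verts (simple_step (length ks))"
  shows "block_rep m (i, v) \<in> cycle_blocks m (length ks)"
    and "part_of (snd (block_rep m (i, v))) = part_of v"
  using assms two_parts by (auto simp: simple_step_def cycle_blocks_def)

lemma cycle_blocks_subset: "(i, v) \<in> cycle_blocks m t \<Longrightarrow> i < m \<and> v \<in> verts (simple_step t)"
  by (cases v) (auto simp: simple_step_def cycle_blocks_def)

lemma block_rep_idem: "x \<in> cycle_blocks m t \<Longrightarrow> block_rep m x = x"
  by (cases "(m, x)" rule: block_rep.cases) (auto simp: cycle_blocks_def)

lemma vertex_rep_idem: "x \<in> cycle_verts \<Longrightarrow> vertex_rep x = x"
  by (cases x) (auto simp: cycle_verts_def block_rep_idem simp del: block_rep.simps)

lemma cycle_verts_subset: "cycle_verts \<subseteq> copy_verts"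
  by (auto simp: cycle_verts_def copy_verts_def verts_step_iff dest: cycle_blocks_subset)

lemma vertex_rep_in_cycle_verts: "x \<in> copy_verts \<Longrightarrow> vertex_rep x \<in> cycle_verts"
  using block_rep_in_cycle_blocks
  by (cases x) (auto simp: copy_verts_def verts_step_iff cycle_verts_def simp del: block_rep.simps)

lemma vertex_rep_eq_of_quot_eq:
  assumes "quot x = quot y"
  shows "vertex_rep x = vertex_rep y"
proof -
  define f where "f c = vertex_rep (SOME z. z \<in> c)" for c
  have f_path_class: "f (path_class z) = vertex_rep z" for z
    unfolding f_def path_class_def by (rule glue_class_lift) (auto simp: path_identifications_iff)
  have "f (SOME c. c \<in> quot z) = vertex_rep z" for z
    unfolding quot_def f_path_class[symmetric]
    by (rule glue_class_lift)
       (use steps_pos in \<open>auto simp: closing_identifications_iff f_path_class\<close>)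
  then show ?thesis by (metis assms)
qed

lemma quot_PartA_True:
  assumes "i < m" and "w \<in> bits (length ks - 2)" and "r \<in> {1..ks ! 0}"
  shows "quot (i, PartA (w @ [True]), r) = quot (Suc i mod m, PartA (w @ [False]), r)"
proof (cases "Suc i < m")
  case True
  then have "((i, PartA (w @ [True]), r), (Suc i mod m, PartA (w @ [False]), r))
      \<in> path_identifications ks m"
    using assms by (auto simp: path_identifications_iff)
  then show ?thesis unfolding quot_def path_class_def by (simp only: glue_class_eqI)
next
  case False
  with \<open>i < m\<close> have "Suc i = m" by simp
  then have "i = m - 1" "Suc i mod m = 0" by auto
  then have "(path_class (Suc i mod m, PartA (w @ [False]), r),
      path_class (i, PartA (w @ [True]), r)) \<in> closing_identifications"
    using assms by (auto simp: closing_identifications_iff)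
  then show ?thesis unfolding quot_def by (rule glue_class_eqI[symmetric])
qed

lemma quot_vertex_rep:
  assumes "x \<in> copy_verts"
  shows "quot (vertex_rep x) = quot x"
proof (cases "\<exists>i w r. x = (i, PartA w, r) \<and> last w")
  case True
  then obtain i w r where x: "x = (i, PartA w, r)" "last w" by blast
  then have i: "i < m" and r: "r \<in> {1..ks ! 0}" and w: "length w = length ks - 1"
    using assms by (auto simp: copy_verts_def verts_step_iff simple_step_def)
  have "w \<noteq> []" using w two_parts by auto
  then have "w = butlast w @ [True]" using x(2) append_butlast_last_id[of w] by simp
  then show ?thesis
    using quot_PartA_True[OF i, of "butlast w" r] x r w by (simp add: bits_def)
next
  case False
  then have "vertex_rep x = x" by (cases x rule: vertex_rep.cases; cases "fst (snd x)") auto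
  then show ?thesis by simp
qed

lemma quot_eq_iff: "x \<in> copy_verts \<Longrightarrow> y \<in> copy_verts \<Longrightarrow> quot x = quot y \<longleftrightarrow> vertex_rep x = vertex_rep y"
  by (metis vertex_rep_eq_of_quot_eq quot_vertex_rep)

lemma inj_on_quot: "inj_on quot cycle_verts"
  by (rule inj_onI) (metis vertex_rep_eq_of_quot_eq vertex_rep_idem)

lemma verts_hcycle: "verts (hcycle ks m) = quot ` cycle_verts"
proof -
  have "quot x \<in> quot ` cycle_verts" if "x \<in> copy_verts" for x
    using quot_vertex_rep[OF that] vertex_rep_in_cycle_verts[OF that] by (metis imageI)
  then show ?thesis using cycle_verts_subset by (auto simp: verts_hcycle_eq_quot)
qed

lemma bij_betw_cycle_block:
  "bij_betw (\<lambda>(j, w). if j = 0 then PartA (w @ [False]) else PartB j w)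
     ({..<length ks} \<times> bits (length ks - 2)) {v. cycle_block (length ks) v}"
proof (rule bij_betwI')
  fix v assume "v \<in> {v. cycle_block (length ks) v}"
  then have v: "cycle_block (length ks) v" by simp
  show "\<exists>x\<in>{..<length ks} \<times> bits (length ks - 2).
      v = (case x of (j, w) \<Rightarrow> if j = 0 then PartA (w @ [False]) else PartB j w)"
  proof (cases v)
    case (PartA w)
    then have "w \<noteq> []" using v two_parts by auto
    then show ?thesis
      using v two_parts append_butlast_last_id[of w] PartA
      by (intro bexI[of _ "(0, butlast w)"]) (auto simp: bits_def)
  next
    case (PartB j w)
    then show ?thesis using v by (intro bexI[of _ "(j, w)"]) (auto simp: bits_def)
  qed
qed (use two_parts in \<open>auto simp: bits_def split: if_splits\<close>)

lemma finite_cycle_blocks: "finite (cycle_blocks m (length ks))"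
  using bij_betw_finite[OF bij_betw_cycle_block] by (simp add: cycle_blocks_def)

lemma cycle_verts_eq_image:
  "cycle_verts = (\<lambda>((i, v), r). (i, v, r)) `
     (SIGMA x:cycle_blocks m (length ks). {1..ks ! part_of (snd x)})"
  by (force simp: cycle_verts_def)

lemma finite_verts_hcycle: "finite (verts (hcycle ks m))"
  unfolding verts_hcycle cycle_verts_eq_image
  by (intro finite_imageI finite_SigmaI finite_cycle_blocks) simp

lemma card_verts_hcycle: "card (verts (hcycle ks m)) = m * 2 ^ (length ks - 2) * sum_list ks"
proof -
  have "card (verts (hcycle ks m)) = card cycle_verts"
    unfolding verts_hcycle by (rule card_image[OF inj_on_quot])
  also have "\<dots> = (\<Sum>x\<in>cycle_blocks m (length ks). ks ! part_of (snd x))"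
    unfolding cycle_verts_eq_image using finite_cycle_blocks
    by (subst card_image) (auto simp: inj_on_def)
  also have "\<dots> = m * (\<Sum>v | cycle_block (length ks) v. ks ! part_of v)"
    by (simp add: cycle_blocks_def sum.cartesian_product' case_prod_unfold)
  also have "(\<Sum>v | cycle_block (length ks) v. ks ! part_of v)
      = (\<Sum>(j, w)\<in>{..<length ks} \<times> bits (length ks - 2). ks ! j)"
    by (subst sum.reindex_bij_betw[OF bij_betw_cycle_block, symmetric])
       (auto intro!: sum.cong split: if_splits)
  also have "\<dots> = 2 ^ (length ks - 2) * sum_list ks"
    by (simp add: sum.cartesian_product[symmetric] card_bits sum_list_sum_nth atLeast0LessThan
        flip: sum_distrib_left)
  finally show ?thesis by simp
qed

definition cycle_edge :: "nat \<Rightarrow> bool list \<Rightarrow> (nat \<times> step_vertex \<times> nat) list" where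
  "cycle_edge i w =
     concat (map (\<lambda>v. map (\<lambda>r. (i, v, r)) [1..<Suc (ks ! part_of v)]) (step_edge (length ks) w))"

lemma set_cycle_edge:
  "set (cycle_edge i w) =
     {(i, v, r) | v r. v \<in> set (step_edge (length ks) w) \<and> r \<in> {1..ks ! part_of v}}"
  by (auto simp: cycle_edge_def atLeastLessThanSuc_atLeastAtMost simp del: upt_Suc)

lemma step_edge_subset:
  "w \<in> bits (length ks - 1) \<Longrightarrow> set (step_edge (length ks) w) \<subseteq> verts (simple_step (length ks))"
  by (auto simp: step_edge_def simple_step_def bits_def length_remove_bit)

lemma cycle_edge_subset: "i < m \<Longrightarrow> w \<in> bits (length ks - 1) \<Longrightarrow> set (cycle_edge i w) \<subseteq> copy_verts"
  using step_edge_subset[of w] by (auto simp: set_cycle_edge copy_verts_def verts_step_iff)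

lemma mset_cycle_edge:
  "image_mset (Pair i)
       (mset_set {(v, r). v \<in># mset (step_edge (length ks) w) \<and> r \<in> {1..ks ! part_of v}})
     = mset (cycle_edge i w)"
proof -
  define xs where
    "xs = concat (map (\<lambda>v. map (Pair v) [1..<Suc (ks ! part_of v)]) (step_edge (length ks) w))"
  have distinct_pairs: "distinct (concat (map (\<lambda>v. map (Pair v) (f v)) vs))"
    if "distinct vs" "\<And>v. distinct (f v)" for f :: "step_vertex \<Rightarrow> nat list" and vs
    using that(1) by (induction vs) (auto simp: distinct_map inj_on_def that(2))
  have "distinct (step_edge (length ks) w)"
    by (auto simp: step_edge_def distinct_map inj_on_def)
  then have "distinct xs" unfolding xs_def by (intro distinct_pairs distinct_upt)
  moreover have "set xs = {(v, r). v \<in># mset (step_edge (length ks) w) \<and> r \<in> {1..ks ! part_of v}}"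
    by (auto simp: xs_def atLeastLessThanSuc_atLeastAtMost simp del: upt_Suc)
  ultimately have
    "mset_set {(v, r). v \<in># mset (step_edge (length ks) w) \<and> r \<in> {1..ks ! part_of v}} = mset xs"
    using mset_set_set[of xs] by simp
  then show ?thesis
    by (simp add: xs_def cycle_edge_def map_concat comp_def flip: mset_map)
qed

lemma edges_hcycle: "edges (hcycle ks m) =
    (\<lambda>(i, w). image_mset quot (mset (cycle_edge i w))) ` ({..<m} \<times> bits (length ks - 1))"
proof -
  have "edges (step ks) = (\<lambda>w. mset_set {(v, r). v \<in># mset (step_edge (length ks) w) \<and>
      r \<in> {1..ks ! part_of v}}) ` bits (length ks - 1)"
    by (auto simp: step_def simple_step_def Let_def bits_def step_edge_def image_def
        simp del: upt_Suc)
  then have "edges (hcycle ks m) = (\<lambda>(i, w). image_mset quot (image_mset (Pair i) (mset_set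
      {(v, r). v \<in># mset (step_edge (length ks) w) \<and> r \<in> {1..ks ! part_of v}}))) `
      ({..<m} \<times> bits (length ks - 1))"
    unfolding edges_hcycle_eq_quot by force
  then show ?thesis by (simp only: mset_cycle_edge)
qed

lemma one_le_part: "j < length ks \<Longrightarrow> 1 \<le> ks ! j"
  using parts_pos[of "ks ! j"] by (simp add: Suc_le_eq)

lemma block_rep_PartA_inj:
  assumes "block_rep m (i, PartA w) = block_rep m (i, PartA w')" and "Suc i mod m \<noteq> i"
    and "w \<noteq> []" and "w' \<noteq> []"
  shows "w = w'"
proof -
  have last: "last w = last w'"
  proof (rule ccontr)
    assume "last w \<noteq> last w'"
    then have "fst (block_rep m (i, PartA w)) \<noteq> fst (block_rep m (i, PartA w'))"
      using not_sym[OF assms(2)] assms(2) by (cases "last w") simp_all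
    then show False using assms(1) by (simp del: block_rep.simps)
  qed
  then have "butlast w = butlast w'"
    using assms(1) by (cases "last w") simp_all
  have "w = butlast w @ [last w]" using assms(3) by simp
  also have "\<dots> = butlast w' @ [last w']"
    by (simp only: last \<open>butlast w = butlast w'\<close>)
  also have "\<dots> = w'" using assms(4) by simp
  finally show ?thesis .
qed

lemma cycle_edge_unique:
  assumes "m \<ge> 2" and "i < m" and w: "w \<in> bits (length ks - 1)" "w' \<in> bits (length ks - 1)"
    and same: "vertex_rep ` set (cycle_edge i w) \<subseteq> vertex_rep ` set (cycle_edge i' w')"
  shows "i = i' \<and> w = w'"
proof -
  have in_edge: "(i, v, 1) \<in> set (cycle_edge i w)" if "v \<in> set (step_edge (length ks) w)" for v
  proof -
    have "part_of v < length ks" using that two_parts by (auto simp: step_edge_def)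
    with that one_le_part show ?thesis by (auto simp: set_cycle_edge)
  qed
  have rep: "\<exists>v'\<in>set (step_edge (length ks) w'). block_rep m (i, v) = block_rep m (i', v')"
    if "v \<in> set (step_edge (length ks) w)" for v
  proof -
    have "vertex_rep (i, v, 1) \<in> vertex_rep ` set (cycle_edge i' w')"
      using same in_edge[OF that] by blast
    then show ?thesis by (auto simp: set_cycle_edge prod_eq_iff)
  qed
  have "PartB 1 (remove_bit 1 w) \<in> set (step_edge (length ks) w)"
    using two_parts by (auto simp: step_edge_def)
  from rep[OF this] have "i = i'"
    by (auto simp: step_edge_def split: if_splits)
  have "\<exists>v'\<in>set (step_edge (length ks) w'). block_rep m (i, PartA w) = block_rep m (i', v')"
    by (rule rep) (simp add: step_edge_def)
  then have "block_rep m (i, PartA w) = block_rep m (i, PartA w')"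
    by (auto simp: step_edge_def \<open>i = i'\<close> split: if_splits)
  moreover have "Suc i mod m \<noteq> i"
    using \<open>i < m\<close> \<open>m \<ge> 2\<close> by (cases "Suc i = m") auto
  moreover have "w \<noteq> []" "w' \<noteq> []"
    using w two_parts by (auto simp: bits_def)
  ultimately have "w = w'" by (rule block_rep_PartA_inj)
  with \<open>i = i'\<close> show ?thesis by simp
qed

lemma card_edges_hcycle:
  assumes "m \<ge> 2"
  shows "card (edges (hcycle ks m)) = m * 2 ^ (length ks - 1)"
proof -
  have "inj_on (\<lambda>(i, w). image_mset quot (mset (cycle_edge i w))) ({..<m} \<times> bits (length ks - 1))"
  proof (rule inj_onI, clarify)
    fix i w i' w'
    assume i: "i < m" "i' < m" and w: "w \<in> bits (length ks - 1)" "w' \<in> bits (length ks - 1)"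
      and eq: "image_mset quot (mset (cycle_edge i w)) = image_mset quot (mset (cycle_edge i' w'))"
    have quot_eq: "quot ` set (cycle_edge i w) = quot ` set (cycle_edge i' w')"
      using arg_cong[OF eq, of set_mset] by simp
    have "vertex_rep ` set (cycle_edge i w) \<subseteq> vertex_rep ` set (cycle_edge i' w')"
    proof (rule image_subsetI)
      fix x assume "x \<in> set (cycle_edge i w)"
      then have "quot x \<in> quot ` set (cycle_edge i' w')" using quot_eq by blast
      then obtain y where "quot x = quot y" and y: "y \<in> set (cycle_edge i' w')" by (rule imageE)
      from \<open>quot x = quot y\<close> have "vertex_rep x = vertex_rep y" by (rule vertex_rep_eq_of_quot_eq)
      with y show "vertex_rep x \<in> vertex_rep ` set (cycle_edge i' w')" by (rule rev_image_eqI)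
    qed
    then show "i = i' \<and> w = w'" by (rule cycle_edge_unique[OF assms i(1) w])
  qed
  from card_image[OF this] show ?thesis
    by (simp add: edges_hcycle card_cartesian_product card_bits)
qed

end

section \<open>Homomorphisms of the cycle\<close>

definition homomorphisms :: "'b hypergraph \<Rightarrow> 'a hypergraph \<Rightarrow> ('b \<Rightarrow> 'a) set" where
  "homomorphisms F H = {\<alpha> \<in> verts F \<rightarrow>\<^sub>E verts H. \<forall>E\<in>edges F. image_mset \<alpha> E \<in> edges H}"

definition edge_kernel :: "'a hypergraph \<Rightarrow> 'a list list \<Rightarrow> real" where
  "edge_kernel H bs = (if mset (concat bs) \<in> edges H then 1 else 0)"

lemma card_PiE_identify_le:
  assumes "finite A" and "finite B" and "x \<in> A" "y \<in> A" "x \<noteq> y"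
  shows "card {\<alpha> \<in> A \<rightarrow>\<^sub>E B. \<alpha> x = \<alpha> y} \<le> card B ^ (card A - 1)"
proof -
  have "card {\<alpha> \<in> A \<rightarrow>\<^sub>E B. \<alpha> x = \<alpha> y} \<le> card ((A - {x}) \<rightarrow>\<^sub>E B)"
  proof (rule card_inj_on_le[of "\<lambda>\<alpha>. restrict \<alpha> (A - {x})"])
    show "inj_on (\<lambda>\<alpha>. restrict \<alpha> (A - {x})) {\<alpha> \<in> A \<rightarrow>\<^sub>E B. \<alpha> x = \<alpha> y}"
    proof (rule inj_onI)
      fix \<alpha> \<beta> assume mem: "\<alpha> \<in> {\<alpha> \<in> A \<rightarrow>\<^sub>E B. \<alpha> x = \<alpha> y}" "\<beta> \<in> {\<alpha> \<in> A \<rightarrow>\<^sub>E B. \<alpha> x = \<alpha> y}"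
        and eq: "restrict \<alpha> (A - {x}) = restrict \<beta> (A - {x})"
      have off_x: "\<alpha> z = \<beta> z" if "z \<in> A" "z \<noteq> x" for z
        using fun_cong[OF eq, of z] that by simp
      have "\<alpha> z = \<beta> z" if "z \<in> A" for z
        using off_x[OF that] off_x[of y] mem assms by (cases "z = x") auto
      then show "\<alpha> = \<beta>" using mem by (auto intro: PiE_ext)
    qed
    show "(\<lambda>\<alpha>. restrict \<alpha> (A - {x})) ` {\<alpha> \<in> A \<rightarrow>\<^sub>E B. \<alpha> x = \<alpha> y} \<subseteq> (A - {x}) \<rightarrow>\<^sub>E B"
      by (intro image_subsetI, subst restrict_PiE_iff) (auto dest: PiE_mem)
    show "finite ((A - {x}) \<rightarrow>\<^sub>E B)" using assms by (intro finite_PiE) auto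
  qed
  also have "\<dots> = card B ^ (card A - 1)"
    using assms by (simp add: card_PiE)
  finally show ?thesis .
qed

lemma card_homomorphisms_le:
  assumes finite_F: "finite (verts F)" and finite_H: "finite (verts H)"
  shows "card (homomorphisms F H) \<le> card (labeled_copies F H)
     + card (verts F) ^ 2 * card (verts H) ^ (card (verts F) - 1)"
proof -
  define P where "P = {(x, y) \<in> verts F \<times> verts F. x \<noteq> y}"
  define S where "S = (\<lambda>(x, y). {\<alpha> \<in> verts F \<rightarrow>\<^sub>E verts H. \<alpha> x = \<alpha> y})"
  have "P \<subseteq> verts F \<times> verts F" by (auto simp: P_def)
  then have pairs: "finite P" "card P \<le> card (verts F) ^ 2"
    using finite_F card_mono[of "verts F \<times> verts F" P]
    by (auto simp: card_cartesian_product power2_eq_square intro: finite_subset)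
  have maps: "finite (verts F \<rightarrow>\<^sub>E verts H)" using finite_F finite_H by (intro finite_PiE) auto
  have finite_parts: "finite (S z)" "finite (labeled_copies F H)" for z
    unfolding S_def case_prod_unfold labeled_copies_def by (auto intro: finite_subset[OF _ maps])
  have "homomorphisms F H \<subseteq> labeled_copies F H \<union> (\<Union>z\<in>P. S z)"
    by (auto simp: homomorphisms_def labeled_copies_def inj_on_def P_def S_def)
  then have "card (homomorphisms F H) \<le> card (labeled_copies F H \<union> (\<Union>z\<in>P. S z))"
    using pairs finite_parts by (intro card_mono) auto
  also have "\<dots> \<le> card (labeled_copies F H) + card (\<Union>z\<in>P. S z)"
    by (rule card_Un_le)
  also have "card (\<Union>z\<in>P. S z) \<le> (\<Sum>z\<in>P. card (S z))"
    by (rule card_UN_le[OF pairs(1)])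
  also have "\<dots> \<le> of_nat (card P) * card (verts H) ^ (card (verts F) - 1)"
    by (rule sum_bounded_above)
       (use card_PiE_identify_le[OF finite_F finite_H] in \<open>auto simp: P_def S_def\<close>)
  also have "\<dots> \<le> card (verts F) ^ 2 * card (verts H) ^ (card (verts F) - 1)"
    using pairs(2) by simp
  finally show ?thesis by simp
qed

context step_cycle
begin

definition edge_preserving_assignments :: "'a hypergraph \<Rightarrow> (nat \<times> step_vertex \<Rightarrow> 'a list) set" where
  "edge_preserving_assignments H = {\<phi> \<in> assignments m (verts H) ks. \<forall>i<m. \<forall>w\<in>bits (length ks - 1).
     mset (concat (edge_blocks m (length ks) \<phi> i w)) \<in> edges H}"

fun vertex_value :: "(nat \<times> step_vertex \<Rightarrow> 'a list) \<Rightarrow> nat \<times> step_vertex \<times> nat \<Rightarrow> 'a" where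
  "vertex_value \<phi> (i, v, r) = \<phi> (block_rep m (i, v)) ! (r - 1)"

definition map_of_assignment ::
    "(nat \<times> step_vertex \<Rightarrow> 'a list) \<Rightarrow> (nat \<times> step_vertex \<times> nat) set set \<Rightarrow> 'a" where
  "map_of_assignment \<phi> =
     (\<lambda>c\<in>verts (hcycle ks m). vertex_value \<phi> (inv_into copy_verts quot c))"

lemma finite_assignments: "finite V \<Longrightarrow> finite (assignments m V ks)"
  unfolding assignments_def using finite_cycle_blocks by (intro finite_PiE) auto

lemma cycle_sum_edge_kernel:
  assumes "finite (verts H)"
  shows "cycle_sum m (verts H) ks (edge_kernel H) = card (edge_preserving_assignments H)"
proof -
  let ?Q = "\<lambda>\<phi> i w. mset (concat (edge_blocks m (length ks) \<phi> i w)) \<in> edges H"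
  have indicator: "(\<Prod>x\<in>A. if R x then 1 else 0 :: real) = (if \<forall>x\<in>A. R x then 1 else 0)"
    if "finite A" for A and R :: "'z \<Rightarrow> bool"
    using that by (induction A rule: finite_induct) auto
  have "cycle_sum m (verts H) ks (edge_kernel H) = (\<Sum>\<phi>\<in>assignments m (verts H) ks.
      if \<forall>i<m. \<forall>w\<in>bits (length ks - 1). ?Q \<phi> i w then 1 else 0)"
    by (simp add: cycle_sum_def edge_kernel_def indicator Ball_def)
  then show ?thesis
    using finite_assignments[OF assms]
    by (simp add: edge_preserving_assignments_def sum.If_cases Int_def)
qed

lemma vertex_value_vertex_rep: "x \<in> copy_verts \<Longrightarrow> vertex_value \<phi> (vertex_rep x) = vertex_value \<phi> x"
  by (cases x) (auto simp: copy_verts_def verts_step_iff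
      block_rep_idem[OF block_rep_in_cycle_blocks(1)] simp del: block_rep.simps)

lemma map_of_assignment_quot:
  assumes "x \<in> copy_verts"
  shows "map_of_assignment \<phi> (quot x) = vertex_value \<phi> x"
proof -
  let ?y = "inv_into copy_verts quot (quot x)"
  have "quot ?y = quot x" "?y \<in> copy_verts"
    using assms by (simp_all add: f_inv_into_f inv_into_into)
  then have "vertex_value \<phi> ?y = vertex_value \<phi> x"
    using assms quot_eq_iff vertex_value_vertex_rep by metis
  then show ?thesis
    using assms by (simp add: map_of_assignment_def verts_hcycle_eq_quot)
qed

lemma assignment_block_rep:
  assumes "\<phi> \<in> assignments m V ks" and "i < m" and "v \<in> verts (simple_step (length ks))"
  shows "\<phi> (block_rep m (i, v)) \<in> tuples V (ks ! part_of v)"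
  using assignments_tuples[OF assms(1)] block_rep_in_cycle_blocks[OF assms(2,3)] by metis

lemma vertex_value_in:
  assumes "\<phi> \<in> assignments m V ks" and "x \<in> copy_verts"
  shows "vertex_value \<phi> x \<in> V"
proof -
  obtain i v r where x: "x = (i, v, r)" by (cases x)
  then have "\<phi> (block_rep m (i, v)) \<in> tuples V (ks ! part_of v)" "r - 1 < ks ! part_of v"
    using assms assignment_block_rep by (auto simp: copy_verts_def verts_step_iff)
  then show ?thesis by (auto simp: x tuples_def)
qed

lemma map_vertex_value_cycle_edge:
  assumes \<phi>: "\<phi> \<in> assignments m V ks" and "i < m" and w: "w \<in> bits (length ks - 1)"
  shows "map (vertex_value \<phi>) (cycle_edge i w) = concat (edge_blocks m (length ks) \<phi> i w)"
proof -
  have "map (\<lambda>r. vertex_value \<phi> (i, v, r)) [1..<Suc (ks ! part_of v)] = \<phi> (block_rep m (i, v))"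
    if "v \<in> set (step_edge (length ks) w)" for v
  proof (rule nth_equalityI)
    have "v \<in> verts (simple_step (length ks))" using that step_edge_subset[OF w] by blast
    then have "length (\<phi> (block_rep m (i, v))) = ks ! part_of v"
      using assignment_block_rep[OF \<phi> \<open>i < m\<close>] by (simp add: tuples_def)
    then show "length (map (\<lambda>r. vertex_value \<phi> (i, v, r)) [1..<Suc (ks ! part_of v)])
        = length (\<phi> (block_rep m (i, v)))" by simp
  qed (simp del: upt_Suc block_rep.simps)
  then show ?thesis
    by (simp add: cycle_edge_def edge_blocks_def map_concat comp_def del: upt_Suc vertex_value.simps
        cong: map_cong)
qed

lemma map_of_assignment_in_homomorphisms:
  assumes "\<phi> \<in> edge_preserving_assignments H"
  shows "map_of_assignment \<phi> \<in> homomorphisms (hcycle ks m) H"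
proof -
  have \<phi>: "\<phi> \<in> assignments m (verts H) ks"
    using assms by (simp add: edge_preserving_assignments_def)
  have "map_of_assignment \<phi> \<in> verts (hcycle ks m) \<rightarrow>\<^sub>E verts H"
    using vertex_value_in[OF \<phi>]
    by (auto simp: verts_hcycle_eq_quot map_of_assignment_quot)
       (simp add: map_of_assignment_def verts_hcycle_eq_quot)
  moreover have "image_mset (map_of_assignment \<phi>) E \<in> edges H"
    if edge: "E \<in> edges (hcycle ks m)" for E
  proof -
    obtain i w where i: "i < m" and w: "w \<in> bits (length ks - 1)"
      and E: "E = image_mset quot (mset (cycle_edge i w))"
      using edge by (auto simp: edges_hcycle)
    have "image_mset (map_of_assignment \<phi>) E
        = mset (map (\<lambda>x. map_of_assignment \<phi> (quot x)) (cycle_edge i w))"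
      by (simp add: E multiset.map_comp comp_def)
    also have "\<dots> = mset (map (vertex_value \<phi>) (cycle_edge i w))"
      unfolding mset_map using cycle_edge_subset[OF i w]
      by (intro image_mset_cong) (auto simp: map_of_assignment_quot)
    also have "\<dots> = mset (concat (edge_blocks m (length ks) \<phi> i w))"
      by (simp only: map_vertex_value_cycle_edge[OF \<phi> i w])
    finally show ?thesis using assms i w by (simp add: edge_preserving_assignments_def)
  qed
  ultimately show ?thesis by (simp add: homomorphisms_def)
qed

lemma inj_on_map_of_assignment: "inj_on map_of_assignment (assignments m V ks)"
proof (rule inj_onI)
  fix \<phi> \<phi>' assume \<phi>: "\<phi> \<in> assignments m V ks" "\<phi>' \<in> assignments m V ks"
    and eq: "map_of_assignment \<phi> = map_of_assignment \<phi>'"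
  show "\<phi> = \<phi>'"
  proof (rule PiE_ext[OF \<phi>[unfolded assignments_def]])
    fix x assume x: "x \<in> cycle_blocks m (length ks)"
    obtain i v where xe: "x = (i, v)" by (cases x)
    have len: "length (\<psi> x) = ks ! part_of v" if "\<psi> \<in> assignments m V ks" for \<psi>
      using assignments_tuples[OF that x] by (simp add: xe tuples_def)
    show "\<phi> x = \<phi>' x"
    proof (rule nth_equalityI)
      fix r assume "r < length (\<phi> x)"
      then have "(i, v, Suc r) \<in> cycle_verts"
        using x len[OF \<phi>(1)] by (auto simp: cycle_verts_def xe)
      then have "(i, v, Suc r) \<in> copy_verts" using cycle_verts_subset by blast
      then have "vertex_value \<phi> (i, v, Suc r) = vertex_value \<phi>' (i, v, Suc r)"
        using eq by (metis map_of_assignment_quot)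
      then show "\<phi> x ! r = \<phi>' x ! r"
        using block_rep_idem[OF x] by (simp add: xe del: block_rep.simps)
    qed (simp add: len \<phi>)
  qed
qed

lemma card_edge_preserving_assignments_le:
  assumes "finite (verts H)"
  shows "card (edge_preserving_assignments H) \<le> card (homomorphisms (hcycle ks m) H)"
proof (rule card_inj_on_le[of map_of_assignment])
  show "inj_on map_of_assignment (edge_preserving_assignments H)"
    by (rule inj_on_subset[OF inj_on_map_of_assignment])
       (auto simp: edge_preserving_assignments_def)
  show "map_of_assignment ` edge_preserving_assignments H \<subseteq> homomorphisms (hcycle ks m) H"
    using map_of_assignment_in_homomorphisms by blast
  show "finite (homomorphisms (hcycle ks m) H)"
    using finite_PiE[of "verts (hcycle ks m)" "\<lambda>_. verts H"] assms finite_verts_hcycle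
    by (simp add: homomorphisms_def)
qed

lemma cycle_sum_edge_kernel_le:
  assumes "finite (verts H)"
  defines "v \<equiv> card (verts (hcycle ks m))"
  shows "cycle_sum m (verts H) ks (edge_kernel H)
    \<le> real (card (labeled_copies (hcycle ks m) H)) + real v ^ 2 * real (card (verts H)) ^ (v - 1)"
proof -
  have "card (edge_preserving_assignments H)
      \<le> card (labeled_copies (hcycle ks m) H) + v ^ 2 * card (verts H) ^ (v - 1)"
    using card_edge_preserving_assignments_le[OF assms(1)]
      card_homomorphisms_le[OF finite_verts_hcycle assms(1)]
    unfolding v_def by linarith
  then show ?thesis
    unfolding cycle_sum_edge_kernel[OF assms(1)]
    by (simp flip: of_nat_power of_nat_mult of_nat_add)
qed

end

section \<open>The spectral quantities as kernel norms\<close>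

lemma multilinear_extension_basis:
  assumes "finite V" and vs: "vs \<in> tuples V k"
  shows "multilinear_extension V k c (map std_basis vs) = c vs"
proof -
  have "(\<Prod>i<k. (map std_basis vs ! i) (us ! i)) = (if us = vs then 1 else 0)"
    if us: "us \<in> tuples V k" for us
  proof (cases "us = vs")
    case False
    then obtain i where "i < k" "us ! i \<noteq> vs ! i"
      using us vs by (auto simp: tuples_def list_eq_iff_nth_eq)
    then have "(\<Prod>i<k. (map std_basis vs ! i) (us ! i)) = 0"
      using vs by (intro prod_zero) (auto simp: tuples_def std_basis_def intro!: bexI[of _ i])
    then show ?thesis using False by simp
  qed (use vs in \<open>simp add: tuples_def std_basis_def\<close>)
  then have "multilinear_extension V k c (map std_basis vs)
      = (\<Sum>us\<in>tuples V k. if us = vs then c vs else 0)"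
    unfolding multilinear_extension_def by (intro sum.cong refl) simp
  then show ?thesis using assms by simp
qed

lemma partition_map_multilinear_extension:
  assumes "finite V" and "length us = length ks"
  shows "partition_map V ks (multilinear_extension V (sum_list ks) c) us
     = tensor_form V ks (\<lambda>bs. c (concat bs)) us"
proof -
  have "{bs. length bs = length ks \<and> (\<forall>i<length ks. bs ! i \<in> tuples V (ks ! i))} = blocks V ks"
    by (auto simp: blocks_def list_all2_conv_all_nth)
  then show ?thesis
    unfolding partition_map_def tensor_form_def inner_on_def
    using assms(2) length_blocks[of _ V ks] multilinear_extension_basis[OF assms(1) concat_blocks]
    by (intro sum.cong) (auto simp: pure_tensor_eq_prod)
qed

lemma spectral_norm_cong:
  assumes "\<And>us. unit_vectors V ks us \<Longrightarrow> \<phi> us = \<psi> us"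
  shows "spectral_norm V ks \<phi> = spectral_norm V ks \<psi>"
  unfolding spectral_norm_def using assms
  by (intro SUP_cong refl) (simp add: unit_vectors_iff_L2_set)

lemma lambda1_eq_kernel_norm:
  assumes "finite (verts H)"
  shows "lambda1 ks H = kernel_norm (verts H) ks (edge_kernel H)"
  unfolding lambda1_def kernel_norm_def adjacency_map_def
  by (rule spectral_norm_cong)
     (simp add: partition_map_multilinear_extension[OF assms] unit_vectors_length
        edge_kernel_def[abs_def])

definition edge_density :: "nat \<Rightarrow> 'a hypergraph \<Rightarrow> real" where
  "edge_density k H = fact k * real (card (edges H)) / real (card (verts H)) ^ k"

lemma lambda2_eq_kernel_norm:
  assumes "finite (verts H)"
  shows "lambda2 ks H
    = kernel_norm (verts H) ks (\<lambda>bs. edge_kernel H bs - edge_density (sum_list ks) H)"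
  unfolding lambda2_def Let_def kernel_norm_def adjacency_map_def all_ones_map_def
proof (rule spectral_norm_cong)
  fix us assume "unit_vectors (verts H) ks us"
  then have "length us = length ks" by (rule unit_vectors_length)
  then show "partition_map (verts H) ks (multilinear_extension (verts H) (sum_list ks)
        (\<lambda>vs. if mset vs \<in> edges H then 1 else 0)) us
      - fact (sum_list ks) * real (card (edges H)) / real (card (verts H)) ^ sum_list ks
        * partition_map (verts H) ks (multilinear_extension (verts H) (sum_list ks) (\<lambda>_. 1)) us
      = tensor_form (verts H) ks (\<lambda>bs. edge_kernel H bs - edge_density (sum_list ks) H) us"
    using tensor_form_diff_scaled[of "verts H" ks "edge_kernel H"
        "edge_density (sum_list ks) H" "\<lambda>_. 1" us]
    by (simp add: partition_map_multilinear_extension[OF assms] edge_kernel_def[abs_def]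
        edge_density_def)
qed

definition normalized_kernel :: "nat \<Rightarrow> 'a hypergraph \<Rightarrow> 'a list list \<Rightarrow> real" where
  "normalized_kernel k H bs = 1 / sqrt (real (card (verts H))) ^ k * edge_kernel H bs"

lemma kernel_norm_cong:
  assumes "\<And>bs. bs \<in> blocks V ls \<Longrightarrow> g bs = h bs"
  shows "kernel_norm V ls g = kernel_norm V ls h"
proof -
  have "tensor_form V ls g = tensor_form V ls h"
    using assms by (auto simp: fun_eq_iff tensor_form_def inner_on_def)
  then show ?thesis by (simp add: kernel_norm_def)
qed

lemma uniform_kernel_eq:
  assumes "bs \<in> blocks V ls"
  shows "uniform_kernel V bs = 1 / sqrt (real (card V)) ^ sum_list ls"
  using concat_blocks[OF assms]
  by (simp add: uniform_kernel_def uniform_vector_def tuples_def power_one_over)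

context
  fixes H :: "'a hypergraph"
  assumes finite_verts: "finite (verts H)" and nonempty_verts: "verts H \<noteq> {}"
begin

lemma kernel_norm_normalized_kernel:
  "kernel_norm (verts H) ks (normalized_kernel (sum_list ks) H)
     = lambda1 ks H / sqrt (real (card (verts H))) ^ sum_list ks"
  using kernel_norm_scale[OF finite_verts nonempty_verts, of ks
      "1 / sqrt (real (card (verts H))) ^ sum_list ks" "edge_kernel H"]
  by (simp add: normalized_kernel_def[abs_def] lambda1_eq_kernel_norm[OF finite_verts])

lemma deviation_normalized_kernel:
  "deviation (edge_density (sum_list ks) H) (verts H) ks (normalized_kernel (sum_list ks) H)
     = lambda2 ks H / sqrt (real (card (verts H))) ^ sum_list ks"
proof -
  let ?q = "edge_density (sum_list ks) H" and ?c = "1 / sqrt (real (card (verts H))) ^ sum_list ks"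
  have "deviation ?q (verts H) ks (normalized_kernel (sum_list ks) H)
      = kernel_norm (verts H) ks (\<lambda>bs. ?c * (edge_kernel H bs - ?q))"
    unfolding deviation_def
    by (rule kernel_norm_cong)
       (simp add: normalized_kernel_def uniform_kernel_eq algebra_simps diff_divide_distrib)
  then show ?thesis
    using kernel_norm_scale[OF finite_verts nonempty_verts, of ks ?c "\<lambda>bs. edge_kernel H bs - ?q"]
    by (simp add: lambda2_eq_kernel_norm[OF finite_verts])
qed

lemma kernel_density_normalized_kernel:
  "kernel_density (verts H) ks (normalized_kernel (sum_list ks) H)
     = real (card {vs \<in> tuples (verts H) (sum_list ks). mset vs \<in> edges H})
         / real (card (verts H)) ^ sum_list ks"
proof -
  let ?k = "sum_list ks" and ?N = "real (card (verts H))"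
  have "(sqrt ?N ^ ?k) * (sqrt ?N ^ ?k) = ?N ^ ?k" by (simp flip: power_mult_distrib)
  then have "kernel_density (verts H) ks (normalized_kernel ?k H)
      = (\<Sum>bs\<in>blocks (verts H) ks.
          (\<lambda>vs. (if mset vs \<in> edges H then 1 else 0) / ?N ^ ?k) (concat bs))"
    unfolding kernel_density_def inner_on_def
    by (intro sum.cong refl) (simp add: normalized_kernel_def edge_kernel_def uniform_kernel_eq)
  also have "\<dots> = (\<Sum>vs\<in>tuples (verts H) ?k. (if mset vs \<in> edges H then 1 else 0) / ?N ^ ?k)"
    by (rule sum_blocks_concat)
  finally show ?thesis
    using finite_verts by (simp add: sum.If_cases Int_def flip: sum_divide_distrib)
qed

end

lemma (in step_cycle) cycle_sum_normalized_kernel_le: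
  assumes finite_nonempty: "finite (verts H)" "verts H \<noteq> {}"
  defines "v \<equiv> card (verts (hcycle ks m))" and "n \<equiv> real (card (verts H))"
  shows "cycle_sum m (verts H) ks (normalized_kernel (sum_list ks) H)
    \<le> real (card (labeled_copies (hcycle ks m) H)) / n ^ v + real v ^ 2 / n"
proof -
  have n_pos: "n > 0" using finite_nonempty by (simp add: n_def card_gt_0_iff)
  have "(2::nat) ^ (length ks - 1) = 2 * 2 ^ (length ks - 2)"
    using two_parts by (simp add: power_eq_if numeral_2_eq_2)
  then have "(sqrt n ^ sum_list ks) ^ (m * 2 ^ (length ks - 1)) = sqrt n ^ (2 * v)"
    by (simp add: v_def card_verts_hcycle mult_ac flip: power_mult)
  also have "\<dots> = n ^ v" using n_pos by (simp add: power_mult)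
  finally have "cycle_sum m (verts H) ks (normalized_kernel (sum_list ks) H)
      = cycle_sum m (verts H) ks (edge_kernel H) / n ^ v"
    by (simp add: normalized_kernel_def[abs_def] cycle_sum_scale[of _ _ _ "1 / _", simplified]
        power_one_over n_def)
  also have "\<dots> \<le> (real (card (labeled_copies (hcycle ks m) H)) + real v ^ 2 * n ^ (v - 1)) / n ^ v"
    unfolding v_def n_def by (intro divide_right_mono cycle_sum_edge_kernel_le finite_nonempty) simp
  also have "\<dots> = real (card (labeled_copies (hcycle ks m) H)) / n ^ v + real v ^ 2 / n"
    using n_pos by (cases v) (auto simp: add_divide_distrib)
  finally show ?thesis .
qed

section \<open>Independence of the ordering\<close>

lemma pure_tensor_permute_list:
  assumes perm: "p permutes {..<length bs}" and len: "length us = length bs"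
  shows "pure_tensor (permute_list p us) (permute_list p bs) = pure_tensor us bs"
proof -
  have "map2 (\<lambda>u b. u b) (permute_list p us) (permute_list p bs)
      = permute_list p (map2 (\<lambda>u b. u b) us bs)"
    using perm len by (simp add: permute_list_zip permute_list_map)
  then show ?thesis
    using perm len by (simp add: pure_tensor_def flip: prod_mset_prod_list)
qed

lemma mset_concat_permute_list:
  assumes "p permutes {..<length bs}"
  shows "mset (concat (permute_list p bs)) = mset (concat bs)"
  using assms by (simp add: mset_concat flip: sum_mset_sum_list)

lemma permute_list_in_blocks:
  "p permutes {..<length ls} \<Longrightarrow> bs \<in> blocks V ls \<Longrightarrow> permute_list p bs \<in> blocks V (permute_list p ls)"
  by (simp add: blocks_def list_all2_permute_list_iff list_all2_lengthD)

lemma unit_vectors_permute_list: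
  "p permutes {..<length ls} \<Longrightarrow> unit_vectors V ls us \<Longrightarrow>
     unit_vectors V (permute_list p ls) (permute_list p us)"
  by (simp add: unit_vectors_def list_all2_permute_list_iff list_all2_lengthD)

lemma bij_betw_permute_list_blocks:
  assumes perm: "p permutes {..<length ls}"
  shows "bij_betw (permute_list p) (blocks V ls) (blocks V (permute_list p ls))"
proof (rule bij_betw_byWitness[of _ "permute_list (inv p)"])
  note inv = permutes_inv[OF perm]
  have inverse: "permute_list (inv p) (permute_list p xs) = xs"
    "permute_list p (permute_list (inv p) xs) = xs"
    if "length xs = length ls" for xs :: "'b list"
    using that perm inv permute_list_compose[of "inv p" xs p] permute_list_compose[of p xs "inv p"]
    by (simp_all add: permutes_inv_o[OF perm])
  show "\<forall>bs\<in>blocks V ls. permute_list (inv p) (permute_list p bs) = bs"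
    "\<forall>bs\<in>blocks V (permute_list p ls). permute_list p (permute_list (inv p) bs) = bs"
    by (auto simp: inverse dest!: length_blocks)
  show "permute_list p ` blocks V ls \<subseteq> blocks V (permute_list p ls)"
    using permute_list_in_blocks[OF perm] by blast
  show "permute_list (inv p) ` blocks V (permute_list p ls) \<subseteq> blocks V ls"
    using permute_list_in_blocks[of "inv p" "permute_list p ls"] inv
    by (auto simp: inverse)
qed

lemma tensor_form_permute_list:
  fixes c :: "'a multiset \<Rightarrow> real"
  assumes perm: "p permutes {..<length ls}" and us: "length us = length ls"
  shows "tensor_form V (permute_list p ls) (\<lambda>bs. c (mset (concat bs))) (permute_list p us)
     = tensor_form V ls (\<lambda>bs. c (mset (concat bs))) us"
  unfolding tensor_form_def inner_on_def
    sum.reindex_bij_betw[OF bij_betw_permute_list_blocks[OF perm], symmetric]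
  using perm us by (intro sum.cong refl)
    (auto simp: mset_concat_permute_list pure_tensor_permute_list dest!: length_blocks)

lemma kernel_norm_cong_mset:
  fixes c :: "'a multiset \<Rightarrow> real"
  assumes finite_nonempty: "finite V" "V \<noteq> {}" and "mset ls = mset ls'"
  defines "g \<equiv> \<lambda>bs. c (mset (concat bs))"
  shows "kernel_norm V ls g = kernel_norm V ls' g"
proof -
  have kernel_norm_le: "kernel_norm V ls g \<le> kernel_norm V ls' g"
    if eq: "mset ls' = mset ls" for ls ls'
  proof (rule kernel_norm_leI[OF finite_nonempty])
    obtain p where perm: "p permutes {..<length ls}" "permute_list p ls = ls'"
      using mset_eq_permutation[OF eq] by metis
    fix us assume unit_us: "unit_vectors V ls us"
    have "tensor_form V ls g us = tensor_form V ls' g (permute_list p us)"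
      using tensor_form_permute_list[OF perm(1) unit_vectors_length[OF unit_us]]
      by (simp add: g_def perm(2))
    then show "\<bar>tensor_form V ls g us\<bar> \<le> kernel_norm V ls' g"
      using abs_tensor_form_le_kernel_norm unit_vectors_permute_list[OF perm(1) unit_us]
      by (simp add: perm(2))
  qed
  show ?thesis using kernel_norm_le[of ls ls'] kernel_norm_le[of ls' ls] assms(3) by simp
qed

lemma
  assumes finite_nonempty: "finite (verts H)" "verts H \<noteq> {}" and same_parts: "mset ks = mset ks'"
  shows lambda1_cong_mset: "lambda1 ks H = lambda1 ks' H"
    and lambda2_cong_mset: "lambda2 ks H = lambda2 ks' H"
proof -
  show "lambda1 ks H = lambda1 ks' H"
    using kernel_norm_cong_mset[OF finite_nonempty same_parts,
        of "\<lambda>E. if E \<in> edges H then 1 else 0"]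
    by (simp add: lambda1_eq_kernel_norm[OF finite_nonempty(1)] edge_kernel_def[abs_def])
  have "sum_list ks = sum_list ks'" using same_parts by (metis sum_mset_sum_list)
  then show "lambda2 ks H = lambda2 ks' H"
    using kernel_norm_cong_mset[OF finite_nonempty same_parts,
        of "\<lambda>E. (if E \<in> edges H then 1 else 0) - edge_density (sum_list ks) H"]
    by (simp add: lambda2_eq_kernel_norm[OF finite_nonempty(1)] edge_kernel_def[abs_def])
qed

section \<open>Counting edges\<close>

definition binomial_ratio :: "nat \<Rightarrow> nat \<Rightarrow> real" where
  "binomial_ratio k n = fact k * real (n choose k) / real n ^ k"

lemma binomial_ratio_tendsto_1: "binomial_ratio k \<longlonglongrightarrow> 1"
proof (rule Lim_transform_eventually)
  have "(\<lambda>n. \<Prod>i<k. 1 - real i / real n) \<longlonglongrightarrow> (\<Prod>i<k. 1 - 0)"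
    by (intro tendsto_intros lim_const_over_n)
  then show "(\<lambda>n. \<Prod>i<k. 1 - real i / real n) \<longlonglongrightarrow> 1" by simp
  show "\<forall>\<^sub>F n in sequentially. (\<Prod>i<k. 1 - real i / real n) = binomial_ratio k n"
    using eventually_gt_at_top[of 0]
  proof eventually_elim
    case (elim n)
    then have "(\<Prod>i<k. 1 - real i / real n) = (\<Prod>i<k. (real n - real i) / real n)"
      by (intro prod.cong refl) (simp add: field_simps)
    also have "\<dots> = binomial_ratio k n"
      by (simp add: binomial_ratio_def binomial_gbinomial gbinomial_prod_rev prod_dividef
          atLeast0LessThan)
    finally show ?case .
  qed
qed

lemma card_distinct_tuples:
  assumes "finite V" and "k \<le> card V"
  shows "card {vs \<in> tuples V k. distinct vs} = fact k * (card V choose k)"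
proof -
  have "card {vs \<in> tuples V k. distinct vs} = \<Prod>{card V - k + 1..card V}"
    using card_lists_distinct_length_eq[OF assms]
    by (simp add: tuples_def conj_commute conj_left_commute)
  also have "\<dots> = fact (card V) div fact (card V - k)"
    by (simp add: fact_div_fact)
  also have "fact (card V) = fact (card V - k) * (fact k * (card V choose k))"
    using binomial_fact_lemma[OF assms(2)] by (simp add: mult_ac)
  finally show ?thesis by simp
qed

lemma card_eq_fact_mult_card_mset_image:
  assumes "finite D" and "\<And>vs. vs \<in> D \<Longrightarrow> distinct vs \<and> length vs = k"
    and closed: "\<And>us vs. vs \<in> D \<Longrightarrow> mset us = mset vs \<Longrightarrow> us \<in> D"
  shows "card D = fact k * card (mset ` D)"
proof -
  have "card {us \<in> D. mset us = E} = fact k" if E: "E \<in> mset ` D" for E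
  proof -
    obtain vs where vs: "vs \<in> D" "E = mset vs" using E by blast
    then have "distinct vs" "length vs = k" using assms(2) by auto
    then have "{us \<in> D. mset us = E} = permutations_of_set (set vs)"
      using vs closed
      by (auto simp: permutations_of_set_altdef permutations_of_multiset_def mset_set_set)
    then show ?thesis using \<open>distinct vs\<close> \<open>length vs = k\<close> by (simp add: distinct_card)
  qed
  then show ?thesis
    using sum.image_gen[OF \<open>finite D\<close>, of "\<lambda>_. 1::nat" mset] by simp
qed

lemma edges_eq_mset_image:
  assumes "uniform_hypergraph_with_loops k H"
  shows "edges H = mset ` {vs \<in> tuples (verts H) k. mset vs \<in> edges H}"
proof
  show "edges H \<subseteq> mset ` {vs \<in> tuples (verts H) k. mset vs \<in> edges H}"
  proof
    fix E assume E: "E \<in> edges H"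
    obtain vs where vs: "mset vs = E" using ex_mset by blast
    have "size E = k" "set_mset E \<subseteq> verts H"
      using assms E by (auto simp: uniform_hypergraph_with_loops_def)
    then have "vs \<in> tuples (verts H) k" by (auto simp: tuples_def simp flip: vs)
    with vs E show "E \<in> mset ` {vs \<in> tuples (verts H) k. mset vs \<in> edges H}" by blast
  qed
qed blast

text \<open>Each edge that is not a loop has \<open>k!\<close> orderings, and there are at most as many loops as
  tuples with a repeated entry.\<close>

lemma fact_mult_card_edges_le:
  assumes uniform_H: "uniform_hypergraph_with_loops k H"
  shows "fact k * card (edges H) \<le> card {vs \<in> tuples (verts H) k. mset vs \<in> edges H}
    + fact k * card {vs \<in> tuples (verts H) k. \<not> distinct vs}"
proof -
  define T where "T = {vs \<in> tuples (verts H) k. mset vs \<in> edges H}"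
  define D where "D = {vs \<in> T. distinct vs}"
  define N where "N = {vs \<in> tuples (verts H) k. \<not> distinct vs}"
  have "finite (tuples (verts H) k)"
    using uniform_H by (simp add: uniform_hypergraph_with_loops_def)
  then have fin: "finite T" "finite D" "finite N" by (simp_all add: T_def D_def N_def)
  have "edges H = mset ` T" unfolding T_def by (rule edges_eq_mset_image[OF uniform_H])
  also have "\<dots> \<subseteq> mset ` D \<union> mset ` N" by (auto simp: T_def D_def N_def)
  finally have "card (edges H) \<le> card (mset ` D \<union> mset ` N)"
    using fin by (intro card_mono) auto
  also have "\<dots> \<le> card (mset ` D) + card (mset ` N)" by (rule card_Un_le)
  also have "card (mset ` N) \<le> card N" using fin(3) by (rule card_image_le)
  finally have "fact k * card (edges H) \<le> fact k * card (mset ` D) + fact k * card N"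
    by (simp flip: distrib_left)
  also have "fact k * card (mset ` D) = card D"
    using fin(2)
  proof (rule card_eq_fact_mult_card_mset_image[symmetric])
    fix us vs assume vs: "vs \<in> D" and eq: "mset us = mset vs"
    then show "us \<in> D"
      using mset_eq_setD[OF eq] mset_eq_length[OF eq] mset_eq_imp_distinct_iff[OF eq]
      by (simp add: D_def T_def tuples_def)
  qed (auto simp: D_def T_def tuples_def)
  also have "card D \<le> card T" using fin(1) by (rule card_mono) (auto simp: D_def)
  finally show ?thesis by (simp add: T_def N_def)
qed

lemma card_nondistinct_tuples:
  assumes "finite V" and "k \<le> card V"
  shows "real (card {vs \<in> tuples V k. \<not> distinct vs})
    = real (card V) ^ k - fact k * real (card V choose k)"
proof -
  have "{vs \<in> tuples V k. \<not> distinct vs} = tuples V k - {vs \<in> tuples V k. distinct vs}" by auto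
  moreover have "card {vs \<in> tuples V k. distinct vs} \<le> card (tuples V k)"
    using assms(1) by (intro card_mono) auto
  ultimately show ?thesis
    using assms by (simp add: card_Diff_subset of_nat_diff card_tuples card_distinct_tuples)
qed

lemma edge_density_le_kernel_density:
  assumes uniform_H: "uniform_hypergraph_with_loops (sum_list ks) H"
    and "verts H \<noteq> {}" and "sum_list ks \<le> card (verts H)"
  shows "edge_density (sum_list ks) H
    \<le> kernel_density (verts H) ks (normalized_kernel (sum_list ks) H)
      + fact (sum_list ks) * (1 - binomial_ratio (sum_list ks) (card (verts H)))"
proof -
  let ?k = "sum_list ks" and ?n = "real (card (verts H))"
  let ?T = "real (card {vs \<in> tuples (verts H) ?k. mset vs \<in> edges H})"
  have finite_H: "finite (verts H)" using uniform_H by (simp add: uniform_hypergraph_with_loops_def)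
  have n_pos: "?n > 0" using finite_H assms(2) by (simp add: card_gt_0_iff)
  have "fact ?k * real (card (edges H))
      \<le> ?T + fact ?k * real (card {vs \<in> tuples (verts H) ?k. \<not> distinct vs})"
    using of_nat_mono[OF fact_mult_card_edges_le[OF uniform_H], where 'a = real] by simp
  also have "\<dots> = ?T + fact ?k * (?n ^ ?k - fact ?k * real (card (verts H) choose ?k))"
    by (simp only: card_nondistinct_tuples[OF finite_H assms(3)])
  finally have "edge_density ?k H
      \<le> (?T + fact ?k * (?n ^ ?k - fact ?k * real (card (verts H) choose ?k))) / ?n ^ ?k"
    unfolding edge_density_def by (rule divide_right_mono) simp
  also have "\<dots> = ?T / ?n ^ ?k + fact ?k * (1 - binomial_ratio ?k (card (verts H)))"
    using n_pos by (simp add: binomial_ratio_def field_simps)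
  finally show ?thesis
    by (simp only: kernel_density_normalized_kernel[OF finite_H assms(2)])
qed

section \<open>Dense sequences of hypergraphs\<close>

lemma powr_half_eq_sqrt_power: "0 < n \<Longrightarrow> real n powr (real k / 2) = sqrt (real n) ^ k"
  using powr_powr[of "real n" "1 / 2" "real k"] by (simp add: powr_half_sqrt powr_realpow)

lemma smallo_powr_halfI:
  assumes "(\<lambda>n. f n / sqrt (real n) ^ k) \<longlonglongrightarrow> 0"
  shows "f \<in> o(\<lambda>n. real n powr (real k / 2))"
proof (rule smalloI_tendsto)
  have "\<forall>\<^sub>F n in sequentially. f n / sqrt (real n) ^ k = f n / real n powr (real k / 2)"
    using eventually_gt_at_top[of 0] by eventually_elim (simp add: powr_half_eq_sqrt_power)
  with assms show "(\<lambda>n. f n / real n powr (real k / 2)) \<longlonglongrightarrow> 0"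
    by (rule Lim_transform_eventually)
  show "\<forall>\<^sub>F n in sequentially. real n powr (real k / 2) \<noteq> 0"
    using eventually_gt_at_top[of 0] by eventually_elim simp
qed

locale dense_hypergraphs =
  fixes k :: nat and p :: real and H :: "nat \<Rightarrow> 'a hypergraph"
  assumes uniform: "uniform_hypergraph_with_loops k (H n)"
    and card_verts: "card (verts (H n)) = n"
    and card_edges_ge: "p * real (n choose k) \<le> real (card (edges (H n)))"
    and p_pos: "0 < p"
begin

lemma finite_verts: "finite (verts (H n))"
  using uniform[of n] by (simp add: uniform_hypergraph_with_loops_def)

lemma verts_nonempty: "0 < n \<Longrightarrow> verts (H n) \<noteq> {}"
  using card_verts[of n] by auto

lemma eventually_nonempty: "\<forall>\<^sub>F n in sequentially. finite (verts (H n)) \<and> verts (H n) \<noteq> {}"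
  using eventually_gt_at_top[of 0] by eventually_elim (simp add: finite_verts verts_nonempty)

lemma edge_density_ge: "p * binomial_ratio k n \<le> edge_density k (H n)"
proof -
  have "fact k * (p * real (n choose k)) / real n ^ k \<le> edge_density k (H n)"
    unfolding edge_density_def card_verts
    by (intro divide_right_mono mult_left_mono card_edges_ge) auto
  then show ?thesis by (simp add: binomial_ratio_def mult_ac)
qed

lemma edge_density_le:
  assumes "sum_list ks = k"
  shows "\<forall>\<^sub>F n in sequentially. edge_density k (H n)
    \<le> kernel_density (verts (H n)) ks (normalized_kernel k (H n))
      + fact k * (1 - binomial_ratio k n)"
  using eventually_ge_at_top[of "max 1 k"]
proof eventually_elim
  case (elim n)
  then show ?case
    using edge_density_le_kernel_density[of ks "H n"] uniform[of n] verts_nonempty[of n]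
    by (simp add: assms card_verts)
qed

lemma kernel_density_ge:
  assumes "sum_list ks = k"
  shows "\<forall>\<^sub>F n in sequentially. p - (p + fact k) * (1 - binomial_ratio k n)
    \<le> kernel_density (verts (H n)) ks (normalized_kernel k (H n))"
  using edge_density_le[OF assms]
proof eventually_elim
  case (elim n)
  with edge_density_ge[of n] show ?case by (simp add: algebra_simps)
qed

lemma cycle_sum_le:
  assumes "step_cycle ks m" and "sum_list ks = k"
  defines "v \<equiv> card (verts (hcycle ks m))"
  assumes "\<And>n. real (card (labeled_copies (hcycle ks m) (H n))) \<le> c * real n ^ v + err n"
  shows "\<forall>\<^sub>F n in sequentially. cycle_sum m (verts (H n)) ks (normalized_kernel k (H n))
    \<le> c + (err n / real n ^ v + real v ^ 2 / real n)"
  using eventually_gt_at_top[of 0]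
proof eventually_elim
  case (elim n)
  have "real (card (labeled_copies (hcycle ks m) (H n))) / real n ^ v
      \<le> (c * real n ^ v + err n) / real n ^ v"
    using assms(4) by (rule divide_right_mono) simp
  also have "\<dots> = c + err n / real n ^ v"
    using elim by (simp add: add_divide_distrib)
  finally show ?case
    using step_cycle.cycle_sum_normalized_kernel_le[OF assms(1) finite_verts
        verts_nonempty[OF elim]]
    by (simp add: assms(2) card_verts v_def)
qed

lemma edge_density_tendsto:
  assumes "sum_list ks = k"
    and "(\<lambda>n. deviation p (verts (H n)) ks (normalized_kernel k (H n))) \<longlonglongrightarrow> 0"
  shows "(\<lambda>n. edge_density k (H n)) \<longlonglongrightarrow> p"
proof (rule real_tendsto_sandwich)
  let ?dev = "\<lambda>n. deviation p (verts (H n)) ks (normalized_kernel k (H n))"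
  show "\<forall>\<^sub>F n in sequentially. p * binomial_ratio k n \<le> edge_density k (H n)"
    by (simp add: edge_density_ge)
  show "\<forall>\<^sub>F n in sequentially.
      edge_density k (H n) \<le> p + ?dev n + fact k * (1 - binomial_ratio k n)"
    using edge_density_le[OF assms(1)] eventually_gt_at_top[of 0]
  proof eventually_elim
    case (elim n)
    then show ?case
      using abs_kernel_density_diff_le_deviation[OF finite_verts verts_nonempty,
          of n ks "normalized_kernel k (H n)" p]
      by linarith
  qed
  have "(\<lambda>n. p * binomial_ratio k n) \<longlonglongrightarrow> p * 1"
    "(\<lambda>n. p + ?dev n + fact k * (1 - binomial_ratio k n)) \<longlonglongrightarrow> p + 0 + fact k * (1 - 1)"
    by (intro tendsto_intros binomial_ratio_tendsto_1 assms(2))+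
  then show "(\<lambda>n. p * binomial_ratio k n) \<longlonglongrightarrow> p"
    "(\<lambda>n. p + ?dev n + fact k * (1 - binomial_ratio k n)) \<longlonglongrightarrow> p" by simp_all
qed

lemma lambda1_tendsto:
  assumes "sum_list ks = k"
    and "(\<lambda>n. deviation p (verts (H n)) ks (normalized_kernel k (H n))) \<longlonglongrightarrow> 0"
  shows "(\<lambda>n. lambda1 ks (H n) / sqrt (real n) ^ k) \<longlonglongrightarrow> p"
proof (rule LIM_zero_cancel, rule Lim_null_comparison[OF _ assms(2)])
  show "\<forall>\<^sub>F n in sequentially. norm (lambda1 ks (H n) / sqrt (real n) ^ k - p)
      \<le> deviation p (verts (H n)) ks (normalized_kernel k (H n))"
    using eventually_gt_at_top[of 0]
  proof eventually_elim
    case (elim n)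
    then show ?case
      using abs_kernel_norm_diff_le_deviation[OF finite_verts verts_nonempty,
          of n p ks "normalized_kernel k (H n)"]
        kernel_norm_normalized_kernel[OF finite_verts verts_nonempty, of n ks] p_pos
      by (simp add: assms(1) card_verts)
  qed
qed

lemma lambda2_tendsto_0:
  assumes "sum_list ks = k"
    and "(\<lambda>n. deviation p (verts (H n)) ks (normalized_kernel k (H n))) \<longlonglongrightarrow> 0"
  shows "(\<lambda>n. lambda2 ks (H n) / sqrt (real n) ^ k) \<longlonglongrightarrow> 0"
proof (rule Lim_null_comparison)
  let ?dev = "\<lambda>q n. deviation q (verts (H n)) ks (normalized_kernel k (H n))"
  show "\<forall>\<^sub>F n in sequentially. norm (lambda2 ks (H n) / sqrt (real n) ^ k)
      \<le> ?dev p n + \<bar>p - edge_density k (H n)\<bar>"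
    using eventually_gt_at_top[of 0]
  proof eventually_elim
    case (elim n)
    note finite_nonempty = finite_verts verts_nonempty[OF elim]
    have "lambda2 ks (H n) / sqrt (real n) ^ k = ?dev (edge_density k (H n)) n"
      using deviation_normalized_kernel[OF finite_nonempty, of ks]
      by (simp add: assms(1) card_verts)
    then show ?case
      using deviation_nonneg[OF finite_nonempty] deviation_triangle[OF finite_nonempty] by simp
  qed
  have "(\<lambda>n. ?dev p n + \<bar>p - edge_density k (H n)\<bar>) \<longlonglongrightarrow> 0 + \<bar>p - p\<bar>"
    by (intro tendsto_intros assms(2) edge_density_tendsto[OF assms])
  then show "(\<lambda>n. ?dev p n + \<bar>p - edge_density k (H n)\<bar>) \<longlonglongrightarrow> 0" by simp
qed

lemma lambda_asymptotics:
  assumes same_parts: "sum_list ks = k" "mset ks = mset ks'"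
    and dev: "(\<lambda>n. deviation p (verts (H n)) ks (normalized_kernel k (H n))) \<longlonglongrightarrow> 0"
  shows "(\<lambda>n. lambda1 ks' (H n) - p * real n powr (real k / 2)) \<in> o(\<lambda>n. real n powr (real k / 2))"
    and "(\<lambda>n. lambda2 ks' (H n)) \<in> o(\<lambda>n. real n powr (real k / 2))"
proof -
  have "\<forall>\<^sub>F n in sequentially. lambda1 ks (H n) / sqrt (real n) ^ k - p
      = (lambda1 ks' (H n) - p * real n powr (real k / 2)) / sqrt (real n) ^ k"
    using eventually_gt_at_top[of 0]
  proof eventually_elim
    case (elim n)
    then show ?case
      using lambda1_cong_mset[OF finite_verts verts_nonempty same_parts(2), of n]
      by (simp add: powr_half_eq_sqrt_power diff_divide_distrib)
  qed
  with LIM_zero[OF lambda1_tendsto[OF same_parts(1) dev]]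
  have "(\<lambda>n. (lambda1 ks' (H n) - p * real n powr (real k / 2)) / sqrt (real n) ^ k) \<longlonglongrightarrow> 0"
    by (rule Lim_transform_eventually)
  then show "(\<lambda>n. lambda1 ks' (H n) - p * real n powr (real k / 2))
      \<in> o(\<lambda>n. real n powr (real k / 2))"
    by (rule smallo_powr_halfI)
  have "\<forall>\<^sub>F n in sequentially.
      lambda2 ks (H n) / sqrt (real n) ^ k = lambda2 ks' (H n) / sqrt (real n) ^ k"
    using eventually_gt_at_top[of 0]
    by eventually_elim (simp add: lambda2_cong_mset[OF finite_verts verts_nonempty same_parts(2)])
  with lambda2_tendsto_0[OF same_parts(1) dev]
  have "(\<lambda>n. lambda2 ks' (H n) / sqrt (real n) ^ k) \<longlonglongrightarrow> 0"
    by (rule Lim_transform_eventually)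
  then show "(\<lambda>n. lambda2 ks' (H n)) \<in> o(\<lambda>n. real n powr (real k / 2))"
    by (rule smallo_powr_halfI)
qed

end

theorem theorem1:
  fixes k l :: nat and p :: real and H :: "nat \<Rightarrow> 'a hypergraph"
    and \<pi> :: "nat multiset" and ks ks' :: "nat list" and err :: "nat \<Rightarrow> real"
  assumes "k \<ge> 2" and "0 < p" and "p < 1"
    and "\<And>n. uniform_hypergraph_with_loops k (H n)"
    and "\<And>n. card (verts (H n)) = n"
    and "\<And>n. real (card (edges (H n))) \<ge> p * real (n choose k)"
    and "proper_partition k \<pi>"
    and "mset ks = \<pi>" and "mset ks' = \<pi>"
    and "l \<ge> 1"
    and "err \<in> o(\<lambda>n. real n ^ card (verts (hcycle ks (2 * l))))"
    and "\<And>n. real (card (labeled_copies (hcycle ks (2 * l)) (H n)))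
               \<le> p ^ card (edges (hcycle ks (2 * l))) * real n ^ card (verts (hcycle ks (2 * l)))
                 + err n"
  shows "(\<lambda>n. lambda1 ks' (H n) - p * real n powr (real k / 2)) \<in> o(\<lambda>n. real n powr (real k / 2))
       \<and> (\<lambda>n. lambda2 ks' (H n)) \<in> o(\<lambda>n. real n powr (real k / 2))"
proof -
  let ?v = "card (verts (hcycle ks (2 * l)))"
  interpret dense_hypergraphs k p H
    by (rule dense_hypergraphs.intro) (fact assms)+
  have parts: "2 \<le> length ks" "\<And>j. j \<in> set ks \<Longrightarrow> 0 < j" "sum_list ks = k"
    using assms(7,8) by (auto simp: proper_partition_def sum_mset_sum_list)
  interpret step_cycle ks "2 * l"
    using parts \<open>l \<ge> 1\<close> by unfold_locales auto
  have edges: "card (edges (hcycle ks (2 * l))) = 2 * l * 2 ^ (length ks - 1)"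
    using \<open>l \<ge> 1\<close> by (intro card_edges_hcycle) simp
  have "(\<lambda>n. (p + fact k) * (1 - binomial_ratio k n)) \<longlonglongrightarrow> (p + fact k) * (1 - 1)"
    "(\<lambda>n. err n / real n ^ ?v + real ?v ^ 2 / real n) \<longlonglongrightarrow> 0 + 0"
    by (intro tendsto_intros binomial_ratio_tendsto_1 smalloD_tendsto assms(11) lim_const_over_n)+
  then have errors: "(\<lambda>n. (p + fact k) * (1 - binomial_ratio k n)) \<longlonglongrightarrow> 0"
    "(\<lambda>n. err n / real n ^ ?v + real ?v ^ 2 / real n) \<longlonglongrightarrow> 0" by simp_all
  have "(\<lambda>n. deviation p (verts (H n)) ks (normalized_kernel k (H n))) \<longlonglongrightarrow> 0"
    using eventually_nonempty assms(2,10) parts(1) kernel_density_ge[OF parts(3)] errors(1)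
      cycle_sum_le[OF step_cycle_axioms parts(3) assms(12), unfolded edges] errors(2)
    by (rule deviation_tendsto_0)
  then show ?thesis
    using lambda_asymptotics[OF parts(3), of ks'] assms(8,9) by simp
qed

end
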